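(* Let $n\ge1$. With the notation below, \[ \mathcal{F}rob_{{\mathfrak S}_n}( MHar_n ) = (q; q)_n \sum_{d=0}^{n} \frac{q^d}{\{ q;q\}_d}\, h_{(n-d,1^{d})}[X] \] and \[ \mathcal{F}rob_{{\mathfrak S}_n}( NCHar_n ) = \Big(\sum_{d=0}^{n} \frac{q^d }{\{ q;q\}_d} \Big)^{-1} \sum_{d=0}^{n} \frac{q^d }{ \{ q;q\}_d}\, h_{(n-d,1^{d})}[X]. \]
   Context: ${\mathbb Q}\langle X_n\rangle={\mathbb Q}\langle x_1,\dots,x_n\rangle$ is the algebra of polynomials in noncommuting variables, graded by degree, with ${\mathfrak S}_n$ acting by permuting variables. $NCSym_n$ is the subspace of ${\mathbb Q}\langle X_n\rangle$ of polynomials invariant under this action, and $\mathfrak M_n=\{p\in NCSym_n : p(0)=0\}$. For a variable $x$, the Hausdorff derivative $\partial_x$ sends a word $w$ to the sum of all subwords obtained from $w$ by deleting one occurrence of the letter $x$ (summed over occurrences), and the twisted derivative $d_x$ sends $w$ to $w'$ if $w=xw'$ and to $0$ otherwise; both are extended linearly. For $p\in{\mathbb Q}\langle X_n\rangle$, $p(\partial_{X_n})$ (resp. $p(d_{X_n})$) is the operator obtained by replacing each $x_i$ in $p$ by $\partial_{x_i}$ (resp. $d_{x_i}$), products becoming compositions. Define $MHar_n=\{f\in{\mathbb Q}\langle X_n\rangle : p(\partial_{X_n})f=0 \text{ for all } p\in\mathfrak M_n\}$ and $NCHar_n=\{f\in{\mathbb Q}\langle X_n\rangle : p(d_{X_n})f=0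 \text{ for all } p\in\mathfrak M_n\}$, graded ${\mathfrak S}_n$-submodules of ${\mathbb Q}\langle X_n\rangle$. The graded Frobenius characteristic of a graded ${\mathfrak S}_n$-module $M=\bigoplus_k M_k$ is $\sum_k q^k\mathcal{F}rob(M_k)$, with $\mathcal{F}rob$ the Frobenius characteristic map to symmetric functions. $h_{(n-d,1^d)}=h_{n-d}h_1^d$ (complete homogeneous symmetric functions), $(q;q)_n=(1-q)(1-q^2)\cdots(1-q^n)$, $\{q;q\}_d=(1-q)(1-2q)\cdots(1-dq)$; rational functions in $q$ are expanded as power series. *)

theory Defs
  imports
    "HOL-Library.Poly_Mapping"
    "HOL-Computational_Algebra.Formal_Power_Series"
    "HOL-Combinatorics.Permutations"
    "HOL-Combinatorics.Orbits"
begin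

section \<open>Symmetric functions\<close>

text \<open>
  Symmetric functions in the alphabet \<open>X = {X\<^sub>0, X\<^sub>1, \<dots>}\<close> are viewed inside the ring of formal
  power series in countably many commuting variables; a monomial is its exponent vector.
\<close>

typedef 'a mpseries = "UNIV :: ((nat \<Rightarrow>\<^sub>0 nat) \<Rightarrow> 'a) set"
  morphisms mp_coeff Abs_mpseries ..

setup_lifting type_definition_mpseries

lemma mpseries_eqI: "(\<And>m. mp_coeff f m = mp_coeff g m) \<Longrightarrow> f = g"
  by (metis mp_coeff_inject ext)

lemma finite_exponents_below:
  fixes m :: "nat \<Rightarrow>\<^sub>0 nat"
  shows "finite {a. \<forall>i. Poly_Mapping.lookup a i \<le> Poly_Mapping.lookup m i}"
proof -
  let ?K = "Poly_Mapping.keys m"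
  let ?S = "{a. \<forall>i. Poly_Mapping.lookup a i \<le> Poly_Mapping.lookup m i}"
  let ?N = "\<Sum>j\<in>?K. Poly_Mapping.lookup m j"
  let ?F = "{f. \<forall>i. (i \<in> ?K \<longrightarrow> f i \<in> {..?N}) \<and> (i \<notin> ?K \<longrightarrow> f i = 0)}"
  have le: "Poly_Mapping.lookup a i \<le> ?N" if "a \<in> ?S" "i \<in> ?K" for a i
  proof -
    have "Poly_Mapping.lookup a i \<le> Poly_Mapping.lookup m i"
      using that by simp
    also have "\<dots> \<le> ?N"
      using that by (intro member_le_sum) auto
    finally show ?thesis .
  qed
  have eq0: "Poly_Mapping.lookup a i = 0" if "a \<in> ?S" "i \<notin> ?K" for a i
  proof -
    have "Poly_Mapping.lookup a i \<le> Poly_Mapping.lookup m i"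
      using that by simp
    then show ?thesis
      using that by (simp add: in_keys_iff)
  qed
  have "Poly_Mapping.lookup a \<in> ?F" if "a \<in> ?S" for a
    using le[OF that] eq0[OF that] unfolding mem_Collect_eq atMost_iff by blast
  then have "Poly_Mapping.lookup ` ?S \<subseteq> ?F"
    by (rule image_subsetI)
  moreover have "finite ?F"
    by (rule finite_set_of_finite_funs) (rule finite_keys, rule finite_atMost)
  ultimately have "finite (Poly_Mapping.lookup ` ?S)"
    by (rule finite_subset)
  moreover have "inj_on Poly_Mapping.lookup ?S"
    by (rule inj_onI) (rule poly_mapping_eqI, simp)
  ultimately show ?thesis
    by (rule finite_imageD)
qed

lemma finite_splits [simp]: "finite {(a, b). a + b = (m :: nat \<Rightarrow>\<^sub>0 nat)}"
proof (rule finite_subset)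
  let ?S = "{a. \<forall>i. Poly_Mapping.lookup a i \<le> Poly_Mapping.lookup m i}"
  show "{(a, b). a + b = m} \<subseteq> ?S \<times> ?S"
    by (auto simp: lookup_add)
  show "finite (?S \<times> ?S)"
    by (intro finite_cartesian_product finite_exponents_below)
qed

lemma finite_splits' [simp]: "finite {p. fst p + snd p = (m :: nat \<Rightarrow>\<^sub>0 nat)}"
  using finite_splits[of m] by (simp only: case_prod_unfold)

instantiation mpseries :: (comm_ring_1) comm_ring_1
begin

lift_definition zero_mpseries :: "'a mpseries" is "\<lambda>_. 0" .
lift_definition one_mpseries :: "'a mpseries" is "\<lambda>m. if m = 0 then 1 else 0" .
lift_definition plus_mpseries :: "'a mpseries \<Rightarrow> 'a mpseries \<Rightarrow> 'a mpseries"
  is "\<lambda>f g m. f m + g m" .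
lift_definition minus_mpseries :: "'a mpseries \<Rightarrow> 'a mpseries \<Rightarrow> 'a mpseries"
  is "\<lambda>f g m. f m - g m" .
lift_definition uminus_mpseries :: "'a mpseries \<Rightarrow> 'a mpseries"
  is "\<lambda>f m. - f m" .
lift_definition times_mpseries :: "'a mpseries \<Rightarrow> 'a mpseries \<Rightarrow> 'a mpseries"
  is "\<lambda>f g m. \<Sum>(a, b) | a + b = m. f a * g b" .

instance
proof
  fix f g h :: "'a mpseries"
  show "f + g + h = f + (g + h)" by transfer (simp add: add.assoc)
  show "f + g = g + f" by transfer (simp add: add.commute)
  show "0 + f = f" by transfer simp
  show "- f + f = 0" by transfer simp
  show "f - g = f + - g" by transfer simp
  show "(0 :: 'a mpseries) \<noteq> 1" by transfer (metis zero_neq_one)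
  show "f * g = g * f"
    by transfer (auto simp: fun_eq_iff add.commute mult.commute
        intro!: sum.reindex_bij_witness[where i = prod.swap and j = prod.swap])
  show "(f + g) * h = f * h + g * h"
    by transfer (simp add: fun_eq_iff distrib_right sum.distrib case_prod_unfold)
  show "1 * f = f"
  proof transfer
    fix f :: "(nat \<Rightarrow>\<^sub>0 nat) \<Rightarrow> 'a"
    show "(\<lambda>m. \<Sum>(a, b) | a + b = m. (if a = 0 then 1 else 0) * f b) = f"
    proof
      fix m :: "nat \<Rightarrow>\<^sub>0 nat"
      have "(\<Sum>(a, b) | a + b = m. (if a = 0 then 1 else 0) * f b)
          = (\<Sum>(a, b) \<in> {(0 :: nat \<Rightarrow>\<^sub>0 nat, m)}. (if a = 0 then 1 else 0) * f b)"
        by (rule sum.mono_neutral_right) (auto split: if_splits)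
      then show "(\<Sum>(a, b) | a + b = m. (if a = 0 then 1 else 0) * f b) = f m"
        by simp
    qed
  qed
  show "f * g * h = f * (g * h)"
  proof transfer
    fix f g h :: "(nat \<Rightarrow>\<^sub>0 nat) \<Rightarrow> 'a"
    show "(\<lambda>m. \<Sum>(s, c) | s + c = m. (\<Sum>(a, b) | a + b = s. f a * g b) * h c)
        = (\<lambda>m. \<Sum>(a, t) | a + t = m. f a * (\<Sum>(b, c) | b + c = t. g b * h c))"
    proof
      fix m :: "nat \<Rightarrow>\<^sub>0 nat"
      have "(\<Sum>(s, c) | s + c = m. (\<Sum>(a, b) | a + b = s. f a * g b) * h c)
          = (\<Sum>(x, y) \<in> (SIGMA x : {(s, c). s + c = m}. {(a, b). a + b = fst x}).
               f (fst y) * g (snd y) * h (snd x))"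
        by (subst sum.Sigma [symmetric]) (auto simp: sum_distrib_right case_prod_unfold)
      also have "\<dots> = (\<Sum>(x, y) \<in> (SIGMA x : {(a, t). a + t = m}. {(b, c). b + c = snd x}).
               f (fst x) * (g (fst y) * h (snd y)))"
        by (rule sum.reindex_bij_witness
            [where i = "\<lambda>(x, y). ((fst x + fst y, snd y), (fst x, fst y))"
              and j = "\<lambda>(x, y). ((fst y, snd y + snd x), (snd y, snd x))"])
          (auto simp: add.assoc mult.assoc)
      also have "\<dots> = (\<Sum>(a, t) | a + t = m. f a * (\<Sum>(b, c) | b + c = t. g b * h c))"
        by (subst sum.Sigma [symmetric]) (auto simp: sum_distrib_left case_prod_unfold)
      finally show "(\<Sum>(s, c) | s + c = m. (\<Sum>(a, b) | a + b = s. f a * g b) * h c)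
          = (\<Sum>(a, t) | a + t = m. f a * (\<Sum>(b, c) | b + c = t. g b * h c))" .
    qed
  qed
qed

end

text \<open>Constants, used to multiply a symmetric function by a scalar.\<close>

definition mp_const :: "'a::comm_ring_1 \<Rightarrow> 'a mpseries"
  where "mp_const c = Abs_mpseries (\<lambda>m. if m = 0 then c else 0)"

definition mdeg :: "(nat \<Rightarrow>\<^sub>0 nat) \<Rightarrow> nat"
  where "mdeg m = (\<Sum>i\<in>Poly_Mapping.keys m. Poly_Mapping.lookup m i)"

definition complete_h :: "nat \<Rightarrow> 'a::comm_ring_1 mpseries"
  where "complete_h k = Abs_mpseries (\<lambda>m. if mdeg m = k then 1 else 0)"

text \<open>The power sum \<open>\<Sum>\<^sub>i X\<^sub>i\<^sup>k\<close>, only meant for \<open>k \<ge> 1\<close>.\<close>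

definition power_p :: "nat \<Rightarrow> 'a::comm_ring_1 mpseries"
  where "power_p k = Abs_mpseries (\<lambda>m. if \<exists>i. m = Poly_Mapping.single i k then 1 else 0)"

section \<open>Frobenius characteristic\<close>

text \<open>The power sum \<open>p\<^sub>\<lambda>\<close> for \<open>\<lambda>\<close> the cycle type of the permutation \<open>\<sigma>\<close> of \<open>{1..n}\<close>.\<close>

definition power_cycle :: "nat \<Rightarrow> (nat \<Rightarrow> nat) \<Rightarrow> 'a::comm_ring_1 mpseries"
  where "power_cycle n \<sigma> = (\<Prod>C \<in> orbit \<sigma> ` {1..n}. power_p (card C))"

context vector_space
begin

text \<open>
  Trace of the restriction of \<open>T\<close> to a finite-dimensional \<open>T\<close>-invariant subspace \<open>V\<close>,
  computed in an arbitrarily chosen basis.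
\<close>

definition trace_on :: "'b set \<Rightarrow> ('b \<Rightarrow> 'b) \<Rightarrow> 'a"
  where "trace_on V T =
    (let B = (SOME B. independent B \<and> span B = V) in \<Sum>b\<in>B. representation B (T b) b)"

text \<open>
  Here \<open>act\<close> is meant to be an action of the permutations of \<open>{1..n}\<close> under which the finite-dimensional
  subspace \<open>V\<close> is stable.
\<close>

definition Frob :: "nat \<Rightarrow> ((nat \<Rightarrow> nat) \<Rightarrow> 'b \<Rightarrow> 'b) \<Rightarrow> 'b set \<Rightarrow> 'a mpseries"
  where "Frob n act V =
    mp_const (1 / of_nat (fact n)) *
    (\<Sum>\<sigma> | \<sigma> permutes {1..n}. mp_const (local.trace_on V (act \<sigma>)) * power_cycle n \<sigma>)"

text \<open>
  The graded characteristic \<open>\<Sum>\<^sub>k q\<^sup>k Frob (V k)\<close>, written as a symmetric function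
  with coefficients that are power series in \<open>q\<close>.
\<close>

definition graded_Frob ::
    "nat \<Rightarrow> ((nat \<Rightarrow> nat) \<Rightarrow> 'b \<Rightarrow> 'b) \<Rightarrow> (nat \<Rightarrow> 'b set) \<Rightarrow> 'a fps mpseries"
  where "graded_Frob n act V =
    Abs_mpseries (\<lambda>m. Abs_fps (\<lambda>k. mp_coeff (local.Frob n act (V k)) m))"

end

section \<open>Polynomials in noncommuting variables\<close>

text \<open>The word \<open>[i\<^sub>1, \<dots>, i\<^sub>k]\<close> stands for the monomial \<open>x\<^bsub>i\<^sub>1\<^esub> \<cdots> x\<^bsub>i\<^sub>k\<^esub>\<close>.\<close>

type_synonym ncpoly = "nat list \<Rightarrow>\<^sub>0 rat"

abbreviation word :: "nat list \<Rightarrow> ncpoly"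
  where "word w \<equiv> Poly_Mapping.single w 1"

definition nc_scale :: "rat \<Rightarrow> ncpoly \<Rightarrow> ncpoly"
  where "nc_scale c = Poly_Mapping.map (\<lambda>a. c * a)"

lemma lookup_nc_scale [simp]:
  "Poly_Mapping.lookup (nc_scale c f) w = c * Poly_Mapping.lookup f w"
  by (simp add: nc_scale_def Poly_Mapping.map.rep_eq when_def)

global_interpretation nc: vector_space nc_scale
  by unfold_locales
    (auto intro!: poly_mapping_eqI simp: lookup_add algebra_simps)

definition NCPoly :: "nat \<Rightarrow> ncpoly set"
  where "NCPoly n = {f. \<forall>w\<in>Poly_Mapping.keys f. set w \<subseteq> {1..n}}"

definition nc_homogeneous :: "nat \<Rightarrow> ncpoly set"
  where "nc_homogeneous k = {f. \<forall>w\<in>Poly_Mapping.keys f. length w = k}"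

definition lin_ext :: "(nat list \<Rightarrow> ncpoly) \<Rightarrow> ncpoly \<Rightarrow> ncpoly"
  where "lin_ext \<phi> f = (\<Sum>w\<in>Poly_Mapping.keys f. nc_scale (Poly_Mapping.lookup f w) (\<phi> w))"

definition permute_vars :: "(nat \<Rightarrow> nat) \<Rightarrow> ncpoly \<Rightarrow> ncpoly"
  where "permute_vars \<sigma> = lin_ext (\<lambda>w. word (map \<sigma> w))"

definition NCSym :: "nat \<Rightarrow> ncpoly set"
  where "NCSym n = {f \<in> NCPoly n. \<forall>\<sigma>. \<sigma> permutes {1..n} \<longrightarrow> permute_vars \<sigma> f = f}"

definition NCSym0 :: "nat \<Rightarrow> ncpoly set"
  where "NCSym0 n = {p \<in> NCSym n. Poly_Mapping.lookup p [] = 0}"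

definition hausdorff_deriv :: "nat \<Rightarrow> ncpoly \<Rightarrow> ncpoly"
  where "hausdorff_deriv x =
    lin_ext (\<lambda>w. \<Sum>i | i < length w \<and> w ! i = x. word (take i w @ drop (Suc i) w))"

definition twisted_deriv :: "nat \<Rightarrow> ncpoly \<Rightarrow> ncpoly"
  where "twisted_deriv x =
    lin_ext (\<lambda>w. case w of [] \<Rightarrow> 0 | y # w' \<Rightarrow> if y = x then word w' else 0)"

text \<open>
  \<open>poly_op D p\<close> is \<open>p\<close> with each variable \<open>x\<^sub>i\<close> replaced by the operator \<open>D i\<close>; the word
  \<open>[i\<^sub>1, \<dots>, i\<^sub>k]\<close> becomes \<open>D i\<^sub>1 \<circ> \<cdots> \<circ> D i\<^sub>k\<close>, in this order.
\<close>

definition poly_op :: "(nat \<Rightarrow> ncpoly \<Rightarrow> ncpoly) \<Rightarrow> ncpoly \<Rightarrow> ncpoly \<Rightarrow> ncpoly"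
  where "poly_op D p f =
    (\<Sum>w\<in>Poly_Mapping.keys p. nc_scale (Poly_Mapping.lookup p w) (foldr D w f))"

definition MHar :: "nat \<Rightarrow> ncpoly set"
  where "MHar n = {f \<in> NCPoly n. \<forall>p\<in>NCSym0 n. poly_op hausdorff_deriv p f = 0}"

definition NCHar :: "nat \<Rightarrow> ncpoly set"
  where "NCHar n = {f \<in> NCPoly n. \<forall>p\<in>NCSym0 n. poly_op twisted_deriv p f = 0}"

definition nc_graded_Frob :: "nat \<Rightarrow> ncpoly set \<Rightarrow> rat fps mpseries"
  where "nc_graded_Frob n M = nc.graded_Frob n permute_vars (\<lambda>k. M \<inter> nc_homogeneous k)"

section \<open>Products in \<open>q\<close>\<close>

definition qpoch :: "nat \<Rightarrow> rat fps"
  where "qpoch n = (\<Prod>i=1..n. 1 - fps_X ^ i)"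

definition qbrace :: "nat \<Rightarrow> rat fps"
  where "qbrace d = (\<Prod>i=1..d. 1 - of_nat i * fps_X)"

end

theory Submission
  imports Defs
begin

text \<open>
  Both characteristics come from a computation of the graded traces of a permutation \<open>\<sigma>\<close>.
  On the full algebra the trace series is \<open>1 / (1 - f q)\<close>, where \<open>f\<close> is the number of fixed
  points of \<open>\<sigma>\<close>; expanding it as \<open>\<Sum>\<^sub>d f (f - 1) \<cdots> (f - d + 1) q\<^sup>d / {q;q}\<^sub>d\<close> and
  averaging against power sums gives \<open>\<Sum>\<^sub>d q\<^sup>d / {q;q}\<^sub>d h\<^bsub>n-d\<^esub> h\<^sub>1\<^sup>d\<close>. It remains to show that
  passing to \<open>NCHar\<close> divides the trace by the Hilbert series of \<open>NCSym\<close>, and that passing to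
  \<open>MHar\<close> multiplies it by \<open>(q;q)\<^sub>n\<close>.

  For \<open>NCHar\<close>, order words of equal length so that the last letter is the most significant one,
  and let \<open>L\<close> be the set of words that are minimal in their orbit. \<open>L\<close> is closed under
  concatenation and under suffixes, hence every word is uniquely \<open>l c\<close> with \<open>l \<in> L\<close> and \<open>c\<close>
  without nonempty prefix in \<open>L\<close>. By triangularity the products (orbit sum of \<open>l\<close>) \<open>\<cdot> c\<close>
  form a basis, so that the algebra is free over \<open>NCSym\<close> on the words \<open>c\<close>.

  For \<open>MHar\<close>, the Hausdorff derivatives commute and, with the left multiplications, satisfy the
  Weyl relations. \<open>MHar\<close> is the common kernel of the power sums \<open>p\<^sub>1, \<dots>, p\<^sub>n\<close> of the derivatives,
  and each \<open>p\<^sub>i\<close> is surjective on the kernel of the previous ones: the Weyl relations give the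
  bound \<open>(q;q)\<^sub>n H\<close> for the Hilbert series of \<open>MHar\<close> (with \<open>H\<close> that of the full algebra),
  through the triangular system \<open>h\<^sub>i(\<partial>\<^sub>1, \<dots>, \<partial>\<^sub>m)\<close>, \<open>i > n - m\<close>, and any failure of surjectivity would
  exceed it.
\<close>

section \<open>Traces\<close>

text \<open>\<open>Frob\<close> only sees traces, so no module is ever decomposed: for each \<sigma>
  a series of traces is computed, using additivity on exact sequences.

  For \<open>NCHar\<close>, freeness is used in dual form. The harmonics are the orthogonal
  complement of the right ideal generated by the symmetric polynomials without constant term, so
  they are spanned by the vectors of the dual basis attached to the words c. The trace factorises
  because the diagonal entry of \<sigma> at a word l c depends on c alone.

  For \<open>MHar\<close>, the obstacle is that the algebra is not a polynomial ring, so coinvariant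
  theory does not apply to it directly. The Weyl relations replace it: they give Taylor expansion in
  one letter at a time. The system of the \<open>h_i\<close> plays the role of a Groebner basis: its
  equations for m variables can be solved for the power n - m + 1 of the m-th derivative, which
  leaves the exponents 0, ..., n - m and hence a factor (1 - q^(n-m+1)) / (1 - q). Only an
  inequality of dimensions is needed from it. Surjectivity of the power sums is thus settled with
  \<sigma> = id; it then holds as a statement about stable subspaces and serves the traces of all
  \<sigma>.\<close>

context vector_space
begin

text \<open>The family \<open>b\<close> need not be independent: inserting the expansions into the trace in the chosen
  basis and exchanging the two sums is enough.\<close>

lemma trace_on_frame:
  assumes V: "subspace V" and I: "finite I"
    and b: "\<And>i. i \<in> I \<Longrightarrow> b i \<in> V"
    and frame: "\<And>x. x \<in> V \<Longrightarrow> x = (\<Sum>i\<in>I. scale (l i x) (b i))"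
    and l_add: "\<And>i x y. i \<in> I \<Longrightarrow> x \<in> V \<Longrightarrow> y \<in> V \<Longrightarrow> l i (x + y) = l i x + l i y"
    and l_scale: "\<And>i c x. i \<in> I \<Longrightarrow> x \<in> V \<Longrightarrow> l i (scale c x) = c * l i x"
    and T: "module_hom scale scale T" and TV: "\<And>x. x \<in> V \<Longrightarrow> T x \<in> V"
  shows "trace_on V T = (\<Sum>i\<in>I. l i (T (b i)))"
proof -
  define B where "B = (SOME B. independent B \<and> span B = V)"
  obtain B' where "B' \<subseteq> V" "independent B'" "V \<subseteq> span B'"
    by (rule maximal_independent_subset[of V])
  then have "\<exists>B. independent B \<and> span B = V"
    using V by (meson span_minimal subset_antisym)
  then have B: "independent B" "span B = V"
    unfolding B_def by (metis (mono_tags, lifting) someI_ex)+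
  have "V \<subseteq> span (b ` I)"
  proof
    fix x assume "x \<in> V"
    moreover have "(\<Sum>i\<in>I. scale (l i x) (b i)) \<in> span (b ` I)"
      by (intro span_sum span_scale span_base) auto
    ultimately show "x \<in> span (b ` I)" using frame by metis
  qed
  then have fin: "finite B"
    using independent_span_bound[of "b ` I" B] I B span_superset by blast
  have l0: "l i 0 = 0" if "i \<in> I" for i
    using l_scale[OF that, of 0 0] V by (simp add: subspace_0)
  have l_sum: "l i (\<Sum>j\<in>J. scale (c j) (g j)) = (\<Sum>j\<in>J. c j * l i (g j))"
    if "i \<in> I" "\<And>j. j \<in> J \<Longrightarrow> g j \<in> V" "finite J" for i J c and g :: "'x \<Rightarrow> 'b"
    using that(3) that(2)
    by (induction J) (auto simp: l0 that(1) l_add l_scale subspace_sum subspace_scale V)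
  have BV: "v \<in> V" if "v \<in> B" for v using that B span_base by blast
  have rep: "x = (\<Sum>v\<in>B. scale (representation B x v) v)" if "x \<in> V" for x
    using sum_representation_eq[OF B(1) _ fin, of x] that B(2) by simp
  have "trace_on V T = (\<Sum>v\<in>B. representation B (T v) v)"
    by (simp add: trace_on_def B_def Let_def)
  also have "\<dots> = (\<Sum>v\<in>B. representation B (\<Sum>i\<in>I. scale (l i (T v)) (b i)) v)"
    using frame TV BV by (intro sum.cong refl) metis
  also have "\<dots> = (\<Sum>v\<in>B. \<Sum>i\<in>I. l i (T v) * representation B (b i) v)"
    using b B by (intro sum.cong refl)
      (simp add: representation_sum representation_scale subspace_scale V)
  also have "\<dots> = (\<Sum>i\<in>I. \<Sum>v\<in>B. representation B (b i) v * l i (T v))"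
    by (subst sum.swap) (simp add: mult.commute)
  also have "\<dots> = (\<Sum>i\<in>I. l i (\<Sum>v\<in>B. scale (representation B (b i) v) (T v)))"
    using fin BV TV by (intro sum.cong refl, subst l_sum) auto
  also have "\<dots> = (\<Sum>i\<in>I. l i (T (\<Sum>v\<in>B. scale (representation B (b i) v) v)))"
    by (simp add: module_hom.sum[OF T] module_hom.scale[OF T])
  also have "\<dots> = (\<Sum>i\<in>I. l i (T (b i)))"
    using rep b by (intro sum.cong refl) metis
  finally show ?thesis .
qed

lemma trace_on_basis:
  assumes "independent B" "finite B" "span B = V"
    and "module_hom scale scale T" "\<And>x. x \<in> V \<Longrightarrow> T x \<in> V"
  shows "trace_on V T = (\<Sum>v\<in>B. representation B (T v) v)"
proof (rule trace_on_frame[where b = "\<lambda>v. v" and l = "\<lambda>v x. representation B x v"])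
  show "x = (\<Sum>v\<in>B. scale (representation B x v) v)" if "x \<in> V" for x
    using sum_representation_eq[of B x B] that assms by simp
qed (use assms in \<open>auto simp: span_base representation_add representation_scale\<close>)

lemma trace_on_id:
  assumes "independent B" "finite B" "span B = V"
  shows "trace_on V (\<lambda>x. x) = of_nat (card B)"
proof -
  have "trace_on V (\<lambda>x. x) = (\<Sum>v\<in>B. representation B v v)"
    using assms by (intro trace_on_basis) (auto simp: module_hom_id[unfolded id_def] linear_id module_hom_iff_linear)
  also have "\<dots> = (\<Sum>v\<in>B. 1)"
    using assms(1) by (intro sum.cong refl) (simp add: representation_basis)
  finally show ?thesis by simp
qed

lemma finite_basis_exists:
  assumes "subspace V" "finite W" "V \<subseteq> span W"
  obtains B where "independent B" "finite B" "span B = V"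
proof -
  obtain B where B: "B \<subseteq> V" "independent B" "V \<subseteq> span B"
    by (rule maximal_independent_subset[of V])
  have "finite B"
    using independent_span_bound[OF assms(2) B(2)] assms(3) B(1) by auto
  moreover have "span B = V"
    using B assms(1) by (meson span_minimal subset_antisym)
  ultimately show thesis by (rule that[OF B(2)])
qed

text \<open>A basis of the kernel together with lifts of a basis of the image is a frame of
  \<open>V\<close>, in which \<open>T\<close> is block triangular.\<close>

lemma trace_on_exact:
  assumes V: "subspace V" "finite W" "V \<subseteq> span W"
    and T: "module_hom scale scale T" and phi: "module_hom scale scale \<phi>"
    and TV: "\<And>x. x \<in> V \<Longrightarrow> T x \<in> V"
    and comm: "\<And>x. x \<in> V \<Longrightarrow> \<phi> (T x) = T (\<phi> x)"
  shows "trace_on V T = trace_on {x \<in> V. \<phi> x = 0} T + trace_on (\<phi> ` V) T"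
proof -
  let ?K = "{x \<in> V. \<phi> x = 0}" and ?U = "\<phi> ` V"
  have K: "subspace ?K"
    using V(1) phi by (auto simp: subspace_def module_hom.add[OF phi] module_hom.scale[OF phi] module_hom.zero[OF phi])
  have U: "subspace ?U"
    using module_hom.subspace_image[OF phi V(1)] .
  have KV: "?K \<subseteq> span W" using V(3) by blast
  have UV: "?U \<subseteq> span (\<phi> ` W)"
    using V(3) module_hom.span_image[OF phi, of W] by blast
  obtain A where A: "independent A" "finite A" "span A = ?K"
    using finite_basis_exists[OF K V(2) KV] .
  obtain B where B: "independent B" "finite B" "span B = ?U"
    using finite_basis_exists[OF U _ UV] V(2) by blast
  have "\<forall>v\<in>B. \<exists>c. c \<in> V \<and> \<phi> c = v"
  proof
    fix v assume "v \<in> B"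
    then have "v \<in> ?U" using B span_base by blast
    then show "\<exists>c. c \<in> V \<and> \<phi> c = v" by blast
  qed
  then obtain c where c: "\<And>v. v \<in> B \<Longrightarrow> c v \<in> V" "\<And>v. v \<in> B \<Longrightarrow> \<phi> (c v) = v"
    by metis
  \<comment> \<open>Subtracting the chosen lifts \<open>c v\<close> projects \<open>V\<close> onto
    the kernel.\<close>
  define pr where "pr x = x - (\<Sum>v\<in>B. scale (representation B (\<phi> x) v) (c v))" for x
  have prK: "pr x \<in> ?K" if "x \<in> V" for x
  proof -
    have "pr x \<in> V"
      unfolding pr_def using that c V(1) by (intro subspace_diff subspace_sum subspace_scale) auto
    moreover have "\<phi> (pr x) = \<phi> x - (\<Sum>v\<in>B. scale (representation B (\<phi> x) v) v)"
      using c(2) by (simp add: pr_def module_hom.diff[OF phi] module_hom.sum[OF phi] module_hom.scale[OF phi])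
    moreover have "\<phi> x = (\<Sum>v\<in>B. scale (representation B (\<phi> x) v) v)"
      using sum_representation_eq[of B "\<phi> x" B] B that by simp
    ultimately show ?thesis by simp
  qed
  have repB_add: "representation B (\<phi> (x + y)) v = representation B (\<phi> x) v + representation B (\<phi> y) v"
    if "x \<in> V" "y \<in> V" for x y v
    using that B by (simp add: module_hom.add[OF phi] representation_add)
  have repB_scale: "representation B (\<phi> (scale k x)) v = k * representation B (\<phi> x) v"
    if "x \<in> V" for x v k
    using that B by (simp add: module_hom.scale[OF phi] representation_scale)
  have pr_add: "pr (x + y) = pr x + pr y" if "x \<in> V" "y \<in> V" for x y
    unfolding pr_def by (simp add: repB_add[OF that] algebra_simps sum.distrib)
  have pr_scale: "pr (scale k x) = scale k (pr x)" if "x \<in> V" for x k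
    unfolding pr_def by (simp add: repB_scale[OF that] algebra_simps scale_sum_right)
  \<comment> \<open>Indexing by a disjoint sum avoids comparing kernel vectors with lifts as
    elements of the space.\<close>
  define l where "l i x = (case i of Inl a \<Rightarrow> representation A (pr x) a | Inr v \<Rightarrow> representation B (\<phi> x) v)" for i x
  have TK: "T x \<in> ?K" if "x \<in> ?K" for x
    using that TV comm module_hom.zero[OF T] by auto
  have TU: "T x \<in> ?U" if "x \<in> ?U" for x
  proof -
    obtain y where y: "y \<in> V" "x = \<phi> y" using \<open>x \<in> ?U\<close> by blast
    then have "T x = \<phi> (T y)" using comm by simp
    then show ?thesis using y TV by blast
  qed
  have "trace_on V T = (\<Sum>i\<in>A <+> B. l i (T (case i of Inl a \<Rightarrow> a | Inr v \<Rightarrow> c v)))"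
  proof (rule trace_on_frame[OF V(1) _ _ _ _ _ T TV])
    show "finite (A <+> B)" using A B by simp
    show "(case i of Inl a \<Rightarrow> a | Inr v \<Rightarrow> c v) \<in> V" if "i \<in> A <+> B" for i
    proof (cases i)
      case (Inl a)
      then have "a \<in> ?K" using that A span_base[of a A] by auto
      then show ?thesis using Inl by simp
    qed (use that c in auto)
    show "x = (\<Sum>i\<in>A <+> B. scale (l i x) (case i of Inl a \<Rightarrow> a | Inr v \<Rightarrow> c v))" if "x \<in> V" for x
    proof -
      have "(\<Sum>i\<in>A <+> B. scale (l i x) (case i of Inl a \<Rightarrow> a | Inr v \<Rightarrow> c v))
          = (\<Sum>a\<in>A. scale (representation A (pr x) a) a) + (\<Sum>v\<in>B. scale (representation B (\<phi> x) v) (c v))"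
        using A B by (simp add: sum.Plus l_def)
      also have "(\<Sum>a\<in>A. scale (representation A (pr x) a) a) = pr x"
        using sum_representation_eq[of A "pr x" A] A prK[OF that] by simp
      finally show ?thesis by (simp add: pr_def)
    qed
    show "l i (x + y) = l i x + l i y" if "i \<in> A <+> B" "x \<in> V" "y \<in> V" for i x y
      using that A prK by (auto simp: l_def pr_add repB_add representation_add)
    show "l i (scale k x) = k * l i x" if "i \<in> A <+> B" "x \<in> V" for i x k
      using that A prK by (auto simp: l_def pr_scale repB_scale representation_scale)
  qed
  also have "\<dots> = (\<Sum>a\<in>A. representation A (pr (T a)) a) + (\<Sum>v\<in>B. representation B (\<phi> (T (c v))) v)"
    using A B by (simp add: sum.Plus l_def)
  \<comment> \<open>\<open>T\<close> preserves the kernel, so \<open>pr\<close> does nothing to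
    \<open>T a\<close>.\<close>
  also have "(\<Sum>a\<in>A. representation A (pr (T a)) a) = (\<Sum>a\<in>A. representation A (T a) a)"
  proof (intro sum.cong refl)
    fix a assume "a \<in> A"
    then have "\<phi> (T a) = 0" using TK A span_base by blast
    then have "representation B (\<phi> (T a)) v = 0" for v
      using B(1) by (simp add: representation_zero)
    then have "pr (T a) = T a" by (simp add: pr_def)
    then show "representation A (pr (T a)) a = representation A (T a) a" by simp
  qed
  also have "\<dots> = trace_on ?K T"
    using trace_on_basis[OF A T TK] by simp
  also have "(\<Sum>v\<in>B. representation B (\<phi> (T (c v))) v) = (\<Sum>v\<in>B. representation B (T v) v)"
    using c comm by (intro sum.cong refl) simp
  also have "\<dots> = trace_on ?U T"
    using trace_on_basis[OF B T TU] by simp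
  finally show ?thesis .
qed

text \<open>A basis of \<open>U\<close> is extended to \<open>V\<close>, and \<open>k\<close> counts
  the added vectors. It is exposed as a natural number because over a general field equal traces
  need not mean equal dimensions.\<close>

lemma trace_on_id_mono:
  fixes U V :: "'b set"
  assumes "subspace U" "subspace V" "U \<subseteq> V" "finite W" "V \<subseteq> span W"
  shows "\<exists>k. trace_on V (\<lambda>x. x) = trace_on U (\<lambda>x. x) + of_nat k \<and> (k = 0 \<longrightarrow> U = V)"
proof -
  obtain A where A: "independent A" "finite A" "span A = U"
    using finite_basis_exists[of U W] assms by blast
  have AV: "A \<subseteq> V" using A assms span_superset by blast
  obtain B where B: "A \<subseteq> B" "B \<subseteq> V" "independent B" "V \<subseteq> span B"
    using maximal_independent_subset_extend[OF AV A(1)] by blast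
  have finB: "finite B"
    using independent_span_bound[OF assms(4) B(3)] B assms by blast
  have "span B = V"
    using B assms(2) by (meson span_minimal subset_antisym)
  moreover have "card B = card A + card (B - A)"
    using finB B(1) by (metis A(2) card_Diff_subset card_mono le_add_diff_inverse)
  ultimately show ?thesis
    using trace_on_id[OF A] trace_on_id[OF B(3) finB] A B finB
    by (intro exI[of _ "card (B - A)"]) auto
qed

end

section \<open>Cycle weights and the Frobenius characteristic\<close>

definition ffact :: "nat \<Rightarrow> nat \<Rightarrow> nat"
  where "ffact k d = (\<Prod>i<d. k - i)"

lemma ffact_0 [simp]: "ffact k 0 = 1"
  by (simp add: ffact_def)

lemma ffact_Suc: "ffact k (Suc d) = ffact k d * (k - d)"
  by (simp add: ffact_def)

lemma ffact_Suc_left: "ffact (Suc k) (Suc d) = Suc k * ffact k d"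
  by (simp add: ffact_def prod.lessThan_Suc_shift del: prod.lessThan_Suc)

lemma ffact_eq_0: "k < d \<Longrightarrow> ffact k d = 0"
  by (auto simp: ffact_def)

lemma qbrace_nth_0 [simp]: "fps_nth (qbrace d) 0 = 1"
  by (induction d) (simp_all add: qbrace_def fps_prod_nth' prod.nat_ivl_Suc')

lemma qbrace_Suc: "qbrace (Suc d) = qbrace d * (1 - of_nat (Suc d) * fps_X)"
  by (simp add: qbrace_def prod.nat_ivl_Suc' mult.commute)

lemma inverse_mult_cancel_fps: "fps_nth g 0 \<noteq> 0 \<Longrightarrow> g * inverse g = (1 :: rat fps)"
  using inverse_mult_eq_1[of g] by (simp add: mult.commute)

text \<open>A telescoping sum with remainder: writing 1 - D q as (1 - k q) + (k - D) q splits off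
  one term at a time. The remainder carries the factor \<open>ffact k D\<close>, which vanishes at D
  = n + 1.\<close>

lemma inverse_one_minus_eq_sum_qbrace:
  assumes "k \<le> n"
  shows "inverse (1 - of_nat k * fps_X :: rat fps)
    = (\<Sum>d=0..n. of_nat (ffact k d) * (fps_X ^ d / qbrace d))"
proof -
  define L where "L i = (1 - of_nat i * fps_X :: rat fps)" for i
  have L: "L i * inverse (L i) = 1" for i
    by (rule inverse_mult_cancel_fps) (simp add: L_def)
  have Q: "qbrace d * inverse (qbrace d) = 1" for d
    by (rule inverse_mult_cancel_fps) simp
  have QS: "inverse (qbrace (Suc d)) = inverse (qbrace d) * inverse (L (Suc d))" for d
    by (simp add: qbrace_Suc L_def fps_inverse_mult)
  \<comment> \<open>\<open>inverse (qbrace D) * L D\<close> is the inverse of \<open>qbrace\<close>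
    at D - 1, in a form that also covers D = 0, where it equals 1.\<close>
  have "inverse (L k) = (\<Sum>d<D. of_nat (ffact k d) * (fps_X ^ d * inverse (qbrace d)))
      + of_nat (ffact k D) * fps_X ^ D * (inverse (qbrace D) * L D) * inverse (L k)" for D
  proof (induction D)
    case 0
    then show ?case by (simp add: qbrace_def L_def)
  next
    case (Suc D)
    have step: "of_nat (ffact k D) * fps_X ^ D * (inverse (qbrace D) * L D) * inverse (L k)
      = of_nat (ffact k D) * (fps_X ^ D * inverse (qbrace D))
      + of_nat (ffact k (Suc D)) * fps_X ^ Suc D * (inverse (qbrace (Suc D)) * L (Suc D)) * inverse (L k)"
    proof -
      have "L D = L k + (of_nat k - of_nat D) * fps_X"
        by (simp add: L_def algebra_simps)
      moreover have "of_nat (ffact k (Suc D)) = (of_nat (ffact k D) * (of_nat k - of_nat D) :: rat fps)"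
        by (cases "D \<le> k") (simp_all add: ffact_Suc of_nat_diff ffact_eq_0)
      moreover have "inverse (qbrace (Suc D)) * L (Suc D) = inverse (qbrace D)"
        using L[of "Suc D"] by (simp add: QS mult.assoc mult.commute[of "inverse (L (Suc D))"])
      moreover have "A * P * (Q * (M + B * X)) * M' = A * (P * Q) * (M * M') + (A * B) * (P * X) * Q * M'"
        for A B P Q M M' X :: "rat fps"
        by (simp add: algebra_simps)
      ultimately show ?thesis
        using L[of k] by (simp add: mult.assoc mult.commute[of fps_X])
    qed
    show ?case using Suc.IH unfolding step by (simp add: algebra_simps)
  qed
  from this[of "Suc n"] have "inverse (L k) = (\<Sum>d<Suc n. of_nat (ffact k d) * (fps_X ^ d * inverse (qbrace d)))"
    using assms by (simp add: ffact_eq_0)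
  moreover have "{..<Suc n} = {0..n}" by auto
  ultimately show ?thesis by (simp add: L_def fps_divide_unit)
qed

section \<open>Permutations weighted by their cycles\<close>

text \<open>The weight stays arbitrary because two choices are needed: power sums for the
  characteristic and the constant 1 for counting.\<close>

definition cycle_weight :: "(nat \<Rightarrow> 'a) \<Rightarrow> 'b set \<Rightarrow> ('b \<Rightarrow> 'b) \<Rightarrow> 'a::comm_ring_1"
  where "cycle_weight w S \<sigma> = (\<Prod>C \<in> orbit \<sigma> ` S. w (card C))"

definition num_fix :: "'b set \<Rightarrow> ('b \<Rightarrow> 'b) \<Rightarrow> nat"
  where "num_fix S \<sigma> = card {x \<in> S. \<sigma> x = x}"

lemma permutes_fixing: "i \<in> S \<Longrightarrow> {\<sigma>. \<sigma> permutes S \<and> \<sigma> i = i} = {\<sigma>. \<sigma> permutes (S - {i})}"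
  by (auto simp: permutes_def)

lemma num_fix_remove:
  "finite S \<Longrightarrow> i \<in> S \<Longrightarrow> \<sigma> i = i \<Longrightarrow> num_fix S \<sigma> = Suc (num_fix (S - {i}) \<sigma>)"
proof -
  assume a: "finite S" "i \<in> S" "\<sigma> i = i"
  then have "{x \<in> S. \<sigma> x = x} = insert i {x \<in> S - {i}. \<sigma> x = x}" by auto
  then show ?thesis using a by (simp add: num_fix_def)
qed

lemma orbit_permutes_subset: "\<sigma> permutes S \<Longrightarrow> x \<in> S \<Longrightarrow> orbit \<sigma> x \<subseteq> S"
proof
  fix y assume "\<sigma> permutes S" "x \<in> S" "y \<in> orbit \<sigma> x"
  from this(3,1,2) show "y \<in> S" by induction (auto simp: permutes_in_image)
qed

lemma self_in_orbit_permutes: "finite S \<Longrightarrow> \<sigma> permutes S \<Longrightarrow> x \<in> orbit \<sigma> x"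
  using permutation_permutes permutation_self_in_orbit by metis

lemma orbit_fixpoint: "\<sigma> i = i \<Longrightarrow> orbit \<sigma> i = {i}"
proof -
  assume "\<sigma> i = i"
  have "y = i" if "y \<in> orbit \<sigma> i" for y
    using that by (induction rule: orbit.induct) (simp_all add: \<open>\<sigma> i = i\<close>)
  moreover have "i \<in> orbit \<sigma> i" using orbit.base[of \<sigma> i] \<open>\<sigma> i = i\<close> by simp
  ultimately show ?thesis by blast
qed

lemma cycle_weight_remove:
  assumes "finite S" "i \<in> S" "\<sigma> permutes (S - {i})"
  shows "cycle_weight w S \<sigma> = w 1 * cycle_weight w (S - {i}) \<sigma>"
proof -
  have i: "\<sigma> i = i" using assms(3) by (meson Diff_iff insertCI permutes_not_in)
  have "orbit \<sigma> ` S = insert {i} (orbit \<sigma> ` (S - {i}))"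
    using assms(2) orbit_fixpoint[of \<sigma> i, OF i] by auto
  moreover have "{i} \<notin> orbit \<sigma> ` (S - {i})"
    using orbit_permutes_subset[OF assms(3)] by blast
  ultimately show ?thesis using assms(1) by (simp add: cycle_weight_def)
qed

text \<open>\<open>ffact (num_fix S \<sigma>) d\<close> counts ordered \<open>d\<close>-tuples of
  distinct fixed points. Deleting a chosen fixed point leaves a permutation of a smaller set and
  splits off the factor \<open>w 1\<close>, so induction on \<open>d\<close> reduces the sum to the
  average \<open>h\<close> over the remaining points.\<close>

lemma sum_ffact_cycle_weight:
  fixes w :: "nat \<Rightarrow> 'a::comm_ring_1"
  assumes h: "\<And>T :: 'b set. finite T \<Longrightarrow> (\<Sum>\<sigma> | \<sigma> permutes T. cycle_weight w T \<sigma>) = of_nat (fact (card T)) * h (card T)"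
    and "finite (S :: 'b set)" "d \<le> card S"
  shows "(\<Sum>\<sigma> | \<sigma> permutes S. of_nat (ffact (num_fix S \<sigma>) d) * cycle_weight w S \<sigma>)
    = of_nat (fact (card S)) * (h (card S - d) * w 1 ^ d)"
  using assms(2,3)
proof (induction d arbitrary: S)
  case 0
  then show ?case using h by simp
next
  case (Suc d)
  note fin = \<open>finite S\<close> finite_permutations[OF \<open>finite S\<close>]
  \<comment> \<open>The leading factor of the falling factorial is spent on the choice of a fixed
    point \<open>i\<close>.\<close>
  have "(\<Sum>\<sigma> | \<sigma> permutes S. of_nat (ffact (num_fix S \<sigma>) (Suc d)) * cycle_weight w S \<sigma>)
      = (\<Sum>\<sigma> | \<sigma> permutes S. \<Sum>i | i \<in> S \<and> \<sigma> i = i.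
          of_nat (ffact (num_fix (S - {i}) \<sigma>) d) * cycle_weight w S \<sigma>)"
  proof (intro sum.cong refl)
    fix \<sigma> assume "\<sigma> \<in> {\<sigma>. \<sigma> permutes S}"
    have "(\<Sum>i | i \<in> S \<and> \<sigma> i = i. of_nat (ffact (num_fix (S - {i}) \<sigma>) d) * cycle_weight w S \<sigma>)
        = (\<Sum>i | i \<in> S \<and> \<sigma> i = i. of_nat (ffact (num_fix S \<sigma> - 1) d) * cycle_weight w S \<sigma>)"
      using fin(1) by (intro sum.cong refl) (auto simp: num_fix_remove)
    also have "\<dots> = of_nat (num_fix S \<sigma> * ffact (num_fix S \<sigma> - 1) d) * cycle_weight w S \<sigma>"
      by (simp add: num_fix_def)
    also have "num_fix S \<sigma> * ffact (num_fix S \<sigma> - 1) d = ffact (num_fix S \<sigma>) (Suc d)"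
      by (cases "num_fix S \<sigma>") (simp_all add: ffact_Suc_left ffact_eq_0)
    finally show "of_nat (ffact (num_fix S \<sigma>) (Suc d)) * cycle_weight w S \<sigma>
      = (\<Sum>i | i \<in> S \<and> \<sigma> i = i. of_nat (ffact (num_fix (S - {i}) \<sigma>) d) * cycle_weight w S \<sigma>)" by simp
  qed
  also have "\<dots> = (\<Sum>i\<in>S. \<Sum>\<sigma> | \<sigma> permutes S \<and> \<sigma> i = i.
          of_nat (ffact (num_fix (S - {i}) \<sigma>) d) * cycle_weight w S \<sigma>)"
    using sum.swap_restrict[OF fin(2,1), of "\<lambda>\<sigma> i. of_nat (ffact (num_fix (S - {i}) \<sigma>) d) * cycle_weight w S \<sigma>"
        "\<lambda>\<sigma> i. \<sigma> i = i"] by simp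
  also have "\<dots> = (\<Sum>i\<in>S. \<Sum>\<sigma> | \<sigma> permutes (S - {i}).
          w 1 * (of_nat (ffact (num_fix (S - {i}) \<sigma>) d) * cycle_weight w (S - {i}) \<sigma>))"
    using fin(1) by (intro sum.cong refl) (auto simp: permutes_fixing cycle_weight_remove)
  also have "\<dots> = (\<Sum>i\<in>S. w 1 * (of_nat (fact (card (S - {i}))) * (h (card (S - {i}) - d) * w 1 ^ d)))"
    using Suc by (intro sum.cong refl) (simp add: sum_distrib_left[symmetric])
  also have "\<dots> = (\<Sum>i\<in>S. w 1 * (of_nat (fact (card S - 1)) * (h (card S - Suc d) * w 1 ^ d)))"
    using fin(1) by (intro sum.cong refl) simp
  also have "\<dots> = of_nat (card S * fact (card S - 1)) * (h (card S - Suc d) * w 1 ^ Suc d)"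
    by (simp add: mult_ac)
  also have "card S * fact (card S - 1) = fact (card S)"
    using Suc.prems by (simp add: fact_reduce)
  finally show ?case .
qed

text \<open>Orbit-stabilizer, summed: for x = \<tau> x0, composing with \<tau> carries the
  stabilizer of x to the permutations sending x0 to x, and these cosets partition the group.\<close>

lemma sum_card_stabilizers:
  fixes act :: "('b \<Rightarrow> 'b) \<Rightarrow> 'x \<Rightarrow> 'x"
  assumes "finite S"
    and X: "X = (\<lambda>\<sigma>. act \<sigma> x0) ` {\<sigma>. \<sigma> permutes S}"
    and act: "\<And>\<sigma> \<tau>. \<sigma> permutes S \<Longrightarrow> \<tau> permutes S \<Longrightarrow> act (\<sigma> \<circ> \<tau>) x0 = act \<sigma> (act \<tau> x0)"
  shows "(\<Sum>x\<in>X. card {\<sigma>. \<sigma> permutes S \<and> act \<sigma> x = x}) = fact (card S)"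
proof -
  note fin = finite_permutations[OF assms(1)]
  have "card {\<sigma>. \<sigma> permutes S \<and> act \<sigma> x = x} = card {\<sigma>. \<sigma> permutes S \<and> act \<sigma> x0 = x}" if "x \<in> X" for x
  proof -
    obtain \<tau> where t: "\<tau> permutes S" "x = act \<tau> x0" using \<open>x \<in> X\<close> X by auto
    have "bij_betw (\<lambda>\<sigma>. \<sigma> \<circ> \<tau>) {\<sigma>. \<sigma> permutes S \<and> act \<sigma> x = x} {\<sigma>. \<sigma> permutes S \<and> act \<sigma> x0 = x}"
      using t permutes_inv_o[OF t(1)] permutes_inv[OF t(1)]
      by (intro bij_betwI[where g = "\<lambda>\<sigma>. \<sigma> \<circ> inv \<tau>"])
        (auto simp: permutes_compose act[symmetric] o_assoc[symmetric])
    then show ?thesis by (rule bij_betw_same_card)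
  qed
  then have "(\<Sum>x\<in>X. card {\<sigma>. \<sigma> permutes S \<and> act \<sigma> x = x}) = (\<Sum>x\<in>X. card {\<sigma>. \<sigma> permutes S \<and> act \<sigma> x0 = x})"
    by simp
  also have "\<dots> = card (\<Union>x\<in>X. {\<sigma>. \<sigma> permutes S \<and> act \<sigma> x0 = x})"
    using X fin by (subst card_UN_disjoint) auto
  also have "(\<Union>x\<in>X. {\<sigma>. \<sigma> permutes S \<and> act \<sigma> x0 = x}) = {\<sigma>. \<sigma> permutes S}"
    using X by auto
  finally show ?thesis using card_permutations[OF refl assms(1)] by simp
qed

section \<open>Coefficients, and generating series of weighted sets\<close>

lemma mp_coeff_simps [simp]:
  "mp_coeff 0 m = 0" "mp_coeff (f + g) m = mp_coeff f m + mp_coeff g m"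
  "mp_coeff (Abs_mpseries c) m = c m"
  by (simp_all add: zero_mpseries.rep_eq plus_mpseries.rep_eq Abs_mpseries_inverse)

lemma mp_coeff_sum [simp]: "mp_coeff (sum f A) m = (\<Sum>x\<in>A. mp_coeff (f x) m)"
  by (induction A rule: infinite_finite_induct) simp_all

lemma mp_coeff_times: "mp_coeff (f * g) m = (\<Sum>(a, b) | a + b = m. mp_coeff f a * mp_coeff g b)"
  by (simp add: times_mpseries.rep_eq)

lemma mp_coeff_const_times [simp]: "mp_coeff (mp_const c * g) m = c * mp_coeff g m"
proof -
  have "mp_coeff (mp_const c * g) m
      = (\<Sum>(a, b) \<in> {(0 :: nat \<Rightarrow>\<^sub>0 nat, m)}. mp_coeff (mp_const c) a * mp_coeff g b)"
    unfolding mp_coeff_times by (rule sum.mono_neutral_right) (auto simp: mp_const_def split: if_splits)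
  then show ?thesis by (simp add: mp_const_def)
qed

lemma mp_coeff_const: "mp_coeff (mp_const c) m = (if m = 0 then c else 0)"
  by (simp add: mp_const_def)

lemma mp_const_1 [simp]: "mp_const 1 = 1"
  by (rule mpseries_eqI) (simp add: mp_coeff_const one_mpseries.rep_eq)

lemma mp_const_0 [simp]: "mp_const 0 = 0"
  by (rule mpseries_eqI) (simp add: mp_coeff_const)

lemma mp_const_add: "mp_const (a + b) = mp_const a + mp_const b"
  by (rule mpseries_eqI) (simp add: mp_coeff_const)

lemma mp_const_mult: "mp_const (a * b) = mp_const a * mp_const b"
  by (rule mpseries_eqI) (simp add: mp_coeff_const)

lemma mp_const_of_nat: "mp_const (of_nat k) = of_nat k"
  by (induction k) (simp_all add: mp_const_add)

lemma mp_const_sum: "mp_const (sum f A) = (\<Sum>x\<in>A. mp_const (f x))"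
  by (induction A rule: infinite_finite_induct) (simp_all add: mp_const_add)

text \<open>An infinite fibre would silently get coefficient 0 through \<open>card\<close>, hence
  the finiteness hypotheses in the product rule.\<close>

definition weight_series :: "'x set \<Rightarrow> ('x \<Rightarrow> nat \<Rightarrow>\<^sub>0 nat) \<Rightarrow> 'a::comm_ring_1 mpseries"
  where "weight_series X w = Abs_mpseries (\<lambda>m. of_nat (card {x \<in> X. w x = m}))"

lemma weight_series_times:
  fixes v :: "'x \<Rightarrow> nat \<Rightarrow>\<^sub>0 nat" and w :: "'y \<Rightarrow> nat \<Rightarrow>\<^sub>0 nat"
  assumes "\<And>m. finite {x \<in> X. v x = m}" "\<And>m. finite {y \<in> Y. w y = m}"
  shows "weight_series X v * weight_series Y w = ( weight_series (X \<times> Y) (\<lambda>(x, y). v x + w y) :: 'a::comm_ring_1 mpseries)"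
proof (rule mpseries_eqI)
  fix m :: "nat \<Rightarrow>\<^sub>0 nat"
  have "{z \<in> X \<times> Y. (case z of (x, y) \<Rightarrow> v x + w y) = m}
     = (\<Union>p\<in>{(a, b). a + b = m}. {x \<in> X. v x = fst p} \<times> {y \<in> Y. w y = snd p})" by auto
  also have "card \<dots> = (\<Sum>p\<in>{(a, b). a + b = m}. card ({x \<in> X. v x = fst p} \<times> {y \<in> Y. w y = snd p}))"
    using assms by (intro card_UN_disjoint) auto
  finally show "mp_coeff (weight_series X v * weight_series Y w) m
    = mp_coeff (weight_series (X \<times> Y) (\<lambda>(x, y). v x + w y) :: 'a mpseries) m"
    by (simp add: mp_coeff_times weight_series_def case_prod_unfold card_cartesian_product)
qed

lemma weight_series_bij:
  assumes "bij_betw f X Y" "\<And>x. x \<in> X \<Longrightarrow> w (f x) = v x"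
  shows "weight_series X v = (weight_series Y w :: 'a::comm_ring_1 mpseries)"
proof (rule mpseries_eqI)
  fix m :: "nat \<Rightarrow>\<^sub>0 nat"
  have "bij_betw f {x \<in> X. v x = m} {y \<in> Y. w y = m}"
    using assms by (auto simp: bij_betw_def inj_on_def)
  then show "mp_coeff (weight_series X v) m = mp_coeff (weight_series Y w :: 'a mpseries) m"
    by (simp add: weight_series_def bij_betw_same_card)
qed

lemma power_p_eq_weight_series:
  assumes "k \<ge> 1"
  shows "power_p k = weight_series UNIV (\<lambda>i. Poly_Mapping.single i k)"
proof (rule mpseries_eqI)
  fix m :: "nat \<Rightarrow>\<^sub>0 nat"
  have inj: "i = j" if "Poly_Mapping.single i k = Poly_Mapping.single j k" for i j :: nat
    using that assms by (metis lookup_single_eq lookup_single_not_eq not_one_le_zero)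
  show "mp_coeff (power_p k) m = mp_coeff (weight_series UNIV (\<lambda>i. Poly_Mapping.single i k) :: 'a mpseries) m"
  proof (cases "\<exists>i. m = Poly_Mapping.single i k")
    case True
    then obtain i where i: "m = Poly_Mapping.single i k" by blast
    then have "{j. Poly_Mapping.single j k = m} = {i}" using inj by auto
    then show ?thesis using True by (simp add: power_p_def weight_series_def)
  next
    case False
    then have "{j. Poly_Mapping.single j k = m} = {}" by auto
    with False show ?thesis by (simp add: power_p_def weight_series_def)
  qed
qed

text \<open>Each block \<open>C\<close> contributes a positive exponent to the variable
  \<open>g C\<close>, so all values of \<open>g\<close> lie in the finite support of
  \<open>m\<close>.\<close>

lemma finite_PiE_weight:
  assumes "finite P" "\<And>C. C \<in> P \<Longrightarrow> k C \<ge> 1"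
  shows "finite {g \<in> P \<rightarrow>\<^sub>E (UNIV :: nat set). (\<Sum>C\<in>P. Poly_Mapping.single (g C) (k C)) = (m :: nat \<Rightarrow>\<^sub>0 nat)}"
proof (rule finite_subset)
  show "{g \<in> P \<rightarrow>\<^sub>E (UNIV :: nat set). (\<Sum>C\<in>P. Poly_Mapping.single (g C) (k C)) = m}
      \<subseteq> P \<rightarrow>\<^sub>E Poly_Mapping.keys m"
  proof
    fix g assume g: "g \<in> {g \<in> P \<rightarrow>\<^sub>E (UNIV :: nat set). (\<Sum>C\<in>P. Poly_Mapping.single (g C) (k C)) = m}"
    have "g C \<in> Poly_Mapping.keys m" if "C \<in> P" for C
    proof -
      have "1 \<le> Poly_Mapping.lookup (Poly_Mapping.single (g C) (k C)) (g C)"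
        using assms(2)[OF that] by simp
      also have "\<dots> \<le> (\<Sum>D\<in>P. Poly_Mapping.lookup (Poly_Mapping.single (g D) (k D)) (g C))"
        using that assms(1) by (intro member_le_sum) auto
      also have "\<dots> = Poly_Mapping.lookup m (g C)"
        using g by (auto simp: lookup_sum)
      finally show ?thesis by (simp add: in_keys_iff)
    qed
    then show "g \<in> P \<rightarrow>\<^sub>E Poly_Mapping.keys m" using g by (auto simp: PiE_iff)
  qed
  show "finite (P \<rightarrow>\<^sub>E Poly_Mapping.keys m)"
    using assms(1) by (intro finite_PiE) auto
qed

text \<open>Expanding the product means choosing one variable per factor; extensionality makes the
  choice unique as a function.\<close>

lemma prod_power_p:
  assumes "finite P" "\<And>C. C \<in> P \<Longrightarrow> k C \<ge> 1"
  shows "(\<Prod>C\<in>P. power_p (k C) :: 'a::comm_ring_1 mpseries) = weight_series (P \<rightarrow>\<^sub>E UNIV) (\<lambda>g. \<Sum>C\<in>P. Poly_Mapping.single (g C) (k C))"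
  using assms
proof (induction P)
  case empty
  have "{x :: 'b \<Rightarrow> nat. x = (\<lambda>x. undefined) \<and> 0 = m} = (if m = 0 then {\<lambda>x. undefined} else {})" for m :: "nat \<Rightarrow>\<^sub>0 nat"
    by auto
  then show ?case
    by (intro mpseries_eqI) (simp add: weight_series_def one_mpseries.rep_eq)
next
  case (insert C P)
  let ?w = "\<lambda>P g. \<Sum>C\<in>P. Poly_Mapping.single (g C) (k C)"
  have fib: "finite {i \<in> UNIV. Poly_Mapping.single i (k C) = m}" for m :: "nat \<Rightarrow>\<^sub>0 nat"
  proof (rule finite_subset[of _ "Poly_Mapping.keys m"])
    show "{i \<in> UNIV. Poly_Mapping.single i (k C) = m} \<subseteq> Poly_Mapping.keys m"
      using insert.prems[of C] by (auto simp: in_keys_iff)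
  qed simp
  have "(\<Prod>C\<in>insert C P. power_p (k C) :: 'a mpseries) = power_p (k C) * weight_series (P \<rightarrow>\<^sub>E UNIV) (?w P)"
    by (simp only: prod.insert[OF insert.hyps(1,2)] insert.IH[OF insert.prems[OF insertI2]])
  also have "\<dots> = weight_series (UNIV \<times> (P \<rightarrow>\<^sub>E UNIV)) (\<lambda>(i, g). Poly_Mapping.single i (k C) + ?w P g)"
    using insert by (subst power_p_eq_weight_series, simp, intro weight_series_times fib finite_PiE_weight) auto
  also have "\<dots> = weight_series (insert C P \<rightarrow>\<^sub>E UNIV) (?w (insert C P))"
  proof (rule weight_series_bij[where f = "\<lambda>(i, g). g(C := i)"])
    show "bij_betw (\<lambda>(i, g). g(C := i)) (UNIV \<times> (P \<rightarrow>\<^sub>E UNIV)) (insert C P \<rightarrow>\<^sub>E (UNIV :: nat set))"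
      using insert.hyps(2) by (simp add: bij_betw_def PiE_insert_eq inj_combinator[of C P "\<lambda>_. UNIV", simplified])
    fix z :: "nat \<times> ('b \<Rightarrow> nat)" assume "z \<in> UNIV \<times> (P \<rightarrow>\<^sub>E UNIV)"
    show "?w (insert C P) (case z of (i, g) \<Rightarrow> g(C := i)) = (case z of (i, g) \<Rightarrow> Poly_Mapping.single i (k C) + ?w P g)"
      using insert.hyps by (auto simp: case_prod_unfold intro!: sum.cong)
  qed
  finally show ?case .
qed

lemma mdeg_alt: "finite K \<Longrightarrow> Poly_Mapping.keys m \<subseteq> K \<Longrightarrow> mdeg m = (\<Sum>i\<in>K. Poly_Mapping.lookup m i)"
  unfolding mdeg_def by (rule sum.mono_neutral_left) (auto simp: in_keys_iff)

lemma mdeg_add: "mdeg (a + b) = mdeg a + mdeg b"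
proof -
  have "mdeg (a + b) = (\<Sum>i\<in>Poly_Mapping.keys a \<union> Poly_Mapping.keys b. Poly_Mapping.lookup (a + b) i)"
    using keys_add[of a b] by (intro mdeg_alt) auto
  also have "\<dots> = mdeg a + mdeg b"
    by (simp add: lookup_add sum.distrib mdeg_alt[of "Poly_Mapping.keys a \<union> Poly_Mapping.keys b"])
  finally show ?thesis .
qed

lemma mdeg_0 [simp]: "mdeg 0 = 0"
  by (simp add: mdeg_def)

lemma mdeg_single [simp]: "mdeg (Poly_Mapping.single i k) = k"
  by (subst mdeg_alt[of "{i}"]) auto

lemma mdeg_sum_single: "finite S \<Longrightarrow> mdeg (\<Sum>x\<in>S. Poly_Mapping.single (f x) k) = card S * k"
  by (induction S rule: finite_induct) (simp_all add: mdeg_add)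

lemma split_off_single:
  assumes "mdeg m = Suc k"
  obtains i m' where "m = Poly_Mapping.single i 1 + m'" "mdeg m' = k"
proof -
  have "m \<noteq> 0" using assms by auto
  then obtain i where i: "Poly_Mapping.lookup m i > 0"
    by (metis gr0I lookup_zero poly_mapping_eqI)
  have "m = Poly_Mapping.single i 1 + (m - Poly_Mapping.single i 1)"
    using i by (intro poly_mapping_eqI) (auto simp: lookup_add lookup_minus lookup_single when_def)
  then show thesis
    using that[of i "m - Poly_Mapping.single i 1"] assms mdeg_add[of "Poly_Mapping.single i 1"]
    by (metis Suc_inject mdeg_single plus_1_eq_Suc)
qed

lemma power_p_1: "power_p 1 = complete_h 1"
proof (rule mpseries_eqI)
  fix m :: "nat \<Rightarrow>\<^sub>0 nat"
  have "(\<exists>i. m = Poly_Mapping.single i 1) \<longleftrightarrow> mdeg m = 1"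
  proof
    assume "mdeg m = 1"
    then obtain i m' where m: "m = Poly_Mapping.single i 1 + m'" "mdeg m' = 0"
      using split_off_single[of m 0] by auto
    then have "m' = 0"
      by (intro poly_mapping_eqI) (auto simp: mdeg_def in_keys_iff)
    with m show "\<exists>i. m = Poly_Mapping.single i 1" by auto
  qed auto
  then show "mp_coeff (power_p 1) m = mp_coeff (complete_h 1 :: 'a mpseries) m"
    by (simp add: power_p_def complete_h_def)
qed

section \<open>Colourings and Burnside counting\<close>

text \<open>The multiset of colours used by the colouring \<open>f\<close>, encoded as the exponent
  vector of its monomial.\<close>

definition content :: "'b set \<Rightarrow> ('b \<Rightarrow> nat) \<Rightarrow> nat \<Rightarrow>\<^sub>0 nat"
  where "content S f = (\<Sum>x\<in>S. Poly_Mapping.single (f x) 1)"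

lemma lookup_content: "finite S \<Longrightarrow> Poly_Mapping.lookup (content S f) i = card {x \<in> S. f x = i}"
  by (simp add: content_def lookup_sum lookup_single when_def sum.If_cases Int_def)

lemma content_permute:
  assumes "\<sigma> permutes S"
  shows "content S (f \<circ> \<sigma>) = content S f"
  unfolding content_def using sum.permute[OF assms, of "\<lambda>x. Poly_Mapping.single (f x) (1 :: nat)"]
  by (simp add: o_def)

lemma content_eq_imp_permuted:
  assumes "finite S" "content S f = content S g"
  obtains \<sigma> where "\<sigma> permutes S" "\<And>x. x \<in> S \<Longrightarrow> f x = g (\<sigma> x)"
proof -
  have "image_mset f (mset_set S) = image_mset g (mset_set S)"
  proof (rule multiset_eqI)
    fix i
    have "count (image_mset h (mset_set S)) i = Poly_Mapping.lookup (content S h) i" for h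
      using assms(1) by (simp add: lookup_content count_image_mset' eq_commute[of i])
    then show "count (image_mset f (mset_set S)) i = count (image_mset g (mset_set S)) i"
      using assms(2) by simp
  qed
  then show thesis
    using image_mset_eq_implies_permutes[OF assms(1)] that by metis
qed

lemma ex_content:
  assumes "finite S" "mdeg m = card S"
  shows "\<exists>f. content S f = m"
  using assms
proof (induction S arbitrary: m rule: finite_induct)
  case empty
  then have "m = 0" by (intro poly_mapping_eqI) (auto simp: mdeg_def in_keys_iff)
  then show ?case by (simp add: content_def)
next
  case (insert x S)
  then obtain i m' where m: "m = Poly_Mapping.single i 1 + m'" "mdeg m' = card S"
    using split_off_single[of m "card S"] by auto
  obtain f where f: "content S f = m'" using insert.IH m by blast
  have "content (insert x S) (f(x := i)) = Poly_Mapping.single i 1 + content S f"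
    using insert.hyps by (auto simp: content_def intro!: sum.cong)
  then show ?case using f m by blast
qed

text \<open>Expanding the power sums picks one colour per cycle, which amounts to a colouring
  constant along \<sigma>.\<close>

lemma cycle_weight_power_p:
  assumes "finite S" "\<sigma> permutes S"
  shows "(cycle_weight power_p S \<sigma> :: 'a::comm_ring_1 mpseries)
    = weight_series {f \<in> S \<rightarrow>\<^sub>E UNIV. \<forall>x\<in>S. f (\<sigma> x) = f x} (content S)"
proof -
  let ?P = "orbit \<sigma> ` S"
  have self: "x \<in> orbit \<sigma> x" for x by (rule self_in_orbit_permutes[OF assms])
  have sub: "orbit \<sigma> x \<subseteq> S" if "x \<in> S" for x by (rule orbit_permutes_subset[OF assms(2) that])
  have fin: "finite C" if "C \<in> ?P" for C
    using sub that assms(1) finite_subset by blast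
  have eq: "orbit \<sigma> y = orbit \<sigma> x" if "y \<in> orbit \<sigma> x" for x y
    by (metis orbit_swap orbit_trans self subsetI subset_antisym that)
  have mem: "y \<in> C \<longleftrightarrow> y \<in> S \<and> orbit \<sigma> y = C" if "C \<in> ?P" for C y
    using that eq self sub by blast
  have const: "f y = f x" if "y \<in> orbit \<sigma> x" "x \<in> S" "\<forall>x\<in>S. f (\<sigma> x) = f x" for x y and f :: "_ \<Rightarrow> nat"
    using that
  proof (induction rule: orbit.induct)
    case (step y)
    then have "y \<in> S" using sub by blast
    with step show ?case by simp
  qed simp
  have "(cycle_weight power_p S \<sigma> :: 'a mpseries)
      = weight_series (?P \<rightarrow>\<^sub>E UNIV) (\<lambda>g. \<Sum>C\<in>?P. Poly_Mapping.single (g C) (card C))"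
    unfolding cycle_weight_def
  proof (rule prod_power_p)
    show "1 \<le> card C" if "C \<in> ?P" for C
      using fin[OF that] that orbit_nonempty[of \<sigma>] by (auto simp: Suc_le_eq card_gt_0_iff)
  qed (use assms in simp)
  also have "\<dots> = weight_series {f \<in> S \<rightarrow>\<^sub>E UNIV. \<forall>x\<in>S. f (\<sigma> x) = f x} (content S)"
  proof (rule weight_series_bij[where f = "\<lambda>g. \<lambda>x\<in>S. g (orbit \<sigma> x)"])
    show "bij_betw (\<lambda>g. \<lambda>x\<in>S. g (orbit \<sigma> x)) (?P \<rightarrow>\<^sub>E (UNIV :: nat set)) {f \<in> S \<rightarrow>\<^sub>E UNIV. \<forall>x\<in>S. f (\<sigma> x) = f x}"
    proof (rule bij_betwI[where g = "\<lambda>f. \<lambda>C\<in>?P. f (SOME x. x \<in> C)"])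
      show "(\<lambda>g. \<lambda>x\<in>S. g (orbit \<sigma> x)) \<in> (?P \<rightarrow>\<^sub>E UNIV) \<rightarrow> {f \<in> S \<rightarrow>\<^sub>E (UNIV :: nat set). \<forall>x\<in>S. f (\<sigma> x) = f x}"
        using eq[OF orbit.base] permutes_in_image[OF assms(2)] by auto
      show "(\<lambda>f. \<lambda>C\<in>?P. f (SOME x. x \<in> C)) \<in> {f \<in> S \<rightarrow>\<^sub>E (UNIV :: nat set). \<forall>x\<in>S. f (\<sigma> x) = f x} \<rightarrow> (?P \<rightarrow>\<^sub>E UNIV)"
        by auto
      fix g :: "'b set \<Rightarrow> nat" assume g: "g \<in> ?P \<rightarrow>\<^sub>E UNIV"
      show "(\<lambda>C\<in>?P. (\<lambda>x\<in>S. g (orbit \<sigma> x)) (SOME x. x \<in> C)) = g"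
      proof
        fix C
        show "(\<lambda>C\<in>?P. (\<lambda>x\<in>S. g (orbit \<sigma> x)) (SOME x. x \<in> C)) C = g C"
        proof (cases "C \<in> ?P")
          case True
          then obtain x where "x \<in> C" using self by blast
          then have "(SOME x. x \<in> C) \<in> C" by (rule someI)
          then have "(SOME x. x \<in> C) \<in> S" "orbit \<sigma> (SOME x. x \<in> C) = C" using mem[OF True] by blast+
          then show ?thesis using True by simp
        qed (use g in \<open>auto simp: PiE_def extensional_def\<close>)
      qed
    next
      fix f :: "'b \<Rightarrow> nat" assume f: "f \<in> {f \<in> S \<rightarrow>\<^sub>E UNIV. \<forall>x\<in>S. f (\<sigma> x) = f x}"
      show "(\<lambda>x\<in>S. (\<lambda>C\<in>?P. f (SOME x. x \<in> C)) (orbit \<sigma> x)) = f"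
      proof
        fix x
        show "(\<lambda>x\<in>S. (\<lambda>C\<in>?P. f (SOME x. x \<in> C)) (orbit \<sigma> x)) x = f x"
        proof (cases "x \<in> S")
          case True
          have "(SOME y. y \<in> orbit \<sigma> x) \<in> orbit \<sigma> x" using self by (rule someI)
          then have "f (SOME y. y \<in> orbit \<sigma> x) = f x" using const True f by blast
          then show ?thesis using True by simp
        qed (use f in \<open>auto simp: PiE_def extensional_def\<close>)
      qed
    qed
    fix g :: "'b set \<Rightarrow> nat"
    have "content S (\<lambda>x\<in>S. g (orbit \<sigma> x)) = (\<Sum>x\<in>S. Poly_Mapping.single (g (orbit \<sigma> x)) 1)"
      by (simp add: content_def)
    also have "\<dots> = (\<Sum>C\<in>?P. \<Sum>x | x \<in> S \<and> orbit \<sigma> x = C. Poly_Mapping.single (g (orbit \<sigma> x)) 1)"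
      by (rule sum.image_gen[OF assms(1)])
    also have "\<dots> = (\<Sum>C\<in>?P. \<Sum>x\<in>C. Poly_Mapping.single (g C) 1)"
      using mem by (intro sum.cong refl) auto
    also have "\<dots> = (\<Sum>C\<in>?P. Poly_Mapping.single (g C) (card C))"
    proof (intro sum.cong refl)
      fix C
      have "(\<Sum>x\<in>A. Poly_Mapping.single (g C) (1::nat)) = Poly_Mapping.single (g C) (card A)" for A :: "'b set"
      proof (induction A rule: infinite_finite_induct)
        case (insert x A)
        then show ?case by (simp del: sum_constant add: single_add[symmetric])
      qed simp_all
      then show "(\<Sum>x\<in>C. Poly_Mapping.single (g C) (1::nat)) = Poly_Mapping.single (g C) (card C)" .
    qed
    finally show "content S (\<lambda>x\<in>S. g (orbit \<sigma> x)) = (\<Sum>C\<in>?P. Poly_Mapping.single (g C) (card C))" .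
  qed
  finally show ?thesis .
qed

text \<open>The characteristic of the trivial representation. Coefficientwise it is Burnside
  counting: the colourings with content \<open>m\<close> form a single orbit if
  \<open>mdeg m = card S\<close>, and there are none otherwise.\<close>

lemma sum_cycle_weight_power_p:
  assumes "finite S"
  shows "(\<Sum>\<sigma> | \<sigma> permutes S. cycle_weight power_p S \<sigma>)
    = of_nat (fact (card S)) * (complete_h (card S) :: 'a::comm_ring_1 mpseries)"
proof (rule mpseries_eqI)
  fix m :: "nat \<Rightarrow>\<^sub>0 nat"
  let ?X = "{f \<in> S \<rightarrow>\<^sub>E UNIV. content S f = m}"
  let ?G = "{\<sigma>. \<sigma> permutes S}"
  \<comment> \<open>The inverse turns composition on the right into a left action, as
    \<open>sum_card_stabilizers\<close> requires.\<close>
  let ?act = "\<lambda>\<sigma> f. f \<circ> inv \<sigma>"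
  have fin: "finite ?X" "finite ?G"
    using finite_PiE_weight[OF assms, of "\<lambda>_. 1" m] finite_permutations[OF assms] by (simp_all add: content_def)
  have stab: "?act \<sigma> f = f \<longleftrightarrow> (\<forall>x\<in>S. f (\<sigma> x) = f x)" if "\<sigma> permutes S" "f \<in> ?X" for f \<sigma>
  proof
    assume "?act \<sigma> f = f"
    then show "\<forall>x\<in>S. f (\<sigma> x) = f x" using permutes_inverses[OF that(1)] by (metis comp_apply)
  next
    assume a: "\<forall>x\<in>S. f (\<sigma> x) = f x"
    show "?act \<sigma> f = f"
    proof
      fix x
      show "?act \<sigma> f x = f x"
      proof (cases "x \<in> S")
        case True
        then have "inv \<sigma> x \<in> S" using permutes_inv[OF that(1)] by (simp add: permutes_in_image)
        then show ?thesis using a permutes_inverses[OF that(1)] by (metis comp_apply)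
      next
        case False
        then show ?thesis using permutes_inv[OF that(1)] by (simp add: permutes_not_in)
      qed
    qed
  qed
  have "mp_coeff (\<Sum>\<sigma> | \<sigma> permutes S. cycle_weight power_p S \<sigma>) m
      = (\<Sum>\<sigma>\<in>?G. of_nat (card {f \<in> ?X. ?act \<sigma> f = f}) :: 'a)"
  proof (simp only: mp_coeff_sum, intro sum.cong refl)
    fix \<sigma> assume "\<sigma> \<in> ?G"
    then have s: "\<sigma> permutes S" by simp
    have "{f \<in> {f \<in> S \<rightarrow>\<^sub>E UNIV. \<forall>x\<in>S. f (\<sigma> x) = f x}. content S f = m} = {f \<in> ?X. ?act \<sigma> f = f}"
      using stab[OF s] by blast
    then show "mp_coeff (cycle_weight power_p S \<sigma>) m = (of_nat (card {f \<in> ?X. ?act \<sigma> f = f}) :: 'a)"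
      by (simp add: cycle_weight_power_p[OF assms s] weight_series_def)
  qed
  also have "\<dots> = of_nat (\<Sum>\<sigma>\<in>?G. card {f \<in> ?X. ?act \<sigma> f = f})"
    by simp
  \<comment> \<open>Double counting of the pairs of a permutation and a colouring fixed by
    it.\<close>
  also have "(\<Sum>\<sigma>\<in>?G. card {f \<in> ?X. ?act \<sigma> f = f}) = (\<Sum>f\<in>?X. card {\<sigma> \<in> ?G. ?act \<sigma> f = f})"
    using sum.swap_restrict[OF fin(2,1), of "\<lambda>_ _. 1::nat" "\<lambda>\<sigma> f. ?act \<sigma> f = f"] by simp
  also have "\<dots> = (if mdeg m = card S then fact (card S) else 0)"
  proof (cases "mdeg m = card S")
    case True
    obtain f0 where f0: "content S f0 = m" using ex_content[OF assms True] by blast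
    let ?f = "restrict f0 S"
    have f: "?f \<in> ?X" using f0 by (auto simp: content_def)
    have ext: "(\<lambda>x\<in>S. f0 x) \<circ> inv \<sigma> \<in> ?X" if "\<sigma> permutes S" for \<sigma>
      using f permutes_inv[OF that] content_permute[OF permutes_inv[OF that], of ?f]
      by (auto simp: PiE_iff extensional_def permutes_not_in permutes_in_image)
    have "?X = (\<lambda>\<sigma>. ?act \<sigma> ?f) ` ?G"
    proof (intro equalityI subsetI)
      fix g assume g: "g \<in> ?X"
      then obtain \<sigma> where s: "\<sigma> permutes S" "\<And>x. x \<in> S \<Longrightarrow> g x = ?f (\<sigma> x)"
        using content_eq_imp_permuted[OF assms, of g ?f] f by auto
      have "g = ?act (inv \<sigma>) ?f"
        using g s by (auto simp: fun_eq_iff permutes_inv_inv[OF s(1)] permutes_in_image permutes_not_in PiE_def extensional_def)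
      then show "g \<in> (\<lambda>\<sigma>. ?act \<sigma> ?f) ` ?G" using permutes_inv[OF s(1)] by blast
    qed (use ext in auto)
    then have "(\<Sum>f\<in>?X. card {\<sigma>. \<sigma> permutes S \<and> ?act \<sigma> f = f}) = fact (card S)"
      by (rule sum_card_stabilizers[OF assms]) (simp only: o_inv_distrib[OF permutes_bij permutes_bij] o_assoc)
    then show ?thesis using True by simp
  next
    case False
    then have "?X = {}" using mdeg_sum_single[OF assms, of _ 1] by (auto simp: content_def)
    then show ?thesis using False by (simp del: Collect_empty_eq)
  qed
  finally show "mp_coeff (\<Sum>\<sigma> | \<sigma> permutes S. cycle_weight power_p S \<sigma>) m
      = mp_coeff (of_nat (fact (card S)) * complete_h (card S) :: 'a mpseries) m"
    by (simp add: complete_h_def mp_const_of_nat[symmetric])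
qed

section \<open>From traces to the graded characteristic\<close>

lemma fps_const_sum_eq: "fps_const (sum f A) = (\<Sum>x\<in>A. fps_const (f x))"
  by (rule fps_ext) (simp add: fps_sum_nth)

text \<open>\<open>Frob\<close> has rational coefficients whereas the claim lives over
  \<open>rat fps\<close>; products of power sums have the same constant coefficients in
  both.\<close>

lemma mp_coeff_fps_cycle_weight:
  "mp_coeff (\<Prod>C\<in>P. power_p (k C) :: rat fps mpseries) m = fps_const (mp_coeff (\<Prod>C\<in>P. power_p (k C)) m)"
proof (induction P arbitrary: m rule: infinite_finite_induct)
  case (insert C P)
  have "mp_coeff (power_p (k C) :: rat fps mpseries) a = fps_const (mp_coeff (power_p (k C)) a)" for a
    by (simp add: power_p_def)
  then show ?case using insert
    by (simp add: mp_coeff_times case_prod_unfold fps_const_sum_eq)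
qed (simp_all add: one_mpseries.rep_eq)

text \<open>Both halves of the theorem end here. As \<open>Q\<close> does not depend on \<sigma>,
  only the expansion of 1/(1 - f q) in falling factorials has to be averaged against the power
  sums.\<close>

lemma nc_graded_Frob_eq:
  assumes tr: "\<And>\<sigma> k. \<sigma> permutes {1..n} \<Longrightarrow>
      nc.trace_on (M \<inter> nc_homogeneous k) (permute_vars \<sigma>)
      = fps_nth (Q * inverse (1 - of_nat (num_fix {1..n} \<sigma>) * fps_X)) k"
  shows "nc_graded_Frob n M = mp_const Q *
      (\<Sum>d=0..n. mp_const (fps_X ^ d / qbrace d) * (complete_h (n - d) * complete_h 1 ^ d))"
proof -
  let ?G = "{\<sigma>. \<sigma> permutes {1..n}}"
  let ?f = "\<lambda>\<sigma>. num_fix {1..n} \<sigma>"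
  let ?E = "\<lambda>\<sigma>. inverse (1 - of_nat (?f \<sigma>) * fps_X) :: rat fps"
  let ?p = "\<lambda>\<sigma>. power_cycle n \<sigma> :: rat fps mpseries"
  have p: "power_cycle n \<sigma> = cycle_weight power_p {1..n} \<sigma>" for \<sigma>
    by (simp add: power_cycle_def cycle_weight_def)
  have E: "mp_const (?E \<sigma>) = (\<Sum>d=0..n. mp_const (fps_X ^ d / qbrace d) * of_nat (ffact (?f \<sigma>) d))" for \<sigma>
  proof -
    have "?f \<sigma> \<le> card {1..n}" unfolding num_fix_def by (rule card_mono) auto
    then show ?thesis
      by (subst inverse_one_minus_eq_sum_qbrace[of _ n])
        (simp_all add: mp_const_sum mp_const_mult mp_const_of_nat mult.commute)
  qed
  have "(\<Sum>\<sigma>\<in>?G. mp_const (?E \<sigma>) * ?p \<sigma>)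
      = (\<Sum>\<sigma>\<in>?G. \<Sum>d=0..n. mp_const (fps_X ^ d / qbrace d) * (of_nat (ffact (?f \<sigma>) d) * ?p \<sigma>))"
    unfolding E by (simp add: sum_distrib_right mult.assoc)
  also have "\<dots> = (\<Sum>d=0..n. mp_const (fps_X ^ d / qbrace d) * (\<Sum>\<sigma>\<in>?G. of_nat (ffact (?f \<sigma>) d) * ?p \<sigma>))"
    by (subst sum.swap) (simp add: sum_distrib_left)
  also have "\<dots> = (\<Sum>d=0..n. mp_const (fps_X ^ d / qbrace d) * (of_nat (fact n) * (complete_h (n - d) * complete_h 1 ^ d)))"
    unfolding p using sum_ffact_cycle_weight[where w = "power_p :: nat \<Rightarrow> rat fps mpseries" and h = complete_h and S = "{1..n}", OF sum_cycle_weight_power_p]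
    by (intro sum.cong refl) (simp add: power_p_1[unfolded One_nat_def])
  also have "\<dots> = mp_const (of_nat (fact n)) * (\<Sum>d=0..n. mp_const (fps_X ^ d / qbrace d) * (complete_h (n - d) * complete_h 1 ^ d))"
    by (simp add: mp_const_of_nat[symmetric] sum_distrib_left mult_ac)
  finally have sum: "mp_const (of_nat (fact n)) * (\<Sum>d=0..n. mp_const (fps_X ^ d / qbrace d) * (complete_h (n - d) * complete_h 1 ^ d))
    = (\<Sum>\<sigma>\<in>?G. mp_const (?E \<sigma>) * ?p \<sigma>)" ..
  \<comment> \<open>Working with n! times the characteristic removes the denominator in
    \<open>Frob\<close>; n! is a unit of \<open>rat fps\<close> and is cancelled at the end.\<close>
  have "mp_const (of_nat (fact n)) * nc_graded_Frob n M = mp_const Q * (\<Sum>\<sigma>\<in>?G. mp_const (?E \<sigma>) * ?p \<sigma>)"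
  proof (rule mpseries_eqI)
    fix m
    let ?c = "\<lambda>\<sigma>. mp_coeff (power_cycle n \<sigma> :: rat mpseries) m"
    have "mp_coeff (mp_const (of_nat (fact n)) * nc_graded_Frob n M) m = (\<Sum>\<sigma>\<in>?G. Q * ?E \<sigma> * fps_const (?c \<sigma>))"
    proof (rule fps_ext)
      fix k
      have "fps_nth (mp_coeff (mp_const (of_nat (fact n)) * nc_graded_Frob n M) m) k
          = (\<Sum>\<sigma>\<in>?G. nc.trace_on (M \<inter> nc_homogeneous k) (permute_vars \<sigma>) * ?c \<sigma>)"
        by (simp add: nc_graded_Frob_def nc.graded_Frob_def nc.Frob_def fps_of_nat[symmetric])
      also have "\<dots> = fps_nth (\<Sum>\<sigma>\<in>?G. Q * ?E \<sigma> * fps_const (?c \<sigma>)) k"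
        using tr by (simp add: fps_sum_nth)
      finally show "fps_nth (mp_coeff (mp_const (of_nat (fact n)) * nc_graded_Frob n M) m) k = \<dots>" .
    qed
    also have "\<dots> = mp_coeff (mp_const Q * (\<Sum>\<sigma>\<in>?G. mp_const (?E \<sigma>) * ?p \<sigma>)) m"
      by (simp add: sum_distrib_left mult.assoc power_cycle_def mp_coeff_fps_cycle_weight)
    finally show "mp_coeff (mp_const (of_nat (fact n)) * nc_graded_Frob n M) m
      = mp_coeff (mp_const Q * (\<Sum>\<sigma>\<in>?G. mp_const (?E \<sigma>) * ?p \<sigma>)) m" .
  qed
  then have eq: "mp_const (of_nat (fact n)) * nc_graded_Frob n M
      = mp_const (of_nat (fact n)) * (mp_const Q * (\<Sum>d=0..n. mp_const (fps_X ^ d / qbrace d) * (complete_h (n - d) * complete_h 1 ^ d)))"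
    unfolding sum[symmetric] by (simp add: mult.left_commute)
  have "inverse (of_nat (fact n)) * of_nat (fact n) = (1 :: rat fps)"
    by (rule inverse_mult_eq_1) (simp add: fps_of_nat[symmetric])
  then have "mp_const (inverse (of_nat (fact n))) * mp_const (of_nat (fact n)) = (1 :: rat fps mpseries)"
    by (simp only: mp_const_mult[symmetric] mp_const_1)
  then show ?thesis using arg_cong[OF eq, of "\<lambda>x. mp_const (inverse (of_nat (fact n))) * x"]
    by (simp add: mult.assoc[symmetric])
qed

section \<open>Linear operators on noncommutative polynomials\<close>

lemmas ncpoly_eqI = poly_mapping_eqI[where 'a = "nat list" and 'b = rat]

abbreviation nc_linear :: "(ncpoly \<Rightarrow> ncpoly) \<Rightarrow> bool"
  where "nc_linear \<equiv> module_hom nc_scale nc_scale"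

lemma nc_linearI:
  "(\<And>f g. T (f + g) = T f + T g) \<Longrightarrow> (\<And>c f. T (nc_scale c f) = nc_scale c (T f)) \<Longrightarrow> nc_linear T"
  by unfold_locales auto

lemma nc_linear_id: "nc_linear (\<lambda>f. f)"
  by (rule nc_linearI) auto

lemma nc_linear_comp: "nc_linear S \<Longrightarrow> nc_linear T \<Longrightarrow> nc_linear (\<lambda>f. S (T f))"
  by (rule nc_linearI) (simp_all add: module_hom.add module_hom.scale)

lemma nc_linear_add: "nc_linear S \<Longrightarrow> nc_linear T \<Longrightarrow> nc_linear (\<lambda>f. S f + T f)"
  by (rule nc_linearI) (simp_all add: module_hom.add module_hom.scale algebra_simps nc.scale_right_distrib)

lemma nc_linear_zero: "nc_linear (\<lambda>f. 0)"
  by (rule nc_linearI) simp_all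

lemma nc_linear_scale: "nc_linear T \<Longrightarrow> nc_linear (\<lambda>f. nc_scale c (T f))"
  by (rule nc_linearI) (simp_all add: module_hom.add module_hom.scale nc.scale_right_distrib mult.commute)

lemma nc_linear_sum: "(\<And>x. x \<in> A \<Longrightarrow> nc_linear (T x)) \<Longrightarrow> nc_linear (\<lambda>f. \<Sum>x\<in>A. T x f)"
  by (induction A rule: infinite_finite_induct) (auto intro: nc_linear_zero nc_linear_add)

lemma nc_linear_funpow: "nc_linear T \<Longrightarrow> nc_linear (T ^^ k)"
proof (induction k)
  case 0
  then show ?case using nc_linear_id by (simp add: id_def)
next
  case (Suc k)
  then show ?case using nc_linear_comp[of T "T ^^ k"] by (simp add: o_def)
qed

lemma nc_linear_foldr: "(\<And>x. nc_linear (D x)) \<Longrightarrow> nc_linear (foldr D w)"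
proof (induction w)
  case Nil
  then show ?case using nc_linear_id by (simp add: id_def)
next
  case (Cons a w)
  then show ?case using nc_linear_comp[of "D a" "foldr D w"] by (simp add: o_def)
qed

lemma lin_ext_superset:
  assumes "finite A" "Poly_Mapping.keys f \<subseteq> A"
  shows "lin_ext \<phi> f = (\<Sum>w\<in>A. nc_scale (Poly_Mapping.lookup f w) (\<phi> w))"
  unfolding lin_ext_def using assms by (intro sum.mono_neutral_left) (auto simp: in_keys_iff)

lemma nc_linear_lin_ext: "nc_linear (lin_ext \<phi>)"
proof (rule nc_linearI)
  fix f g :: ncpoly and c :: rat
  let ?A = "Poly_Mapping.keys f \<union> Poly_Mapping.keys g"
  show "lin_ext \<phi> (f + g) = lin_ext \<phi> f + lin_ext \<phi> g"
    using keys_add[of f g]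
    by (simp add: lin_ext_superset[of ?A] lookup_add nc.scale_left_distrib sum.distrib)
  have "Poly_Mapping.keys (nc_scale c f) \<subseteq> Poly_Mapping.keys f"
    by (auto simp: in_keys_iff)
  then show "lin_ext \<phi> (nc_scale c f) = nc_scale c (lin_ext \<phi> f)"
    by (simp add: lin_ext_superset[of "Poly_Mapping.keys f"] nc.scale_sum_right)
qed

lemma lin_ext_word [simp]: "lin_ext \<phi> (word w) = \<phi> w"
  by (simp add: lin_ext_def)

lemma lin_ext_words: "lin_ext word f = f"
  by (rule ncpoly_eqI)
    (simp add: lin_ext_def lookup_sum lookup_single mult_when, simp add: when_def in_keys_iff)

lemma nc_linear_eq_lin_ext: "nc_linear T \<Longrightarrow> T f = lin_ext (\<lambda>w. T (word w)) f"
proof -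
  assume T: "nc_linear T"
  have "T f = T (lin_ext word f)" by (simp add: lin_ext_words)
  also have "\<dots> = lin_ext (\<lambda>w. T (word w)) f"
    unfolding lin_ext_def by (simp only: module_hom.sum[OF T] module_hom.scale[OF T])
  finally show ?thesis .
qed

lemma nc_linear_eqI:
  assumes "nc_linear S" "nc_linear T" "\<And>w. S (word w) = T (word w)"
  shows "S f = T f"
  unfolding nc_linear_eq_lin_ext[OF assms(1), of f] nc_linear_eq_lin_ext[OF assms(2), of f] assms(3) ..

lemma lin_ext_compose: "lin_ext \<phi> (lin_ext \<psi> f) = lin_ext (\<lambda>w. lin_ext \<phi> (\<psi> w)) f"
  by (rule nc_linear_eqI) (auto intro: nc_linear_lin_ext nc_linear_comp)

lemma lookup_lin_ext: "Poly_Mapping.lookup (lin_ext \<phi> f) u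
    = (\<Sum>w\<in>Poly_Mapping.keys f. Poly_Mapping.lookup f w * Poly_Mapping.lookup (\<phi> w) u)"
  by (simp add: lin_ext_def lookup_sum)

definition words :: "nat \<Rightarrow> nat \<Rightarrow> nat list set"
  where "words n k = {w. set w \<subseteq> {1..n} \<and> length w = k}"

lemma finite_words [simp]: "finite (words n k)"
  unfolding words_def by (rule finite_lists_length_eq) simp

lemma NCPoly_iff: "f \<in> NCPoly n \<longleftrightarrow> (\<forall>w. \<not> set w \<subseteq> {1..n} \<longrightarrow> Poly_Mapping.lookup f w = 0)"
  unfolding NCPoly_def by (auto simp only: mem_Collect_eq in_keys_iff)

lemma homogeneous_iff: "f \<in> nc_homogeneous k \<longleftrightarrow> (\<forall>w. length w \<noteq> k \<longrightarrow> Poly_Mapping.lookup f w = 0)"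
  unfolding nc_homogeneous_def by (auto simp only: mem_Collect_eq in_keys_iff)

lemma subspace_NCPoly: "nc.subspace (NCPoly n)"
  by (simp add: nc.subspace_def NCPoly_iff lookup_add)

lemma subspace_homogeneous: "nc.subspace (nc_homogeneous k)"
  by (simp add: nc.subspace_def homogeneous_iff lookup_add)

lemma NCPoly_homogeneous_iff: "f \<in> NCPoly n \<inter> nc_homogeneous k \<longleftrightarrow> Poly_Mapping.keys f \<subseteq> words n k"
  by (auto simp: NCPoly_def nc_homogeneous_def words_def)

lemma NCPoly_homogeneous_span: "NCPoly n \<inter> nc_homogeneous k \<subseteq> nc.span (word ` words n k)"
proof
  fix f assume "f \<in> NCPoly n \<inter> nc_homogeneous k"
  then have "Poly_Mapping.keys f \<subseteq> words n k" unfolding NCPoly_homogeneous_iff .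
  then have "lin_ext word f \<in> nc.span (word ` words n k)"
    unfolding lin_ext_def by (intro nc.span_sum nc.span_scale nc.span_base) auto
  then show "f \<in> nc.span (word ` words n k)" by (simp add: lin_ext_words)
qed

lemma lin_ext_in_subspace:
  "nc.subspace V \<Longrightarrow> (\<And>w. w \<in> Poly_Mapping.keys f \<Longrightarrow> \<phi> w \<in> V) \<Longrightarrow> lin_ext \<phi> f \<in> V"
  unfolding lin_ext_def by (intro nc.subspace_sum nc.subspace_scale)

lemma word_in_NCPoly: "set w \<subseteq> {1..n} \<Longrightarrow> word w \<in> NCPoly n"
  by (simp add: NCPoly_def)

lemma word_homogeneous: "word w \<in> nc_homogeneous (length w)"
  by (simp add: nc_homogeneous_def)

lemma nc_linear_permute_vars: "nc_linear (permute_vars \<sigma>)"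
  unfolding permute_vars_def by (rule nc_linear_lin_ext)

lemma permute_vars_word [simp]: "permute_vars \<sigma> (word w) = word (map \<sigma> w)"
  by (simp add: permute_vars_def)

lemma permute_vars_homogeneous: "f \<in> nc_homogeneous k \<Longrightarrow> permute_vars \<sigma> f \<in> nc_homogeneous k"
  unfolding permute_vars_def using word_homogeneous
  by (intro lin_ext_in_subspace subspace_homogeneous) (auto simp: nc_homogeneous_def)

lemma set_map_permutes: "\<sigma> permutes S \<Longrightarrow> set w \<subseteq> S \<Longrightarrow> set (map \<sigma> w) \<subseteq> S"
  by (auto simp: permutes_in_image)

lemma permute_vars_NCPoly: "\<sigma> permutes {1..n} \<Longrightarrow> f \<in> NCPoly n \<Longrightarrow> permute_vars \<sigma> f \<in> NCPoly n"
proof -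
  assume a: "\<sigma> permutes {1..n}" "f \<in> NCPoly n"
  show ?thesis unfolding permute_vars_def
  proof (intro lin_ext_in_subspace subspace_NCPoly word_in_NCPoly)
    fix w assume "w \<in> Poly_Mapping.keys f"
    then have "set w \<subseteq> {1..n}" using a by (auto simp: NCPoly_def)
    then show "set (map \<sigma> w) \<subseteq> {1..n}" by (rule set_map_permutes[OF a(1)])
  qed
qed

lemma lookup_permute_vars:
  assumes "\<sigma> permutes S"
  shows "Poly_Mapping.lookup (permute_vars \<sigma> f) (map \<sigma> u) = Poly_Mapping.lookup f u"
proof -
  have "map \<sigma> w = map \<sigma> u \<longleftrightarrow> w = u" for w
    using permutes_inj[OF assms] inj_map_eq_map by blast
  then show ?thesis
    by (auto simp: permute_vars_def lookup_lin_ext lookup_single when_def in_keys_iff if_distrib cong: if_cong)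
qed

section \<open>Annihilation by symmetric polynomials, and traces on the full algebra\<close>

lemma poly_op_eq_lin_ext: "poly_op D p f = lin_ext (\<lambda>w. foldr D w f) p"
  by (simp add: poly_op_def lin_ext_def)

text \<open>Each word of the orbit of \<open>w\<close> occurs as often as its stabilizer has
  elements; a sum over permutations is easier to reindex than one over the orbit.\<close>

definition symmetrized_op :: "nat \<Rightarrow> (nat \<Rightarrow> ncpoly \<Rightarrow> ncpoly) \<Rightarrow> nat list \<Rightarrow> ncpoly \<Rightarrow> ncpoly"
  where "symmetrized_op n D w f = (\<Sum>\<sigma> | \<sigma> permutes {1..n}. foldr D (map \<sigma> w) f)"

text \<open>Symmetrised nonempty words span the symmetric polynomials without constant term: such a
  \<open>p\<close> is the average of its permuted copies. The family \<open>D\<close> is arbitrary,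
  so the criterion serves both kinds of harmonics.\<close>

lemma NCSym0_annihilated_iff:
  "(\<forall>p\<in>NCSym0 n. poly_op D p f = 0)
    \<longleftrightarrow> (\<forall>w. w \<noteq> [] \<longrightarrow> set w \<subseteq> {1..n} \<longrightarrow> symmetrized_op n D w f = 0)"
proof (intro iffI allI impI ballI)
  fix w :: "nat list"
  assume a: "\<forall>p\<in>NCSym0 n. poly_op D p f = 0" "w \<noteq> []" "set w \<subseteq> {1..n}"
  let ?p = "\<Sum>\<sigma> | \<sigma> permutes {1..n}. word (map \<sigma> w)"
  have "?p \<in> NCPoly n"
    using a(3) by (intro nc.subspace_sum subspace_NCPoly word_in_NCPoly set_map_permutes) auto
  moreover have "permute_vars \<tau> ?p = ?p" if "\<tau> permutes {1..n}" for \<tau>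
  proof -
    have "permute_vars \<tau> ?p = (\<Sum>\<sigma> | \<sigma> permutes {1..n}. word (map (\<tau> \<circ> \<sigma>) w))"
      by (simp add: module_hom.sum[OF nc_linear_permute_vars])
    also have "\<dots> = ?p"
      using setum_permutations_compose_left[OF that, of "\<lambda>\<sigma>. word (map \<sigma> w)"] by simp
    finally show ?thesis .
  qed
  moreover have "Poly_Mapping.lookup ?p [] = 0"
    using a(2) by (simp add: lookup_sum lookup_single)
  ultimately have "?p \<in> NCSym0 n"
    by (simp add: NCSym0_def NCSym_def)
  then have "poly_op D ?p f = 0" using a(1) by blast
  then show "symmetrized_op n D w f = 0"
    by (simp add: poly_op_eq_lin_ext module_hom.sum[OF nc_linear_lin_ext] symmetrized_op_def)
next
  fix p
  assume a: "\<forall>w. w \<noteq> [] \<longrightarrow> set w \<subseteq> {1..n} \<longrightarrow> symmetrized_op n D w f = 0" and p: "p \<in> NCSym0 n"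
  let ?\<phi> = "\<lambda>w. foldr D w f"
  let ?G = "{\<sigma>. \<sigma> permutes {1..n}}"
  have G: "finite ?G" "card ?G = fact n" by (simp_all add: finite_permutations card_permutations)
  have "nc_scale (of_nat (fact n)) (poly_op D p f) = (\<Sum>\<sigma>\<in>?G. poly_op D p f)"
    using G nc.sum_constant_scale[of "poly_op D p f" ?G] by simp
  also have "\<dots> = (\<Sum>\<sigma>\<in>?G. lin_ext ?\<phi> (permute_vars \<sigma> p))"
    using p by (intro sum.cong refl) (simp add: NCSym0_def NCSym_def poly_op_eq_lin_ext)
  also have "\<dots> = (\<Sum>\<sigma>\<in>?G. \<Sum>w\<in>Poly_Mapping.keys p. nc_scale (Poly_Mapping.lookup p w) (?\<phi> (map \<sigma> w)))"
    by (simp add: permute_vars_def lin_ext_compose) (simp add: lin_ext_def)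
  also have "\<dots> = (\<Sum>w\<in>Poly_Mapping.keys p. nc_scale (Poly_Mapping.lookup p w) (symmetrized_op n D w f))"
    by (subst sum.swap) (simp add: nc.scale_sum_right symmetrized_op_def)
  also have "\<dots> = 0"
  proof (intro sum.neutral ballI)
    fix w assume w: "w \<in> Poly_Mapping.keys p"
    with p have "w \<noteq> []" "set w \<subseteq> {1..n}"
      by (auto simp: NCSym0_def NCSym_def NCPoly_def in_keys_iff)
    with a show "nc_scale (Poly_Mapping.lookup p w) (symmetrized_op n D w f) = 0" by simp
  qed
  finally show "poly_op D p f = 0" by simp
qed

lemma card_fixed_words: "card {w \<in> words n k. map \<sigma> w = w} = num_fix {1..n} \<sigma> ^ k"
proof -
  have "map \<sigma> w = w \<longleftrightarrow> (\<forall>x\<in>set w. \<sigma> x = x)" for w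
    using map_eq_conv[of \<sigma> w "\<lambda>x. x"] by simp
  then have "{w \<in> words n k. map \<sigma> w = w} = {w. set w \<subseteq> {x \<in> {1..n}. \<sigma> x = x} \<and> length w = k}"
    by (auto simp: words_def)
  then show ?thesis by (simp add: num_fix_def card_lists_length_eq)
qed

text \<open>In the basis of words \<sigma> acts by a permutation matrix, so the trace counts fixed
  words.\<close>

lemma trace_NCPoly:
  assumes "\<sigma> permutes {1..n}"
  shows "nc.trace_on (NCPoly n \<inter> nc_homogeneous k) (permute_vars \<sigma>) = of_nat (num_fix {1..n} \<sigma> ^ k)"
proof -
  have "nc.trace_on (NCPoly n \<inter> nc_homogeneous k) (permute_vars \<sigma>)
      = (\<Sum>w\<in>words n k. Poly_Mapping.lookup (permute_vars \<sigma> (word w)) w)"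
  proof (rule nc.trace_on_frame)
    show "nc.subspace (NCPoly n \<inter> nc_homogeneous k)"
      by (rule nc.subspace_inter[OF subspace_NCPoly subspace_homogeneous])
    show "f = (\<Sum>w\<in>words n k. nc_scale (Poly_Mapping.lookup f w) (word w))"
      if "f \<in> NCPoly n \<inter> nc_homogeneous k" for f
      using that lin_ext_superset[of "words n k" f word] unfolding NCPoly_homogeneous_iff
      by (simp add: lin_ext_words)
    show "permute_vars \<sigma> f \<in> NCPoly n \<inter> nc_homogeneous k" if "f \<in> NCPoly n \<inter> nc_homogeneous k" for f
      using that permute_vars_homogeneous permute_vars_NCPoly[OF assms] by blast
    show "word w \<in> NCPoly n \<inter> nc_homogeneous k" if "w \<in> words n k" for w
      using that word_in_NCPoly[of w n] word_homogeneous[of w] by (auto simp: words_def)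
  qed (simp_all add: lookup_add nc_linear_permute_vars)
  also have "\<dots> = of_nat (card {w \<in> words n k. map \<sigma> w = w})"
    by (simp add: lookup_single when_def sum.If_cases Int_def)
  also have "\<dots> = of_nat (num_fix {1..n} \<sigma> ^ k)"
    by (simp only: card_fixed_words)
  finally show ?thesis .
qed

lemma inverse_one_minus_nth: "fps_nth (inverse (1 - of_nat m * fps_X :: rat fps)) k = of_nat (m ^ k)"
proof -
  have "(1 - of_nat m * fps_X) * Abs_fps (\<lambda>k. of_nat (m ^ k)) = (1 :: rat fps)"
  proof (rule fps_ext)
    fix k
    show "fps_nth ((1 - of_nat m * fps_X) * Abs_fps (\<lambda>k. of_nat (m ^ k))) k = fps_nth (1 :: rat fps) k"
      by (cases k) (simp_all add: left_diff_distrib mult.assoc fps_of_nat[symmetric])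
  qed
  then have "inverse (1 - of_nat m * fps_X) = (Abs_fps (\<lambda>k. of_nat (m ^ k)) :: rat fps)"
    by (metis fps_inverse_unique)
  then show ?thesis by simp
qed

section \<open>Words minimal in their orbit\<close>

text \<open>Elements are added in order of increasing rank, so the new row vanishes on the old
  elements and the inverse grows by one column. Both identities are kept: one gives duality, the
  other reconstruction.\<close>

lemma triangular_inverse:
  fixes A :: "'w \<Rightarrow> 'w \<Rightarrow> 'a::field" and r :: "'w \<Rightarrow> nat"
  assumes "finite W"
    and "\<And>w. w \<in> W \<Longrightarrow> A w w \<noteq> 0"
    and "\<And>w u. w \<in> W \<Longrightarrow> u \<in> W \<Longrightarrow> A w u \<noteq> 0 \<Longrightarrow> w = u \<or> r w < r u"
  shows "\<exists>B. \<forall>w\<in>W. \<forall>u\<in>W. (\<Sum>v\<in>W. A w v * B v u) = (if w = u then 1 else 0)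
      \<and> (\<Sum>v\<in>W. B w v * A v u) = (if w = u then 1 else 0)"
  using assms
proof (induction W rule: finite_ranking_induct[where f = r])
  case empty
  then show ?case by simp
next
  case (insert x S)
  have "\<exists>B. \<forall>w\<in>S. \<forall>u\<in>S. (\<Sum>v\<in>S. A w v * B v u) = (if w = u then 1 else 0)
      \<and> (\<Sum>v\<in>S. B w v * A v u) = (if w = u then 1 else 0)"
    by (rule insert.IH) (use insert.prems in auto)
  then obtain B where AB: "\<And>w u. w \<in> S \<Longrightarrow> u \<in> S \<Longrightarrow> (\<Sum>v\<in>S. A w v * B v u) = (if w = u then 1 else 0)"
    and BA: "\<And>w u. w \<in> S \<Longrightarrow> u \<in> S \<Longrightarrow> (\<Sum>v\<in>S. B w v * A v u) = (if w = u then 1 else 0)"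
    by blast
  show ?case
  proof (cases "x \<in> S")
    case True
    then have "insert x S = S" by auto
    then show ?thesis using AB BA by (intro exI[of _ B]) simp
  next
    case False
    have Ax: "A x u = 0" if "u \<in> S" for u
    proof (rule ccontr)
      assume "A x u \<noteq> 0"
      then have "x = u \<or> r x < r u" using insert.prems(2)[of x u] that by blast
      then show False using insert.hyps(2)[OF that] False that by auto
    qed
    have Axx: "A x x \<noteq> 0" using insert.prems by simp
    \<comment> \<open>Inverse of a block triangular matrix: the new column is minus \<open>B\<close>
      applied to the column of \<open>A\<close> at \<open>x\<close>, divided by
      \<open>A x x\<close>.\<close>
    define B' where "B' w u = (if w = x then if u = x then 1 / A x x else 0
      else if u = x then - (\<Sum>v\<in>S. B w v * A v x) / A x x else B w u)" for w u
    have S: "w \<noteq> x" if "w \<in> S" for w using that False by auto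
    have sum_ins: "(\<Sum>v\<in>insert x S. g v) = g x + (\<Sum>v\<in>S. g v)" for g :: "'w \<Rightarrow> 'a"
      using insert.hyps(1) False by simp
    have AS: "(\<Sum>v\<in>S. A w v * B' v x) = - A w x / A x x" if "w \<in> S" for w
    proof -
      have "(\<Sum>v\<in>S. A w v * B' v x) = (\<Sum>v\<in>S. \<Sum>v'\<in>S. - (A w v * B v v') * A v' x / A x x)"
        by (intro sum.cong refl) (simp add: S B'_def sum_distrib_left sum_negf sum_divide_distrib mult.assoc)
      also have "\<dots> = (\<Sum>v'\<in>S. - (\<Sum>v\<in>S. A w v * B v v') * A v' x / A x x)"
        by (subst sum.swap) (simp add: sum_distrib_right sum_negf sum_divide_distrib)
      also have "\<dots> = (\<Sum>v'\<in>S. if w = v' then - A v' x / A x x else 0)"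
        using that by (intro sum.cong refl) (simp add: AB)
      also have "\<dots> = - A w x / A x x"
        using that insert.hyps(1) by simp
      finally show ?thesis .
    qed
    have "(\<Sum>v\<in>insert x S. A w v * B' v u) = (if w = u then 1 else 0)
      \<and> (\<Sum>v\<in>insert x S. B' w v * A v u) = (if w = u then 1 else 0)"
      if "w \<in> insert x S" "u \<in> insert x S" for w u
    proof (cases "w = x"; cases "u = x")
      assume "w = x" "u = x"
      then show ?thesis using Ax Axx S by (simp add: sum_ins B'_def)
    next
      assume "w = x" "u \<noteq> x"
      then show ?thesis using Ax Axx S that by (auto simp add: sum_ins B'_def)
    next
      assume a: "w \<noteq> x" "u = x"
      then show ?thesis using Axx S that by (auto simp: sum_ins AS) (auto simp: B'_def)
    next
      assume a: "w \<noteq> x" "u \<noteq> x"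
      then have wu: "w \<in> S" "u \<in> S" using that by auto
      have "(\<Sum>v\<in>S. A w v * B' v u) = (\<Sum>v\<in>S. A w v * B v u)"
        "(\<Sum>v\<in>S. B' w v * A v u) = (\<Sum>v\<in>S. B w v * A v u)"
        using S a by (auto intro!: sum.cong simp: B'_def)
      then show ?thesis using a AB[OF wu] BA[OF wu] Ax[OF wu(2)] by (simp add: sum_ins) (simp add: B'_def)
    qed
    then show ?thesis by blast
  qed
qed

text \<open>The last letter is the most significant digit; this is what makes the minimal words below closed
  under suffixes.\<close>

fun word_key :: "nat \<Rightarrow> nat list \<Rightarrow> nat" where
  "word_key n [] = 0"
| "word_key n (a # w) = a + Suc n * word_key n w"

lemma word_key_append: "word_key n (u @ v) = word_key n u + Suc n ^ length u * word_key n v"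
  by (induction u) (simp_all add: algebra_simps)

lemma word_key_less: "set w \<subseteq> {1..n} \<Longrightarrow> word_key n w < Suc n ^ length w"
proof (induction w)
  case (Cons a w)
  then have "a \<le> n" "Suc (word_key n w) \<le> Suc n ^ length w" by auto
  then have "a + Suc n * word_key n w < Suc n * Suc (word_key n w)" by simp
  also have "\<dots> \<le> Suc n * Suc n ^ length w"
    using \<open>Suc (word_key n w) \<le> Suc n ^ length w\<close> by (rule mult_le_mono2)
  finally show ?case by simp
qed simp

lemma word_key_inj:
  "length u = length v \<Longrightarrow> set u \<subseteq> {1..n} \<Longrightarrow> set v \<subseteq> {1..n} \<Longrightarrow> word_key n u = word_key n v \<Longrightarrow> u = v"
proof (induction u v rule: list_induct2)
  case (Cons a u b v)
  have "a < Suc n" "b < Suc n" using Cons.prems by auto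
  have eq: "a + Suc n * word_key n u = b + Suc n * word_key n v"
    using Cons.prems by simp
  have "(a + Suc n * word_key n u) mod Suc n = a" "(b + Suc n * word_key n v) mod Suc n = b"
    using \<open>a < Suc n\<close> \<open>b < Suc n\<close> by (simp_all only: mod_mult_self2 mod_less)
  then have "a = b" using eq by metis
  then have "Suc n * word_key n u = Suc n * word_key n v" using eq by simp
  then have "word_key n u = word_key n v" by (simp only: mult_cancel1) simp
  then show ?case using Cons \<open>a = b\<close> by simp
qed simp

definition min_words :: "nat \<Rightarrow> nat list set"
  where "min_words n = {l. set l \<subseteq> {1..n} \<and>
    (\<forall>\<sigma>. \<sigma> permutes {1..n} \<longrightarrow> word_key n l \<le> word_key n (map \<sigma> l))}"

definition reduced_words :: "nat \<Rightarrow> nat list set"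
  where "reduced_words n = {c. set c \<subseteq> {1..n} \<and> (\<forall>l c'. c = l @ c' \<longrightarrow> l \<in> min_words n \<longrightarrow> l = [])}"

lemma Nil_min_words [simp]: "[] \<in> min_words n"
  by (simp add: min_words_def)

lemma min_words_append: "u \<in> min_words n \<Longrightarrow> v \<in> min_words n \<Longrightarrow> u @ v \<in> min_words n"
  by (simp add: min_words_def word_key_append add_mono)

text \<open>If \<sigma> lowered the key of \<open>v\<close>, the key of the whole word would drop by
  at least \<open>Suc n ^ length u\<close> in its high digits, more than the low digits coming from
  \<open>u\<close> can regain.\<close>

lemma min_words_suffix:
  assumes "u @ v \<in> min_words n"
  shows "v \<in> min_words n"
proof -
  have uv: "set u \<subseteq> {1..n}" "set v \<subseteq> {1..n}" using assms by (auto simp: min_words_def)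
  have "word_key n v \<le> word_key n (map \<sigma> v)" if "\<sigma> permutes {1..n}" for \<sigma>
  proof (rule ccontr)
    assume "\<not> ?thesis"
    then have "Suc (word_key n (map \<sigma> v)) \<le> word_key n v" by simp
    then have "Suc n ^ length u * Suc (word_key n (map \<sigma> v)) \<le> Suc n ^ length u * word_key n v"
      by (rule mult_le_mono2)
    moreover have "word_key n (map \<sigma> u) < Suc n ^ length u"
      using word_key_less[OF set_map_permutes[OF that uv(1)]] by simp
    moreover have "word_key n (u @ v) \<le> word_key n (map \<sigma> (u @ v))"
      using assms that unfolding min_words_def by blast
    ultimately show False by (simp add: word_key_append)
  qed
  then show ?thesis using uv by (simp add: min_words_def)
qed

text \<open>The overhang \<open>v\<close> of the longer minimal part is a suffix of a minimal word,
  hence minimal, and a prefix of a reduced word, hence empty.\<close>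

lemma decomposition_unique:
  assumes "l @ c = l' @ c'" "l \<in> min_words n" "l' \<in> min_words n" "c \<in> reduced_words n" "c' \<in> reduced_words n"
  shows "l = l' \<and> c = c'"
proof -
  from assms(1) obtain v where v: "l = l' @ v \<and> v @ c = c' \<or> l @ v = l' \<and> c = v @ c'"
    by (auto simp: append_eq_append_conv2)
  then have "v \<in> min_words n" using assms(2,3) min_words_suffix by auto
  then have "v = []" using v assms(4,5) by (auto simp: reduced_words_def)
  then show ?thesis using v by auto
qed

text \<open>The longest minimal prefix is split off; a nonempty minimal prefix of the rest could be
  appended to it.\<close>

lemma decomposition_exists:
  assumes "set w \<subseteq> {1..n}"
  shows "\<exists>l c. w = l @ c \<and> l \<in> min_words n \<and> c \<in> reduced_words n"
proof -
  let ?P = "\<lambda>i. i \<le> length w \<and> take i w \<in> min_words n"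
  define i where "i = (GREATEST i. ?P i)"
  have ex: "?P 0" by simp
  have i: "?P i" unfolding i_def by (rule GreatestI_nat[where P = ?P, OF ex, of "length w"]) simp
  have max: "j \<le> i" if "?P j" for j unfolding i_def by (rule Greatest_le_nat[where P = ?P, OF that, of "length w"]) simp
  have "drop i w \<in> reduced_words n"
  proof -
    have "l = []" if "drop i w = l @ c'" "l \<in> min_words n" for l c'
    proof -
      have "w = take i w @ l @ c'" using that(1) append_take_drop_id[of i w] by simp
      then have "take (i + length l) w = take i w @ l"
        using i by (metis append.assoc append_eq_conv_conj length_append length_take min.absorb2)
      then have "take (i + length l) w \<in> min_words n"
        using min_words_append i that(2) by simp
      moreover have "i + length l \<le> length w"
        using arg_cong[OF that(1), of length] i by auto
      ultimately have "i + length l \<le> i" using max by blast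
      then show ?thesis by simp
    qed
    moreover have "set (drop i w) \<subseteq> {1..n}" using assms set_drop_subset[of i w] by blast
    ultimately show ?thesis unfolding reduced_words_def by blast
  qed
  then show ?thesis using i append_take_drop_id[of i w] by metis
qed

text \<open>Only meant for words in the letters \<open>1, \<dots>, n\<close>; otherwise the choice is arbitrary.\<close>

definition min_part :: "nat \<Rightarrow> nat list \<Rightarrow> nat list"
  where "min_part n w = (SOME l. l \<in> min_words n \<and> (\<exists>c. w = l @ c \<and> c \<in> reduced_words n))"

definition reduced_part :: "nat \<Rightarrow> nat list \<Rightarrow> nat list"
  where "reduced_part n w = drop (length (min_part n w)) w"

lemma decomposition:
  assumes "set w \<subseteq> {1..n}"
  shows "min_part n w \<in> min_words n" "reduced_part n w \<in> reduced_words n" "w = min_part n w @ reduced_part n w"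
proof -
  have "min_part n w \<in> min_words n \<and> (\<exists>c. w = min_part n w @ c \<and> c \<in> reduced_words n)"
    unfolding min_part_def by (rule someI_ex) (use decomposition_exists[OF assms] in blast)
  then obtain c where c: "min_part n w \<in> min_words n" "w = min_part n w @ c" "c \<in> reduced_words n"
    by blast
  have "reduced_part n w = c"
    unfolding reduced_part_def using c(2) by (metis append_eq_conv_conj)
  then show "min_part n w \<in> min_words n" "reduced_part n w \<in> reduced_words n" "w = min_part n w @ reduced_part n w"
    using c by simp_all
qed

lemma min_words_subset: "l \<in> min_words n \<Longrightarrow> set l \<subseteq> {1..n}"
  by (simp add: min_words_def)

lemma reduced_words_subset: "c \<in> reduced_words n \<Longrightarrow> set c \<subseteq> {1..n}"
  by (simp add: reduced_words_def)

lemma parts_append: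
  assumes "l \<in> min_words n" "c \<in> reduced_words n"
  shows "min_part n (l @ c) = l" "reduced_part n (l @ c) = c"
proof -
  have "set (l @ c) \<subseteq> {1..n}" using assms min_words_subset reduced_words_subset by simp
  from decomposition[OF this] decomposition_unique[OF decomposition(3)[OF this] assms(1) _ assms(2)]
  show "min_part n (l @ c) = l" "reduced_part n (l @ c) = c" by auto
qed

lemma ex_min_representative:
  assumes "set l \<subseteq> {1..n}"
  shows "\<exists>\<tau>. \<tau> permutes {1..n} \<and> map \<tau> l \<in> min_words n"
proof -
  let ?G = "{\<sigma>. \<sigma> permutes {1..n}}"
  have "id \<in> ?G" by (simp add: permutes_id)
  then obtain \<tau> where t: "\<tau> \<in> ?G" "\<And>\<sigma>. \<sigma> \<in> ?G \<Longrightarrow> word_key n (map \<tau> l) \<le> word_key n (map \<sigma> l)"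
    using ex_has_least_nat[of "\<lambda>\<sigma>. \<sigma> \<in> ?G" id "\<lambda>\<sigma>. word_key n (map \<sigma> l)"] by blast
  have "word_key n (map \<tau> l) \<le> word_key n (map \<sigma> (map \<tau> l))" if "\<sigma> permutes {1..n}" for \<sigma>
    using t(2)[of "\<sigma> \<circ> \<tau>"] t(1) permutes_compose[OF _ that, of \<tau>] by simp
  then have "map \<tau> l \<in> min_words n"
    using t(1) assms set_map_permutes[of \<tau> "{1..n}" l] by (simp add: min_words_def)
  then show ?thesis using t(1) by blast
qed

lemma min_words_unique:
  assumes "l \<in> min_words n" "map \<tau> l \<in> min_words n" "\<tau> permutes {1..n}"
  shows "map \<tau> l = l"
proof (rule word_key_inj[of _ _ n])
  have "map (inv \<tau>) (map \<tau> l) = l" using permutes_inverses[OF assms(3)] by (simp add: map_idI)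
  moreover have "word_key n (map \<tau> l) \<le> word_key n (map (inv \<tau>) (map \<tau> l))"
    using assms(2) permutes_inv[OF assms(3)] unfolding min_words_def by blast
  moreover have "word_key n l \<le> word_key n (map \<tau> l)"
    using assms(1,3) unfolding min_words_def by blast
  ultimately show "word_key n (map \<tau> l) = word_key n l" by simp
qed (use min_words_subset[OF assms(1)] min_words_subset[OF assms(2)] in simp_all)

text \<open>Burnside's lemma: every orbit contains exactly one minimal word, and \<sigma> fixes
  exactly the words in its fixed letters.\<close>

lemma card_min_words: "card {l \<in> min_words n. length l = k} * fact n = (\<Sum>\<sigma> | \<sigma> permutes {1..n}. num_fix {1..n} \<sigma> ^ k)"
proof -
  let ?G = "{\<sigma>. \<sigma> permutes {1..n}}" and ?L = "{l \<in> min_words n. length l = k}"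
  let ?O = "\<lambda>l. (\<lambda>\<sigma>. map \<sigma> l) ` ?G"
  have finG: "finite ?G" by (rule finite_permutations) simp
  have L: "?L \<subseteq> words n k" by (auto simp: words_def min_words_def)
  then have finL: "finite ?L" by (rule finite_subset) simp
  have un: "words n k = (\<Union>l\<in>?L. ?O l)"
  proof (intro equalityI subsetI)
    fix w assume w: "w \<in> words n k"
    then obtain \<tau> where t: "\<tau> permutes {1..n}" "map \<tau> w \<in> min_words n"
      using ex_min_representative[of w n] by (auto simp: words_def)
    have "w = map (inv \<tau>) (map \<tau> w)" using permutes_inverses[OF t(1)] by (simp add: map_idI)
    then have "w \<in> ?O (map \<tau> w)" using permutes_inv[OF t(1)] by blast
    moreover have "map \<tau> w \<in> ?L" using t w by (simp add: words_def)
    ultimately show "w \<in> (\<Union>l\<in>?L. ?O l)" by blast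
  next
    fix w assume "w \<in> (\<Union>l\<in>?L. ?O l)"
    then obtain l \<sigma> where l: "l \<in> ?L" "\<sigma> permutes {1..n}" "w = map \<sigma> l" by blast
    then show "w \<in> words n k"
      using set_map_permutes[OF l(2), of l] min_words_subset[of l n] by (auto simp: words_def)
  qed
  have disj: "?O l \<inter> ?O l' = {}" if "l \<in> ?L" "l' \<in> ?L" "l \<noteq> l'" for l l'
  proof (rule ccontr)
    assume "?O l \<inter> ?O l' \<noteq> {}"
    then obtain \<sigma> \<tau> where s: "\<sigma> permutes {1..n}" "\<tau> permutes {1..n}" "map \<sigma> l = map \<tau> l'" by auto
    have "map (inv \<sigma>) (map \<sigma> l) = l" using permutes_inverses[OF s(1)] by (simp add: map_idI)
    then have "l = map (inv \<sigma> \<circ> \<tau>) l'" using s(3) by simp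
    moreover have "(inv \<sigma> \<circ> \<tau>) permutes {1..n}" using s permutes_compose permutes_inv by blast
    ultimately show False using min_words_unique[of l' n "inv \<sigma> \<circ> \<tau>"] that by auto
  qed
  have "(\<Sum>\<sigma>\<in>?G. num_fix {1..n} \<sigma> ^ k) = (\<Sum>\<sigma>\<in>?G. card {w \<in> words n k. map \<sigma> w = w})"
    by (simp only: card_fixed_words)
  also have "\<dots> = (\<Sum>w\<in>words n k. card {\<sigma> \<in> ?G. map \<sigma> w = w})"
    using sum.swap_restrict[OF finG finite_words[of n k], of "\<lambda>_ _. 1::nat" "\<lambda>\<sigma> w. map \<sigma> w = w"] by simp
  also have "\<dots> = (\<Sum>l\<in>?L. \<Sum>w\<in>?O l. card {\<sigma> \<in> ?G. map \<sigma> w = w})"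
    unfolding un using finL finG disj by (intro sum.UNION_disjoint) auto
  also have "\<dots> = (\<Sum>l\<in>?L. fact n)"
  proof (intro sum.cong refl)
    fix l
    show "(\<Sum>w\<in>?O l. card {\<sigma> \<in> ?G. map \<sigma> w = w}) = fact n"
      using sum_card_stabilizers[of "{1..n}" "?O l" "\<lambda>\<sigma> w. map \<sigma> w" l] by simp
  qed
  finally show ?thesis by simp
qed

section \<open>Pairing with products of an orbit sum and a word\<close>

text \<open>\<open>h\<close> is a linear form given by its values on words, evaluated at the
  symmetrisation of \<open>l\<close> times \<open>u\<close>. If \<open>h\<close> lists the
  coefficients of a polynomial, this is the scalar product of that polynomial with the
  product.\<close>

definition sym_pairing :: "nat \<Rightarrow> (nat list \<Rightarrow> rat) \<Rightarrow> nat list \<Rightarrow> nat list \<Rightarrow> rat"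
  where "sym_pairing n h l u = (\<Sum>\<sigma> | \<sigma> permutes {1..n}. h (map \<sigma> l @ u))"

abbreviation word_pairing :: "nat \<Rightarrow> (nat list \<Rightarrow> rat) \<Rightarrow> nat list \<Rightarrow> rat"
  where "word_pairing n h w \<equiv> sym_pairing n h (min_part n w) (reduced_part n w)"

lemma sym_pairing_map:
  "\<tau> permutes {1..n} \<Longrightarrow> sym_pairing n h (map \<tau> l) u = sym_pairing n h l u"
  unfolding sym_pairing_def
  using sum_permutations_compose_right[of \<tau> "{1..n}" "\<lambda>\<sigma>. h (map \<sigma> l @ u)"] by simp

text \<open>Substituting \<open>\<sigma> \<circ> \<tau>\<close> for \<tau> turns a product of two
  symmetrisations into a sum of symmetrisations; closure of the symmetric polynomials under
  multiplication enters in this form.\<close>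

lemma sum_sym_pairing:
  "(\<Sum>\<tau> | \<tau> permutes {1..n}. sym_pairing n h l (map \<tau> l' @ c))
    = (\<Sum>\<tau> | \<tau> permutes {1..n}. sym_pairing n h (l @ map \<tau> l') c)"
proof -
  let ?G = "{\<sigma>. \<sigma> permutes {1..n}}"
  have "(\<Sum>\<tau>\<in>?G. sym_pairing n h l (map \<tau> l' @ c)) = (\<Sum>\<sigma>\<in>?G. \<Sum>\<tau>\<in>?G. h (map \<sigma> l @ map \<tau> l' @ c))"
    unfolding sym_pairing_def by (rule sum.swap)
  also have "\<dots> = (\<Sum>\<sigma>\<in>?G. \<Sum>\<tau>\<in>?G. h (map \<sigma> l @ map (\<sigma> \<circ> \<tau>) l' @ c))"
    by (intro sum.cong refl setum_permutations_compose_left) simp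
  also have "\<dots> = (\<Sum>\<tau>\<in>?G. sym_pairing n h (l @ map \<tau> l') c)"
    unfolding sym_pairing_def by (subst sum.swap) simp
  finally show ?thesis .
qed

text \<open>Replacing \<open>l\<close> by the minimal word of its orbit keeps the symmetrisation and
  makes the product a member of the basis.\<close>

lemma sym_pairing_eq_word_pairing:
  assumes "set l \<subseteq> {1..n}" "c \<in> reduced_words n"
  obtains l' where "l' \<in> min_words n" "length l' = length l" "sym_pairing n h l c = word_pairing n h (l' @ c)"
proof -
  obtain \<tau> where t: "\<tau> permutes {1..n}" "map \<tau> l \<in> min_words n"
    using ex_min_representative[OF assms(1)] by blast
  then have "sym_pairing n h l c = word_pairing n h (map \<tau> l @ c)"
    by (simp add: parts_append[OF t(2) assms(2)] sym_pairing_map)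
  then show thesis using that[of "map \<tau> l"] t by simp
qed

text \<open>Passing from words to the basis products is triangular: the minimal word has the
  smallest key in its orbit, and the reduced part is common to all terms. \<open>b\<close> is the
  dual basis.\<close>

lemma dual_basis_exists:
  "\<exists>b. (\<forall>k. \<forall>w\<in>words n k. \<forall>w'\<in>words n k. word_pairing n (b w) w' = (if w = w' then 1 else 0))
    \<and> (\<forall>k h. \<forall>u\<in>words n k. h u = (\<Sum>w\<in>words n k. word_pairing n h w * b w u))"
proof -
  let ?G = "{\<sigma>. \<sigma> permutes {1..n}}"
  have finG: "finite ?G" by (rule finite_permutations) simp
  \<comment> \<open>The coefficient of the word \<open>u\<close> in the basis product attached to
    \<open>w\<close>.\<close>
  define A :: "nat list \<Rightarrow> nat list \<Rightarrow> rat"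
    where "A w u = of_nat (card {\<sigma> \<in> ?G. map \<sigma> (min_part n w) @ reduced_part n w = u})" for w u
  have A0: "w = u \<or> word_key n w < word_key n u" if "w \<in> words n k" "u \<in> words n k" "A w u \<noteq> 0" for k w u
  proof -
    have w: "set w \<subseteq> {1..n}" using that by (simp add: words_def)
    have "{\<sigma> \<in> ?G. map \<sigma> (min_part n w) @ reduced_part n w = u} \<noteq> {}"
      using that(3) unfolding A_def by (metis card.empty of_nat_0)
    then obtain \<sigma> where s: "\<sigma> permutes {1..n}" "map \<sigma> (min_part n w) @ reduced_part n w = u" by blast
    have "word_key n (min_part n w) \<le> word_key n (map \<sigma> (min_part n w))"
      using decomposition(1)[OF w] s(1) unfolding min_words_def by blast
    then have "word_key n (min_part n w @ reduced_part n w) \<le> word_key n u"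
      unfolding s(2)[symmetric] word_key_append by simp
    then have "word_key n w \<le> word_key n u" by (simp only: decomposition(3)[OF w, symmetric])
    moreover have "word_key n w = word_key n u \<Longrightarrow> w = u"
      using that by (intro word_key_inj[of w u n]) (simp_all add: words_def)
    ultimately show ?thesis by linarith
  qed
  have A1: "A w w \<noteq> 0" if "w \<in> words n k" for k w
  proof -
    have w: "set w \<subseteq> {1..n}" using that by (simp add: words_def)
    then have "id \<in> {\<sigma> \<in> ?G. map \<sigma> (min_part n w) @ reduced_part n w = w}"
      by (simp add: permutes_id decomposition(3)[OF w, symmetric])
    then have "{\<sigma> \<in> ?G. map \<sigma> (min_part n w) @ reduced_part n w = w} \<noteq> {}" by blast
    moreover have "finite {\<sigma> \<in> ?G. map \<sigma> (min_part n w) @ reduced_part n w = w}" using finG by simp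
    ultimately show ?thesis unfolding A_def by (simp only: of_nat_eq_0_iff card_0_eq) simp
  qed
  have pair: "word_pairing n h w = (\<Sum>u\<in>words n k. A w u * h u)" if "w \<in> words n k" for h k w
  proof -
    have w: "set w \<subseteq> {1..n}" "length w = k" using that by (simp_all add: words_def)
    let ?f = "\<lambda>\<sigma>. map \<sigma> (min_part n w) @ reduced_part n w"
    have im: "?f ` ?G \<subseteq> words n k"
    proof
      fix u assume "u \<in> ?f ` ?G"
      then obtain \<sigma> where s: "\<sigma> permutes {1..n}" "u = ?f \<sigma>" by blast
      have "length (min_part n w @ reduced_part n w) = k" using w(2) by (simp only: decomposition(3)[OF w(1), symmetric])
      then show "u \<in> words n k"
        using s set_map_permutes[OF s(1) min_words_subset[OF decomposition(1)[OF w(1)]]]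
          reduced_words_subset[OF decomposition(2)[OF w(1)]] by (auto simp: words_def)
    qed
    have "word_pairing n h w = (\<Sum>u\<in>words n k. \<Sum>\<sigma> | \<sigma> \<in> ?G \<and> ?f \<sigma> = u. h (?f \<sigma>))"
      unfolding sym_pairing_def by (rule sum.group[OF finG finite_words im, symmetric])
    also have "\<dots> = (\<Sum>u\<in>words n k. A w u * h u)"
      by (intro sum.cong refl) (simp add: A_def)
    finally show ?thesis .
  qed
  have "\<exists>B. \<forall>w\<in>words n k. \<forall>u\<in>words n k. (\<Sum>v\<in>words n k. A w v * B v u) = (if w = u then 1 else 0)
      \<and> (\<Sum>v\<in>words n k. B w v * A v u) = (if w = u then 1 else 0)" for k
    by (rule triangular_inverse[where r = "word_key n"]) (use A0 A1 in auto)
  then obtain B where B: "\<And>k. \<forall>w\<in>words n k. \<forall>u\<in>words n k. (\<Sum>v\<in>words n k. A w v * B k v u) = (if w = u then 1 else 0)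
      \<and> (\<Sum>v\<in>words n k. B k w v * A v u) = (if w = u then 1 else 0)"
    by metis
  show ?thesis
  \<comment> \<open>Dual vectors are columns of the inverse matrix, hence the transposed arguments;
    the length selects the degree.\<close>
  proof (intro exI[of _ "\<lambda>w u. B (length w) u w"] conjI allI ballI)
    fix k w w' assume w: "w \<in> words n k" "w' \<in> words n k"
    then have "length w = k" by (simp add: words_def)
    then show "word_pairing n (\<lambda>u. B (length w) u w) w' = (if w = w' then 1 else 0)"
      unfolding pair[OF w(2)] using B[of k] w by auto
  next
    fix k u and h :: "nat list \<Rightarrow> rat" assume u: "u \<in> words n k"
    have len: "length w = k" if "w \<in> words n k" for w using that by (simp add: words_def)
    have "(\<Sum>w\<in>words n k. word_pairing n h w * B (length w) u w)
        = (\<Sum>w\<in>words n k. \<Sum>v\<in>words n k. (B k u w * A w v) * h v)"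
      using len by (intro sum.cong refl) (simp add: pair sum_distrib_right sum_distrib_left mult_ac)
    also have "\<dots> = (\<Sum>v\<in>words n k. (\<Sum>w\<in>words n k. B k u w * A w v) * h v)"
      by (subst sum.swap) (simp add: sum_distrib_right)
    also have "\<dots> = (\<Sum>v\<in>words n k. if u = v then h v else 0)"
      using B[of k] u by (intro sum.cong refl) simp
    also have "\<dots> = h u" using u by simp
    finally show "h u = (\<Sum>w\<in>words n k. word_pairing n h w * B (length w) u w)" ..
  qed
qed

section \<open>The trace on twisted harmonics\<close>

lemma lookup_twisted_deriv: "Poly_Mapping.lookup (twisted_deriv x f) u = Poly_Mapping.lookup f (x # u)"
proof -
  have "Poly_Mapping.lookup (case w of [] \<Rightarrow> 0 | y # w' \<Rightarrow> if y = x then word w' else (0 :: ncpoly)) u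
      = (if w = x # u then 1 else 0)" for w
    by (simp add: lookup_single when_def split: list.split)
  then show ?thesis
    by (simp only: twisted_deriv_def lookup_lin_ext) (simp add: in_keys_iff if_distrib cong: if_cong)
qed

text \<open>The last letter of \<open>w\<close> acts first and strips the first letter of its
  argument, hence the reversal.\<close>

lemma lookup_foldr_twisted_deriv:
  "Poly_Mapping.lookup (foldr twisted_deriv w f) u = Poly_Mapping.lookup f (rev w @ u)"
  by (induction w arbitrary: u) (simp_all add: lookup_twisted_deriv)

text \<open>Orthogonality to the right ideal generated by the symmetrised nonempty words. The
  reversal commutes with the action on letters and is absorbed into the quantifier over
  \<open>l\<close>.\<close>

lemma NCHar_iff: "f \<in> NCHar n \<longleftrightarrow> f \<in> NCPoly n
    \<and> (\<forall>l u. l \<noteq> [] \<longrightarrow> set l \<subseteq> {1..n} \<longrightarrow> sym_pairing n (Poly_Mapping.lookup f) l u = 0)"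
proof -
  have "symmetrized_op n twisted_deriv w f = 0
      \<longleftrightarrow> (\<forall>u. sym_pairing n (Poly_Mapping.lookup f) (rev w) u = 0)" for w
    unfolding poly_mapping_eq_iff fun_eq_iff
    by (simp add: symmetrized_op_def lookup_sum lookup_foldr_twisted_deriv sym_pairing_def rev_map)
  then show ?thesis
    unfolding NCHar_def mem_Collect_eq NCSym0_annihilated_iff by (metis rev_is_Nil_conv rev_rev_ident set_rev)
qed

lemma subspace_NCHar: "nc.subspace (NCHar n)"
proof -
  have eq: "NCHar n = NCPoly n \<inter> {f. \<forall>l u. l \<noteq> [] \<longrightarrow> set l \<subseteq> {1..n} \<longrightarrow> sym_pairing n (Poly_Mapping.lookup f) l u = 0}"
    by (rule set_eqI) (simp only: NCHar_iff Int_iff mem_Collect_eq)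
  show ?thesis unfolding eq
    by (intro nc.subspace_inter subspace_NCPoly)
      (simp add: nc.subspace_def sym_pairing_def lookup_add sum.distrib sum_distrib_left[symmetric])
qed

text \<open>The symmetrised factor is invariant, so \<sigma> only moves \<open>u\<close>.\<close>

lemma sym_pairing_permute_vars:
  assumes "\<sigma> permutes {1..n}"
  shows "sym_pairing n (Poly_Mapping.lookup (permute_vars \<sigma> f)) l (map \<sigma> u) = sym_pairing n (Poly_Mapping.lookup f) l u"
proof -
  have "sym_pairing n (Poly_Mapping.lookup (permute_vars \<sigma> f)) l (map \<sigma> u)
      = (\<Sum>\<tau> | \<tau> permutes {1..n}. Poly_Mapping.lookup (permute_vars \<sigma> f) (map (\<sigma> \<circ> \<tau>) l @ map \<sigma> u))"
    unfolding sym_pairing_def by (rule setum_permutations_compose_left[OF assms])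
  also have "\<dots> = sym_pairing n (Poly_Mapping.lookup f) l u"
    unfolding sym_pairing_def
    by (intro sum.cong refl) (simp only: map_map[symmetric] map_append[symmetric] lookup_permute_vars[OF assms])
  finally show ?thesis .
qed

lemma map_map_inv: "\<sigma> permutes S \<Longrightarrow> map \<sigma> (map (inv \<sigma>) u) = u"
  by (simp add: map_idI permutes_inverses)

lemma NCHar_permute_vars:
  assumes s: "\<sigma> permutes {1..n}" and f: "f \<in> NCHar n"
  shows "permute_vars \<sigma> f \<in> NCHar n"
proof -
  have "sym_pairing n (Poly_Mapping.lookup (permute_vars \<sigma> f)) l u = 0" if "l \<noteq> []" "set l \<subseteq> {1..n}" for l u
    using sym_pairing_permute_vars[OF s, of f l "map (inv \<sigma>) u"] f that
    by (simp only: NCHar_iff map_map_inv[OF s]) simp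
  then show ?thesis using permute_vars_NCPoly[OF s] f by (simp add: NCHar_iff)
qed

lemma words_append: "u \<in> words n j \<Longrightarrow> v \<in> words n k \<Longrightarrow> u @ v \<in> words n (j + k)"
  by (auto simp: words_def)

text \<open>In the basis dual to the products, the diagonal entry of \<sigma> at
  \<open>l @ c\<close> equals the entry at \<open>c\<close> of its action on the harmonics. Summing
  over the unique factorisations gives a convolution.\<close>

lemma trace_NCHar_convolution:
  assumes s: "\<sigma> permutes {1..n}"
  shows "of_nat (num_fix {1..n} \<sigma> ^ k) = (\<Sum>j=0..k. of_nat (card {l \<in> min_words n. length l = j})
      * nc.trace_on (NCHar n \<inter> nc_homogeneous (k - j)) (permute_vars \<sigma>))"
proof -
  let ?G = "{\<sigma>. \<sigma> permutes {1..n}}"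
  have cardG: "card ?G = fact n" by (simp add: card_permutations)
  let ?C = "\<lambda>j. {c \<in> reduced_words n. length c = j}"
  let ?L = "\<lambda>j. {l \<in> min_words n. length l = j}"
  obtain b where dual: "\<And>k w w'. w \<in> words n k \<Longrightarrow> w' \<in> words n k \<Longrightarrow> word_pairing n (b w) w' = (if w = w' then 1 else 0)"
    and expand: "\<And>k h u. u \<in> words n k \<Longrightarrow> h u = (\<Sum>w\<in>words n k. word_pairing n h w * b w u)"
    using dual_basis_exists[of n] by blast
  have C_words: "c \<in> words n j" if "c \<in> ?C j" for c j
    using that reduced_words_subset by (auto simp: words_def)
  have L_words: "l \<in> words n j" if "l \<in> ?L j" for l j
    using that min_words_subset by (auto simp: words_def)
  have finC: "finite (?C j)" for j
    by (rule finite_subset[OF subsetI finite_words[of n j]]) (rule C_words)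
  have finL: "finite (?L j)" for j
    by (rule finite_subset[OF subsetI finite_words[of n j]]) (rule L_words)
  have parts_C: "min_part n c = []" "reduced_part n c = c" if "c \<in> reduced_words n" for c
    using parts_append[of "[]" n c] that by simp_all
  \<comment> \<open>The symmetrisation of the empty word is n! times the unit; this is the origin of
    every factor n! below.\<close>
  have pair_C: "word_pairing n h c = of_nat (fact n) * h c" if "c \<in> reduced_words n" for h c
    by (simp only: parts_C[OF that]) (simp add: sym_pairing_def cardG[unfolded One_nat_def])
  have not_C: "min_part n w \<noteq> []" if "w \<in> words n j" "w \<notin> ?C j" for w j
  proof
    assume "min_part n w = []"
    moreover have w: "set w \<subseteq> {1..n}" "length w = j" using that(1) by (simp_all add: words_def)
    ultimately have "w = reduced_part n w" using decomposition(3)[OF w(1)] by (metis append_Nil)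
    then have "w \<in> reduced_words n" using decomposition(2)[OF w(1)] by metis
    then show False using that(2) w(2) by simp
  qed
  have parts_words: "set w \<subseteq> {1..n}" if "w \<in> words n j" for w j
    using that by (simp add: words_def)

  define v where "v w = (\<Sum>u\<in>words n (length w). nc_scale (b w u) (word u))" for w
  have v_lookup: "Poly_Mapping.lookup (v w) u = (if u \<in> words n (length w) then b w u else 0)" for w u
    by (simp add: v_def lookup_sum lookup_single mult_when) (simp add: when_def)
  have v_homog: "v w \<in> NCPoly n \<inter> nc_homogeneous (length w)" for w
    unfolding NCPoly_homogeneous_iff by (auto simp: in_keys_iff v_lookup split: if_splits)
  have pair_cong: "word_pairing n h w = word_pairing n h' w"
    if "w \<in> words n j" "\<And>u. u \<in> words n j \<Longrightarrow> h u = h' u" for h h' w j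
    unfolding sym_pairing_def
  proof (intro sum.cong refl that(2))
    fix \<tau> assume "\<tau> \<in> ?G"
    then have t: "\<tau> permutes {1..n}" by simp
    note d = decomposition[OF parts_words[OF that(1)]]
    have "length (min_part n w @ reduced_part n w) = j"
      using that(1) by (simp only: d(3)[symmetric]) (simp add: words_def)
    then show "map \<tau> (min_part n w) @ reduced_part n w \<in> words n j"
      using set_map_permutes[OF t min_words_subset[OF d(1)]] reduced_words_subset[OF d(2)]
      by (simp add: words_def)
  qed
  have v_dual: "word_pairing n (Poly_Mapping.lookup (v w)) w' = (if w = w' then 1 else 0)"
    if "w \<in> words n j" "w' \<in> words n j" for w w' j
  proof -
    have "length w = j" using that(1) by (simp add: words_def)
    then have "word_pairing n (Poly_Mapping.lookup (v w)) w' = word_pairing n (b w) w'"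
      by (intro pair_cong[OF that(2)]) (simp add: v_lookup)
    then show ?thesis using dual[OF that] by simp
  qed
  have v_expand: "h u = (\<Sum>w\<in>words n j. word_pairing n h w * Poly_Mapping.lookup (v w) u)" if "u \<in> words n j" for h u j
    unfolding expand[OF that, of h]
    using that by (intro sum.cong refl) (auto simp: v_lookup words_def)

  \<comment> \<open>\<open>sym_pairing n h l\<close> is tested on the basis products: multiplying
    the two symmetrised factors gives symmetrisations of words at least as long as \<open>l\<close>,
    on which \<open>h\<close> vanishes.\<close>
  have vanish: "sym_pairing n h l u = 0"
    if h: "\<And>w. w \<in> words n (length l + length u) \<Longrightarrow> min_part n w \<noteq> [] \<Longrightarrow> word_pairing n h w = 0"
      and l: "l \<noteq> []" "set l \<subseteq> {1..n}" and u: "set u \<subseteq> {1..n}" for h l u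
  proof -
    have "word_pairing n (sym_pairing n h l) w = 0" if w: "w \<in> words n (length u)" for w
    proof -
      note d = decomposition[OF parts_words[OF w]]
      have len: "length (min_part n w) + length (reduced_part n w) = length u"
        using arg_cong[OF d(3), of length] w by (simp add: words_def)
      have "word_pairing n (sym_pairing n h l) w = (\<Sum>\<tau>\<in>?G. sym_pairing n h (l @ map \<tau> (min_part n w)) (reduced_part n w))"
        using sum_sym_pairing[of n h l "min_part n w" "reduced_part n w"]
        by (simp add: sym_pairing_def[of n "sym_pairing n h l"])
      also have "\<dots> = 0"
      proof (intro sum.neutral ballI)
        fix \<tau> assume t: "\<tau> \<in> ?G"
        have "set (l @ map \<tau> (min_part n w)) \<subseteq> {1..n}"
          using l(2) set_map_permutes[of \<tau> "{1..n}", OF _ min_words_subset[OF d(1)]] t by simp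
        from sym_pairing_eq_word_pairing[OF this d(2), of h]
        obtain l' where l': "l' \<in> min_words n" "length l' = length (l @ map \<tau> (min_part n w))"
          "sym_pairing n h (l @ map \<tau> (min_part n w)) (reduced_part n w) = word_pairing n h (l' @ reduced_part n w)" .
        have "l' @ reduced_part n w \<in> words n (length l + length u)"
          using l' len min_words_subset[OF l'(1)] reduced_words_subset[OF d(2)] by (simp add: words_def)
        moreover have "min_part n (l' @ reduced_part n w) \<noteq> []"
          using parts_append(1)[OF l'(1) d(2)] l'(2) l(1) by auto
        ultimately show "sym_pairing n h (l @ map \<tau> (min_part n w)) (reduced_part n w) = 0"
          unfolding l'(3) by (rule h)
      qed
      finally show ?thesis .
    qed
    then show ?thesis
      using expand[of u "length u" "sym_pairing n h l"] u by (simp add: words_def)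
  qed

  have v_NCHar: "v c \<in> NCHar n \<inter> nc_homogeneous j" if c: "c \<in> ?C j" for c j
  proof -
    have "sym_pairing n (Poly_Mapping.lookup (v c)) l u = 0" if l: "l \<noteq> []" "set l \<subseteq> {1..n}" for l u
    proof (cases "set u \<subseteq> {1..n} \<and> length l + length u = j")
      case True
      show ?thesis
      proof (rule vanish[OF _ l])
        fix w assume w: "w \<in> words n (length l + length u)" "min_part n w \<noteq> []"
        then have "w \<noteq> c" using c parts_C by auto
        then show "word_pairing n (Poly_Mapping.lookup (v c)) w = 0"
          using v_dual[OF C_words[OF c], of w] w True by auto
      qed (use True in simp)
    next
      case False
      then have "map \<tau> l @ u \<notin> words n (length c)" for \<tau>
        using c by (auto simp: words_def)
      then show ?thesis by (simp add: sym_pairing_def v_lookup)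
    qed
    then show ?thesis using v_homog[of c] c by (simp add: NCHar_iff)
  qed

  have stable: "permute_vars \<sigma> f \<in> NCHar n \<inter> nc_homogeneous j" if "f \<in> NCHar n \<inter> nc_homogeneous j" for f j
    using that NCHar_permute_vars[OF s] permute_vars_homogeneous by blast

  \<comment> \<open>On a harmonic polynomial only the pairings with empty minimal part survive, so
    the vectors \<open>v c\<close> with \<open>c\<close> reduced form a frame, with n! times the
    coefficient at \<open>c\<close> as coordinate.\<close>
  have tr_NCHar: "nc.trace_on (NCHar n \<inter> nc_homogeneous j) (permute_vars \<sigma>)
      = (\<Sum>c\<in>?C j. of_nat (fact n) * Poly_Mapping.lookup (permute_vars \<sigma> (v c)) c)" for j
  proof (rule nc.trace_on_frame)
    show "nc.subspace (NCHar n \<inter> nc_homogeneous j)"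
      by (rule nc.subspace_inter[OF subspace_NCHar subspace_homogeneous])
    show "f = (\<Sum>c\<in>?C j. nc_scale (of_nat (fact n) * Poly_Mapping.lookup f c) (v c))"
      if f: "f \<in> NCHar n \<inter> nc_homogeneous j" for f
    proof (rule ncpoly_eqI)
      fix u
      have f': "f \<in> NCPoly n \<inter> nc_homogeneous j" using f by (simp add: NCHar_iff)
      show "Poly_Mapping.lookup f u = Poly_Mapping.lookup (\<Sum>c\<in>?C j. nc_scale (of_nat (fact n) * Poly_Mapping.lookup f c) (v c)) u"
      proof (cases "u \<in> words n j")
        case True
        have "Poly_Mapping.lookup f u = (\<Sum>w\<in>words n j. word_pairing n (Poly_Mapping.lookup f) w * Poly_Mapping.lookup (v w) u)"
          by (rule v_expand[OF True])
        also have "\<dots> = (\<Sum>c\<in>?C j. word_pairing n (Poly_Mapping.lookup f) c * Poly_Mapping.lookup (v c) u)"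
        proof (rule sum.mono_neutral_right)
          show "\<forall>w\<in>words n j - ?C j. word_pairing n (Poly_Mapping.lookup f) w * Poly_Mapping.lookup (v w) u = 0"
          proof
            fix w assume w: "w \<in> words n j - ?C j"
            then have "set (min_part n w) \<subseteq> {1..n}"
              using decomposition(1)[of w n] min_words_subset parts_words[of w j] by blast
            then show "word_pairing n (Poly_Mapping.lookup f) w * Poly_Mapping.lookup (v w) u = 0"
              using f not_C[of w j] w by (simp add: NCHar_iff)
          qed
        qed (use C_words in auto)
        also have "\<dots> = (\<Sum>c\<in>?C j. of_nat (fact n) * Poly_Mapping.lookup f c * Poly_Mapping.lookup (v c) u)"
          using pair_C by (intro sum.cong refl) simp
        finally show ?thesis by (simp add: lookup_sum)
      next
        case False
        then have "Poly_Mapping.lookup f u = 0"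
          using f' unfolding NCPoly_homogeneous_iff by (auto simp: in_keys_iff)
        moreover have "Poly_Mapping.lookup (v c) u = 0" if "c \<in> ?C j" for c
          using that False by (simp add: v_lookup)
        ultimately show ?thesis by (simp add: lookup_sum)
      qed
    qed
    show "v c \<in> NCHar n \<inter> nc_homogeneous j" if "c \<in> ?C j" for c
      by (rule v_NCHar[OF that])
    show "permute_vars \<sigma> f \<in> NCHar n \<inter> nc_homogeneous j" if "f \<in> NCHar n \<inter> nc_homogeneous j" for f
      by (rule stable[OF that])
  qed (use finC in \<open>simp_all add: lookup_add algebra_simps nc_linear_permute_vars\<close>)

  have frame: "nc.trace_on (NCPoly n \<inter> nc_homogeneous k) (permute_vars \<sigma>)
      = (\<Sum>w\<in>words n k. word_pairing n (Poly_Mapping.lookup (permute_vars \<sigma> (v w))) w)"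
  proof (rule nc.trace_on_frame)
    show "nc.subspace (NCPoly n \<inter> nc_homogeneous k)"
      by (rule nc.subspace_inter[OF subspace_NCPoly subspace_homogeneous])
    show "v w \<in> NCPoly n \<inter> nc_homogeneous k" if "w \<in> words n k" for w
      using v_homog[of w] that by (simp add: words_def)
    show "f = (\<Sum>w\<in>words n k. nc_scale (word_pairing n (Poly_Mapping.lookup f) w) (v w))"
      if f: "f \<in> NCPoly n \<inter> nc_homogeneous k" for f
    proof (rule ncpoly_eqI)
      fix u
      show "Poly_Mapping.lookup f u = Poly_Mapping.lookup (\<Sum>w\<in>words n k. nc_scale (word_pairing n (Poly_Mapping.lookup f) w) (v w)) u"
      proof (cases "u \<in> words n k")
        case True
        show ?thesis using v_expand[OF True, of "Poly_Mapping.lookup f"] by (simp add: lookup_sum)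
      next
        case False
        then have "Poly_Mapping.lookup f u = 0"
          using f unfolding NCPoly_homogeneous_iff by (auto simp: in_keys_iff)
        moreover have "Poly_Mapping.lookup (v w) u = 0" if "w \<in> words n k" for w
          using that False by (auto simp: v_lookup words_def)
        ultimately show ?thesis by (simp add: lookup_sum)
      qed
    qed
    show "permute_vars \<sigma> f \<in> NCPoly n \<inter> nc_homogeneous k" if "f \<in> NCPoly n \<inter> nc_homogeneous k" for f
      using that permute_vars_homogeneous permute_vars_NCPoly[OF s] by blast
  qed (simp_all add: sym_pairing_def lookup_add sum.distrib sum_distrib_left nc_linear_permute_vars)

  \<comment> \<open>Contraction with the symmetrisation of \<open>l\<close> sends the dual vector of
    \<open>l @ c\<close> to n! times that of \<open>c\<close>: for a word \<open>w\<close> other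
    than \<open>c\<close>, uniqueness of the factorisation keeps all products that arise away from
    \<open>l @ c\<close>.\<close>
  have strip: "sym_pairing n (Poly_Mapping.lookup (v (l @ c))) l u = of_nat (fact n) * Poly_Mapping.lookup (v c) u"
    if l: "l \<in> min_words n" and c: "c \<in> reduced_words n" and u: "u \<in> words n (length c)" for l c u
  proof -
    let ?h = "Poly_Mapping.lookup (v (l @ c))"
    have lc: "l @ c \<in> words n (length l + length c)"
      using min_words_subset[OF l] reduced_words_subset[OF c] by (simp add: words_def)
    have "word_pairing n (sym_pairing n ?h l) w = (if w = c then of_nat (fact n) else 0)" if w: "w \<in> words n (length c)" for w
    proof -
      note d = decomposition[OF parts_words[OF w]]
      have len: "length (min_part n w) + length (reduced_part n w) = length c"
        using arg_cong[OF d(3), of length] w by (simp add: words_def)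
      have "word_pairing n (sym_pairing n ?h l) w = (\<Sum>\<tau>\<in>?G. sym_pairing n ?h (l @ map \<tau> (min_part n w)) (reduced_part n w))"
        using sum_sym_pairing[of n ?h l "min_part n w" "reduced_part n w"]
        by (simp add: sym_pairing_def[of n "sym_pairing n ?h l"])
      also have "\<dots> = (\<Sum>\<tau>\<in>?G. if w = c then 1 else 0)"
      proof (intro sum.cong refl)
        fix \<tau> assume t: "\<tau> \<in> ?G"
        show "sym_pairing n ?h (l @ map \<tau> (min_part n w)) (reduced_part n w) = (if w = c then 1 else 0)"
        proof (cases "w = c")
          case True
          then have "sym_pairing n ?h (l @ map \<tau> (min_part n w)) (reduced_part n w) = word_pairing n ?h (l @ c)"
            using parts_C[OF c] parts_append[OF l c] by simp
          then show ?thesis using v_dual[OF lc lc] True by simp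
        next
          case False
          have "set (l @ map \<tau> (min_part n w)) \<subseteq> {1..n}"
            using min_words_subset[OF l] set_map_permutes[of \<tau> "{1..n}", OF _ min_words_subset[OF d(1)]] t by simp
          from sym_pairing_eq_word_pairing[OF this d(2), of ?h]
          obtain l' where l': "l' \<in> min_words n" "length l' = length (l @ map \<tau> (min_part n w))"
            "sym_pairing n ?h (l @ map \<tau> (min_part n w)) (reduced_part n w) = word_pairing n ?h (l' @ reduced_part n w)" .
          have "l' @ reduced_part n w \<in> words n (length l + length c)"
            using l' len min_words_subset[OF l'(1)] reduced_words_subset[OF d(2)] by (simp add: words_def)
          moreover have "l @ c \<noteq> l' @ reduced_part n w"
          proof
            assume "l @ c = l' @ reduced_part n w"
            then have "l = l'" "c = reduced_part n w"
              using decomposition_unique[OF _ l l'(1) c d(2)] by auto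
            then have "min_part n w = []" using l'(2) by simp
            then show False using d(3) \<open>c = reduced_part n w\<close> False by (metis append_Nil)
          qed
          ultimately show ?thesis unfolding l'(3) using v_dual[OF lc] False by simp
        qed
      qed
      finally show ?thesis by (simp add: cardG[unfolded One_nat_def])
    qed
    then have "sym_pairing n ?h l u = (\<Sum>w\<in>words n (length c). (if w = c then of_nat (fact n) else 0) * Poly_Mapping.lookup (v w) u)"
      using v_expand[OF u, of "sym_pairing n ?h l"] by simp
    also have "\<dots> = (\<Sum>w\<in>words n (length c). if w = c then of_nat (fact n) * Poly_Mapping.lookup (v w) u else 0)"
      by (intro sum.cong refl) simp
    also have "\<dots> = of_nat (fact n) * Poly_Mapping.lookup (v c) u"
      using C_words[of c "length c"] c by simp
    finally show ?thesis .
  qed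

  \<comment> \<open>Invariance of the left factor moves \<sigma> onto \<open>c\<close>; contraction
    then removes \<open>l\<close>.\<close>
  have diag: "word_pairing n (Poly_Mapping.lookup (permute_vars \<sigma> (v (l @ c)))) (l @ c)
      = of_nat (fact n) * Poly_Mapping.lookup (permute_vars \<sigma> (v c)) c"
    if l: "l \<in> min_words n" and c: "c \<in> reduced_words n" for l c
  proof -
    let ?u = "map (inv \<sigma>) c"
    have u: "?u \<in> words n (length c)"
      using set_map_permutes[OF permutes_inv[OF s] reduced_words_subset[OF c]] by (simp add: words_def)
    have "word_pairing n (Poly_Mapping.lookup (permute_vars \<sigma> (v (l @ c)))) (l @ c)
        = sym_pairing n (Poly_Mapping.lookup (permute_vars \<sigma> (v (l @ c)))) l (map \<sigma> ?u)"
      by (simp only: parts_append[OF l c] map_map_inv[OF s])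
    also have "\<dots> = of_nat (fact n) * Poly_Mapping.lookup (v c) ?u"
      by (simp only: sym_pairing_permute_vars[OF s] strip[OF l c u])
    also have "Poly_Mapping.lookup (v c) ?u = Poly_Mapping.lookup (permute_vars \<sigma> (v c)) c"
      using lookup_permute_vars[OF s, of "v c" ?u] by (simp only: map_map_inv[OF s])
    finally show ?thesis .
  qed

  let ?t = "\<lambda>c. of_nat (fact n) * Poly_Mapping.lookup (permute_vars \<sigma> (v c)) c"
  have "words n k = (\<lambda>(l, c). l @ c) ` (\<Union>j\<in>{0..k}. ?L j \<times> ?C (k - j))"
  proof (intro equalityI subsetI)
    fix w assume w: "w \<in> words n k"
    note d = decomposition[OF parts_words[OF w]]
    have len: "length (min_part n w) + length (reduced_part n w) = k"
      using arg_cong[OF d(3), of length] w by (simp add: words_def)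
    have "(min_part n w, reduced_part n w) \<in> (\<Union>j\<in>{0..k}. ?L j \<times> ?C (k - j))"
      using d len by auto
    then show "w \<in> (\<lambda>(l, c). l @ c) ` (\<Union>j\<in>{0..k}. ?L j \<times> ?C (k - j))"
      by (rule rev_image_eqI) (simp only: case_prod_conv d(3)[symmetric])
  next
    fix w assume "w \<in> (\<lambda>(l, c). l @ c) ` (\<Union>j\<in>{0..k}. ?L j \<times> ?C (k - j))"
    then obtain j l c where "j \<le> k" "l \<in> ?L j" "c \<in> ?C (k - j)" "w = l @ c" by auto
    then show "w \<in> words n k" using words_append[OF L_words[of l j] C_words[of c "k - j"]] by simp
  qed
  note W = this
  have inj: "inj_on (\<lambda>(l, c). l @ c) (\<Union>j\<in>{0..k}. ?L j \<times> ?C (k - j))"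
  proof (rule inj_onI, clarify)
    fix l c l' c' j j'
    assume "l @ c = l' @ c'" "l \<in> min_words n" "l' \<in> min_words n" "c \<in> reduced_words n" "c' \<in> reduced_words n"
    then show "l = l' \<and> c = c'" by (rule decomposition_unique)
  qed
  have "of_nat (num_fix {1..n} \<sigma> ^ k) = (\<Sum>w\<in>words n k. word_pairing n (Poly_Mapping.lookup (permute_vars \<sigma> (v w))) w)"
    using frame trace_NCPoly[OF s, of k] by metis
  also have "\<dots> = (\<Sum>(l, c)\<in>(\<Union>j\<in>{0..k}. ?L j \<times> ?C (k - j)). word_pairing n (Poly_Mapping.lookup (permute_vars \<sigma> (v (l @ c)))) (l @ c))"
    unfolding W sum.reindex[OF inj] by (simp only: o_def case_prod_unfold)
  also have "\<dots> = (\<Sum>(l, c)\<in>(\<Union>j\<in>{0..k}. ?L j \<times> ?C (k - j)). ?t c)"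
    using diag by (intro sum.cong refl) auto
  also have "\<dots> = (\<Sum>j=0..k. \<Sum>(l, c)\<in>?L j \<times> ?C (k - j). ?t c)"
    using finL finC by (intro sum.UNION_disjoint) auto
  also have "\<dots> = (\<Sum>j=0..k. of_nat (card (?L j)) * nc.trace_on (NCHar n \<inter> nc_homogeneous (k - j)) (permute_vars \<sigma>))"
    by (simp add: tr_NCHar sum.cartesian_product[symmetric])
  finally show ?thesis .
qed

text \<open>The average of 1/(1 - f q) over all \<sigma> counts orbits of words, and for
  \<open>d \<le> n\<close> the average number of ordered \<open>d\<close>-tuples of distinct fixed
  points is 1.\<close>

lemma min_words_series: "Abs_fps (\<lambda>k. of_nat (card {l \<in> min_words n. length l = k}))
    = (\<Sum>d=0..n. fps_X ^ d / qbrace d)"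
proof -
  let ?G = "{\<sigma>. \<sigma> permutes {1..n}}"
  let ?H = "Abs_fps (\<lambda>k. of_nat (card {l \<in> min_words n. length l = k})) :: rat fps"
  have count: "(\<Sum>\<sigma>\<in>?G. of_nat (ffact (num_fix {1..n} \<sigma>) d)) = (of_nat (fact n) :: rat fps)" if "d \<le> n" for d
    using sum_ffact_cycle_weight[where w = "\<lambda>_. 1 :: rat fps" and h = "\<lambda>_. 1" and S = "{1..n}" and d = d] that
    by (simp add: cycle_weight_def card_permutations)
  have "of_nat (fact n) * ?H = (\<Sum>\<sigma>\<in>?G. inverse (1 - of_nat (num_fix {1..n} \<sigma>) * fps_X))"
  proof (rule fps_ext)
    fix k
    have "fps_nth (of_nat (fact n) * ?H) k = of_nat (card {l \<in> min_words n. length l = k} * fact n)"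
      by (simp add: fps_of_nat[symmetric] del: of_nat_fact)
    then show "fps_nth (of_nat (fact n) * ?H) k
        = fps_nth (\<Sum>\<sigma>\<in>?G. inverse (1 - of_nat (num_fix {1..n} \<sigma>) * fps_X)) k"
      unfolding card_min_words by (simp add: fps_sum_nth inverse_one_minus_nth)
  qed
  also have "\<dots> = (\<Sum>\<sigma>\<in>?G. \<Sum>d=0..n. of_nat (ffact (num_fix {1..n} \<sigma>) d) * (fps_X ^ d / qbrace d))"
  proof (intro sum.cong refl inverse_one_minus_eq_sum_qbrace)
    fix \<sigma> :: "nat \<Rightarrow> nat"
    have "num_fix {1..n} \<sigma> \<le> card {1..n}" unfolding num_fix_def by (rule card_mono) auto
    then show "num_fix {1..n} \<sigma> \<le> n" by simp
  qed
  also have "\<dots> = of_nat (fact n) * (\<Sum>d=0..n. fps_X ^ d / qbrace d)"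
    using count by (subst sum.swap) (simp add: sum_distrib_right[symmetric] sum_distrib_left)
  finally have eq: "of_nat (fact n) * ?H = of_nat (fact n) * (\<Sum>d=0..n. fps_X ^ d / qbrace d)" .
  have "(of_nat (fact n) :: rat fps) \<noteq> 0" by (simp only: of_nat_eq_0_iff fact_nonzero) simp
  then show ?thesis using eq by (simp only: mult_cancel_left) simp
qed

lemma trace_NCHar:
  assumes s: "\<sigma> permutes {1..n}"
  shows "nc.trace_on (NCHar n \<inter> nc_homogeneous k) (permute_vars \<sigma>)
    = fps_nth (inverse (\<Sum>d=0..n. fps_X ^ d / qbrace d) * inverse (1 - of_nat (num_fix {1..n} \<sigma>) * fps_X)) k"
proof -
  define H :: "rat fps" where "H = Abs_fps (\<lambda>k. of_nat (card {l \<in> min_words n. length l = k}))"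
  define T where "T = Abs_fps (\<lambda>k. nc.trace_on (NCHar n \<inter> nc_homogeneous k) (permute_vars \<sigma>))"
  have "inverse (1 - of_nat (num_fix {1..n} \<sigma>) * fps_X) = H * T"
  proof (rule fps_ext)
    fix k
    show "fps_nth (inverse (1 - of_nat (num_fix {1..n} \<sigma>) * fps_X)) k = fps_nth (H * T) k"
      unfolding inverse_one_minus_nth trace_NCHar_convolution[OF s] fps_mult_nth by (simp add: H_def T_def)
  qed
  moreover have "{l \<in> min_words n. length l = 0} = {[]}" by auto
  then have "inverse H * H = 1"
    by (intro inverse_mult_eq_1) (simp add: H_def)
  ultimately have "T = inverse H * inverse (1 - of_nat (num_fix {1..n} \<sigma>) * fps_X)"
    by (simp add: mult.assoc[symmetric])
  then show ?thesis
    unfolding H_def min_words_series by (simp add: T_def fps_eq_iff)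
qed

section \<open>Hausdorff derivatives\<close>

definition left_mult :: "nat \<Rightarrow> ncpoly \<Rightarrow> ncpoly"
  where "left_mult i = lin_ext (\<lambda>w. word (i # w))"

lemma left_mult_word [simp]: "left_mult i (word w) = word (i # w)"
  by (simp add: left_mult_def)

lemma nc_linear_left_mult: "nc_linear (left_mult i)"
  unfolding left_mult_def by (rule nc_linear_lin_ext)

lemma nc_linear_hausdorff: "nc_linear (hausdorff_deriv x)"
  unfolding hausdorff_deriv_def by (rule nc_linear_lin_ext)

lemma hausdorff_Nil [simp]: "hausdorff_deriv x (word []) = 0"
  by (simp add: hausdorff_deriv_def)

text \<open>Leibniz rule: the deleted letter is the first one or lies in \<open>w\<close>.\<close>

lemma hausdorff_Cons:
  "hausdorff_deriv j (word (i # w)) = (if i = j then word w else 0) + left_mult i (hausdorff_deriv j (word w))"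
proof -
  let ?S = "{k. k < length w \<and> w ! k = j}"
  have "{k. k < length (i # w) \<and> (i # w) ! k = j} = (if i = j then {0} else {}) \<union> Suc ` ?S"
  proof (rule set_eqI)
    fix k
    show "k \<in> {k. k < length (i # w) \<and> (i # w) ! k = j} \<longleftrightarrow> k \<in> (if i = j then {0} else {}) \<union> Suc ` ?S"
      by (cases k) auto
  qed
  moreover have "(\<Sum>k\<in>(if i = j then {0} else {}) \<union> Suc ` ?S. word (take k (i # w) @ drop (Suc k) (i # w)))
      = (if i = j then word w else 0) + (\<Sum>k\<in>?S. word (i # take k w @ drop (Suc k) w))"
    by (subst sum.union_disjoint) (auto simp: sum.reindex)
  ultimately show ?thesis
    by (simp add: hausdorff_deriv_def module_hom.sum[OF nc_linear_left_mult])
qed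

text \<open>The Weyl relation: derivatives and left multiplications have the same commutators as in
  a polynomial ring.\<close>

lemma hausdorff_left_mult:
  "hausdorff_deriv j (left_mult i f) = (if i = j then f else 0) + left_mult i (hausdorff_deriv j f)"
proof (rule nc_linear_eqI[of "\<lambda>f. hausdorff_deriv j (left_mult i f)"])
  show "nc_linear (\<lambda>f. hausdorff_deriv j (left_mult i f))"
    by (rule nc_linear_comp[OF nc_linear_hausdorff nc_linear_left_mult])
  show "nc_linear (\<lambda>f. (if i = j then f else 0) + left_mult i (hausdorff_deriv j f))"
  proof (rule nc_linear_add[OF _ nc_linear_comp[OF nc_linear_left_mult nc_linear_hausdorff]])
    show "nc_linear (\<lambda>f. if i = j then f else 0)"
      using nc_linear_id nc_linear_zero by (cases "i = j") simp_all
  qed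
qed (simp add: hausdorff_Cons)

lemma hausdorff_commute: "hausdorff_deriv x (hausdorff_deriv y f) = hausdorff_deriv y (hausdorff_deriv x f)"
proof (rule nc_linear_eqI[of "\<lambda>f. hausdorff_deriv x (hausdorff_deriv y f)"])
  fix w
  show "hausdorff_deriv x (hausdorff_deriv y (word w)) = hausdorff_deriv y (hausdorff_deriv x (word w))"
  proof (induction w)
    case Nil
    then show ?case by (simp add: module_hom.zero[OF nc_linear_hausdorff])
  next
    case (Cons i w)
    then show ?case
      by (simp add: hausdorff_Cons module_hom.add[OF nc_linear_hausdorff] hausdorff_left_mult
          module_hom.zero[OF nc_linear_hausdorff])
  qed
qed (rule nc_linear_comp[OF nc_linear_hausdorff nc_linear_hausdorff])+

lemma permute_vars_left_mult: "permute_vars \<sigma> (left_mult i f) = left_mult (\<sigma> i) (permute_vars \<sigma> f)"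
  by (rule nc_linear_eqI[of "\<lambda>f. permute_vars \<sigma> (left_mult i f)"])
    (simp_all add: nc_linear_comp[OF nc_linear_permute_vars nc_linear_left_mult] nc_linear_comp[OF nc_linear_left_mult nc_linear_permute_vars])

lemma permute_vars_hausdorff:
  assumes "inj \<sigma>"
  shows "permute_vars \<sigma> (hausdorff_deriv x f) = hausdorff_deriv (\<sigma> x) (permute_vars \<sigma> f)"
proof (rule nc_linear_eqI[of "\<lambda>f. permute_vars \<sigma> (hausdorff_deriv x f)"])
  fix w
  show "permute_vars \<sigma> (hausdorff_deriv x (word w)) = hausdorff_deriv (\<sigma> x) (permute_vars \<sigma> (word w))"
  proof (induction w)
    case Nil
    then show ?case by (simp add: module_hom.zero[OF nc_linear_permute_vars])
  next
    case (Cons i w)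
    then show ?case using inj_eq[OF assms]
      by (simp add: hausdorff_Cons module_hom.add[OF nc_linear_permute_vars] permute_vars_left_mult
          module_hom.zero[OF nc_linear_permute_vars])
  qed
qed (rule nc_linear_comp[OF nc_linear_permute_vars nc_linear_hausdorff] nc_linear_comp[OF nc_linear_hausdorff nc_linear_permute_vars])+

lemma hausdorff_in_subspace:
  assumes "nc.subspace V" "\<And>w i. w \<in> Poly_Mapping.keys f \<Longrightarrow> i < length w \<Longrightarrow> word (take i w @ drop (Suc i) w) \<in> V"
  shows "hausdorff_deriv x f \<in> V"
  unfolding hausdorff_deriv_def using assms by (intro lin_ext_in_subspace nc.subspace_sum) auto

lemma hausdorff_NCPoly: "f \<in> NCPoly n \<Longrightarrow> hausdorff_deriv x f \<in> NCPoly n"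
proof (rule hausdorff_in_subspace[OF subspace_NCPoly], rule word_in_NCPoly)
  fix w i assume "f \<in> NCPoly n" "w \<in> Poly_Mapping.keys f"
  then have "set w \<subseteq> {1..n}" by (simp add: NCPoly_def)
  then show "set (take i w @ drop (Suc i) w) \<subseteq> {1..n}"
    using set_take_subset[of i w] set_drop_subset[of "Suc i" w] by auto
qed

text \<open>The truncated degree for \<open>k = 0\<close> is harmless, as the derivative is then
  zero.\<close>

lemma hausdorff_homogeneous:
  assumes f: "f \<in> nc_homogeneous k"
  shows "hausdorff_deriv x f \<in> nc_homogeneous (k - 1)"
proof (rule hausdorff_in_subspace[OF subspace_homogeneous])
  fix w i assume a: "w \<in> Poly_Mapping.keys f" "i < length w"
  then have "length (take i w @ drop (Suc i) w) = k - 1"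
    using f by (auto simp: nc_homogeneous_def)
  then show "word (take i w @ drop (Suc i) w) \<in> nc_homogeneous (k - 1)"
    using word_homogeneous by metis
qed

lemma hausdorff_homogeneous_0:
  assumes "f \<in> nc_homogeneous 0"
  shows "hausdorff_deriv x f = 0"
  unfolding hausdorff_deriv_def lin_ext_def
  using assms by (intro sum.neutral) (auto simp: nc_homogeneous_def)

lemma left_mult_homogeneous: "f \<in> nc_homogeneous k \<Longrightarrow> left_mult i f \<in> nc_homogeneous (Suc k)"
  unfolding left_mult_def by (intro lin_ext_in_subspace subspace_homogeneous) (auto simp: nc_homogeneous_def)

lemma left_mult_NCPoly: "i \<in> {1..n} \<Longrightarrow> f \<in> NCPoly n \<Longrightarrow> left_mult i f \<in> NCPoly n"
  unfolding left_mult_def by (intro lin_ext_in_subspace subspace_NCPoly word_in_NCPoly) (auto simp: NCPoly_def)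

lemma funpow_left_mult_homogeneous: "f \<in> nc_homogeneous k \<Longrightarrow> (left_mult i ^^ j) f \<in> nc_homogeneous (k + j)"
  by (induction j) (auto simp: left_mult_homogeneous)

lemma funpow_hausdorff_homogeneous: "f \<in> nc_homogeneous k \<Longrightarrow> (hausdorff_deriv x ^^ j) f \<in> nc_homogeneous (k - j)"
proof (induction j)
  case (Suc j)
  then show ?case using hausdorff_homogeneous[of "(hausdorff_deriv x ^^ j) f" "k - j" x] by simp
qed simp

lemma funpow_hausdorff_eq_0:
  assumes "f \<in> nc_homogeneous k" "k < j"
  shows "(hausdorff_deriv x ^^ j) f = 0"
  using assms(2)
proof (induction j)
  case (Suc j)
  show ?case
  proof (cases "k < j")
    case True
    then show ?thesis using Suc.IH by (simp add: module_hom.zero[OF nc_linear_hausdorff])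
  next
    case False
    then have "k - j = 0" using Suc.prems by simp
    then have "(hausdorff_deriv x ^^ j) f \<in> nc_homogeneous 0"
      using funpow_hausdorff_homogeneous[OF assms(1), where x = x and j = j] by simp
    then show ?thesis by (simp add: hausdorff_homogeneous_0)
  qed
qed simp

lemma funpow_hausdorff_NCPoly: "f \<in> NCPoly n \<Longrightarrow> (hausdorff_deriv x ^^ j) f \<in> NCPoly n"
  by (induction j) (auto simp: hausdorff_NCPoly)

lemma funpow_left_mult_NCPoly: "i \<in> {1..n} \<Longrightarrow> f \<in> NCPoly n \<Longrightarrow> (left_mult i ^^ j) f \<in> NCPoly n"
  by (induction j) (simp_all add: left_mult_NCPoly)

lemma funpow_commute_with: "(\<And>f. T (S f) = S (T f)) \<Longrightarrow> T ((S ^^ j) f) = (S ^^ j) (T f)"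
  by (induction j) simp_all

section \<open>Taylor expansion and integration in one variable\<close>

lemma hausdorff_funpow_left_mult:
  "hausdorff_deriv x ((left_mult x ^^ k) f)
    = nc_scale (of_nat k) ((left_mult x ^^ (k - 1)) f) + (left_mult x ^^ k) (hausdorff_deriv x f)"
proof (induction k)
  case (Suc k)
  have "hausdorff_deriv x ((left_mult x ^^ Suc k) f)
      = (left_mult x ^^ k) f + left_mult x (hausdorff_deriv x ((left_mult x ^^ k) f))"
    by (simp add: hausdorff_left_mult)
  also have "\<dots> = (left_mult x ^^ k) f + (nc_scale (of_nat k) (left_mult x ((left_mult x ^^ (k - 1)) f))
      + (left_mult x ^^ Suc k) (hausdorff_deriv x f))"
    unfolding Suc.IH by (simp add: module_hom.add[OF nc_linear_left_mult] module_hom.scale[OF nc_linear_left_mult])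
  also have "nc_scale (of_nat k) (left_mult x ((left_mult x ^^ (k - 1)) f)) = nc_scale (of_nat k) ((left_mult x ^^ k) f)"
    by (cases k) simp_all
  finally show ?case by (simp add: nc.scale_left_distrib algebra_simps)
qed simp

text \<open>The Taylor projection onto the kernel of the derivative \<open>\<partial>\<^sub>x\<close> along left multiplication by \<open>x\<close>,
  truncated so that it is only meant for elements of degree at most \<open>K\<close>.\<close>

definition constant_part :: "nat \<Rightarrow> nat \<Rightarrow> ncpoly \<Rightarrow> ncpoly"
  where "constant_part x K f = (\<Sum>k\<le>K. nc_scale ((-1) ^ k / fact k) ((left_mult x ^^ k) ((hausdorff_deriv x ^^ k) f)))"

lemma nc_linear_constant_part: "nc_linear (constant_part x K)"
  unfolding constant_part_def[abs_def]
  by (intro nc_linear_sum nc_linear_scale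
      nc_linear_comp[OF nc_linear_funpow[OF nc_linear_left_mult] nc_linear_funpow[OF nc_linear_hausdorff]])

text \<open>The Weyl relation makes the sum telescope to its last term, which vanishes once
  \<open>K\<close> reaches the degree of \<open>f\<close>.\<close>

lemma hausdorff_constant_part:
  "hausdorff_deriv x (constant_part x K f)
    = nc_scale ((-1) ^ K / fact K) ((left_mult x ^^ K) ((hausdorff_deriv x ^^ Suc K) f))"
proof (induction K)
  case 0
  then show ?case by (simp add: constant_part_def)
next
  case (Suc K)
  have "constant_part x (Suc K) f = constant_part x K f
      + nc_scale ((-1) ^ Suc K / fact (Suc K)) ((left_mult x ^^ Suc K) ((hausdorff_deriv x ^^ Suc K) f))"
    by (simp add: constant_part_def)
  then have "hausdorff_deriv x (constant_part x (Suc K) f)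
      = nc_scale ((-1) ^ K / fact K) ((left_mult x ^^ K) ((hausdorff_deriv x ^^ Suc K) f))
      + nc_scale ((-1) ^ Suc K / fact (Suc K)) (hausdorff_deriv x ((left_mult x ^^ Suc K) ((hausdorff_deriv x ^^ Suc K) f)))"
    by (simp only: module_hom.add[OF nc_linear_hausdorff] module_hom.scale[OF nc_linear_hausdorff] Suc.IH)
  also have "hausdorff_deriv x ((left_mult x ^^ Suc K) ((hausdorff_deriv x ^^ Suc K) f))
      = nc_scale (of_nat (Suc K)) ((left_mult x ^^ K) ((hausdorff_deriv x ^^ Suc K) f))
        + (left_mult x ^^ Suc K) ((hausdorff_deriv x ^^ Suc (Suc K)) f)"
    by (simp only: hausdorff_funpow_left_mult diff_Suc_1 funpow.simps(2)[of "Suc K" "hausdorff_deriv x"] o_apply)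
  also have "nc_scale ((-1) ^ K / fact K) A + nc_scale ((-1) ^ Suc K / fact (Suc K)) (nc_scale (of_nat (Suc K)) A + B)
      = nc_scale ((-1) ^ Suc K / fact (Suc K)) B" for A B
  proof -
    have "(-1) ^ Suc K / fact (Suc K) * of_nat (Suc K) = - ((-1) ^ K / fact K :: rat)"
      unfolding fact_Suc power_Suc by (simp del: of_nat_Suc)
    then have "nc_scale ((-1) ^ Suc K / fact (Suc K)) (nc_scale (of_nat (Suc K)) A) = - nc_scale ((-1) ^ K / fact K) A"
      by (simp only: nc.scale_scale nc.scale_minus_left)
    then show ?thesis by (simp only: nc.scale_right_distrib) simp
  qed
  finally show ?case .
qed

lemma constant_part_NCPoly: "x \<in> {1..n} \<Longrightarrow> f \<in> NCPoly n \<Longrightarrow> constant_part x K f \<in> NCPoly n"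
  unfolding constant_part_def
  by (intro nc.subspace_sum nc.subspace_scale subspace_NCPoly funpow_left_mult_NCPoly funpow_hausdorff_NCPoly)

lemma constant_part_homogeneous:
  assumes "f \<in> nc_homogeneous k"
  shows "constant_part x K f \<in> nc_homogeneous k"
  unfolding constant_part_def
proof (intro nc.subspace_sum nc.subspace_scale subspace_homogeneous)
  fix j
  show "(left_mult x ^^ j) ((hausdorff_deriv x ^^ j) f) \<in> nc_homogeneous k"
  proof (cases "k < j")
    case True
    then show ?thesis
      using funpow_hausdorff_eq_0[OF assms True] nc.subspace_0[OF subspace_homogeneous]
        module_hom.zero[OF nc_linear_funpow[OF nc_linear_left_mult]] by simp
  next
    case False
    then show ?thesis
      using funpow_left_mult_homogeneous[OF funpow_hausdorff_homogeneous[OF assms, where x = x and j = j], where i = x and j = j]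
      by simp
  qed
qed

lemma constant_part_hausdorff:
  assumes "y \<noteq> x"
  shows "constant_part x K (hausdorff_deriv y f) = hausdorff_deriv y (constant_part x K f)"
proof -
  have "hausdorff_deriv y (left_mult x g) = left_mult x (hausdorff_deriv y g)" for g
    using assms by (simp add: hausdorff_left_mult)
  then show ?thesis
    by (simp add: constant_part_def module_hom.sum[OF nc_linear_hausdorff] module_hom.scale[OF nc_linear_hausdorff]
        funpow_commute_with[of "hausdorff_deriv y"] hausdorff_commute)
qed

text \<open>Uniqueness of the Taylor expansion: by induction on the degree the derivative of
  \<open>f\<close> is zero, and then \<open>f\<close> is its own constant part.\<close>

lemma constant_parts_zero:
  assumes "f \<in> nc_homogeneous k" "k \<le> K" "\<And>j. constant_part x K ((hausdorff_deriv x ^^ j) f) = 0"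
  shows "f = 0"
  using assms
proof (induction k arbitrary: f)
  case 0
  have "(hausdorff_deriv x ^^ j) f = 0" if "j > 0" for j
    using funpow_hausdorff_eq_0[OF 0(1) that] .
  then have "constant_part x K f = (\<Sum>j\<le>K. if j = 0 then f else 0)"
    unfolding constant_part_def
    by (intro sum.cong refl) (auto simp: module_hom.zero[OF nc_linear_funpow[OF nc_linear_left_mult]])
  then show ?case using 0(3)[of 0] by simp
next
  case (Suc k)
  have "hausdorff_deriv x f = 0"
  proof (rule Suc.IH)
    show "hausdorff_deriv x f \<in> nc_homogeneous k" using hausdorff_homogeneous[OF Suc.prems(1)] by simp
    show "constant_part x K ((hausdorff_deriv x ^^ j) (hausdorff_deriv x f)) = 0" for j
      using Suc.prems(3)[of "Suc j"] by (simp add: funpow_swap1)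
  qed (use Suc.prems in simp)
  then have "(hausdorff_deriv x ^^ j) f = 0" if "j > 0" for j
    using that module_hom.zero[OF nc_linear_funpow[OF nc_linear_hausdorff]]
    by (cases j) (simp_all add: funpow_Suc_right del: funpow.simps)
  then have "constant_part x K f = (\<Sum>j\<le>K. if j = 0 then f else 0)"
    unfolding constant_part_def
    by (intro sum.cong refl) (auto simp: module_hom.zero[OF nc_linear_funpow[OF nc_linear_left_mult]])
  then show ?case using Suc.prems(3)[of 0] by simp
qed

text \<open>Integration by parts: if h has derivative x^(a+1) \<partial>f, then (x^(a+1) f -
  h)/(a+1) has derivative x^a f. The exponent \<open>a\<close> serves the induction on the degree;
  surjectivity is the case \<open>a = 0\<close>.\<close>

lemma hausdorff_surjective:
  assumes V: "nc.subspace V" and DV: "\<And>f. f \<in> V \<Longrightarrow> hausdorff_deriv x f \<in> V" and LV: "\<And>f. f \<in> V \<Longrightarrow> left_mult x f \<in> V"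
  shows "f \<in> V \<inter> nc_homogeneous k \<Longrightarrow> \<exists>g\<in>V \<inter> nc_homogeneous (Suc (k + a)). hausdorff_deriv x g = (left_mult x ^^ a) f"
proof (induction k arbitrary: f a)
  case 0
  let ?g = "nc_scale (1 / of_nat (Suc a)) ((left_mult x ^^ Suc a) f)"
  have LaV: "(left_mult x ^^ j) f \<in> V" for j using 0 by (induction j) (auto simp: LV)
  have "hausdorff_deriv x ?g = (left_mult x ^^ a) f"
    using 0 by (simp add: module_hom.scale[OF nc_linear_hausdorff] hausdorff_funpow_left_mult hausdorff_homogeneous_0
        module_hom.zero[OF nc_linear_funpow[OF nc_linear_left_mult]] module_hom.zero[OF nc_linear_left_mult]
        del: funpow.simps of_nat_Suc)
  moreover have "?g \<in> V \<inter> nc_homogeneous (Suc (0 + a))"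
    using LaV[of "Suc a"] funpow_left_mult_homogeneous[where f = f and k = 0 and i = x and j = "Suc a"] 0 V subspace_homogeneous
    by (simp add: nc.subspace_scale del: funpow.simps)
  ultimately show ?case by blast
next
  case (Suc k)
  have LaV: "(left_mult x ^^ j) f \<in> V" for j using Suc.prems by (induction j) (auto simp: LV)
  have "hausdorff_deriv x f \<in> V \<inter> nc_homogeneous k"
    using Suc.prems DV hausdorff_homogeneous[of f "Suc k"] by simp
  from Suc.IH[OF this, of "Suc a"] obtain h where h: "h \<in> V \<inter> nc_homogeneous (Suc (k + Suc a))"
    "hausdorff_deriv x h = (left_mult x ^^ Suc a) (hausdorff_deriv x f)" by blast
  let ?g = "nc_scale (1 / of_nat (Suc a)) ((left_mult x ^^ Suc a) f - h)"
  have "hausdorff_deriv x ?g = (left_mult x ^^ a) f"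
    by (simp add: module_hom.scale[OF nc_linear_hausdorff] module_hom.diff[OF nc_linear_hausdorff]
        hausdorff_funpow_left_mult h(2) del: funpow.simps of_nat_Suc)
  moreover have "?g \<in> V \<inter> nc_homogeneous (Suc (Suc k + a))"
    using LaV[of "Suc a"] funpow_left_mult_homogeneous[where f = f and k = "Suc k" and i = x and j = "Suc a"] Suc.prems h(1) V subspace_homogeneous
    by (simp add: nc.subspace_scale nc.subspace_diff del: funpow.simps)
  ultimately show ?case by blast
qed

text \<open>\<open>complete_op m i\<close> is \<open>h\<^sub>i(\<partial>\<^sub>1, \<dots>, \<partial>\<^sub>m)\<close>.\<close>

fun complete_op :: "nat \<Rightarrow> nat \<Rightarrow> ncpoly \<Rightarrow> ncpoly" where
  "complete_op m 0 f = f"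
| "complete_op 0 (Suc i) f = 0"
| "complete_op (Suc m) (Suc i) f = complete_op m (Suc i) f + hausdorff_deriv (Suc m) (complete_op (Suc m) i f)"

lemma nc_linear_complete_op: "nc_linear (complete_op m i)"
proof (induction m arbitrary: i)
  case 0
  have "complete_op 0 i = (if i = 0 then (\<lambda>f. f) else (\<lambda>f. 0))"
    by (cases i) (simp_all add: fun_eq_iff)
  then show ?case using nc_linear_id nc_linear_zero by simp
next
  case (Suc m)
  note m_IH = this
  show ?case
  proof (induction i)
    case 0
    have "complete_op (Suc m) 0 = (\<lambda>f. f)" by (simp add: fun_eq_iff)
    then show ?case by (simp only: nc_linear_id)
  next
    case (Suc i)
    have "complete_op (Suc m) (Suc i) = (\<lambda>f. complete_op m (Suc i) f + hausdorff_deriv (Suc m) (complete_op (Suc m) i f))"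
      by (simp add: fun_eq_iff)
    then show ?case
      using nc_linear_add[OF m_IH[of "Suc i"] nc_linear_comp[OF nc_linear_hausdorff Suc]] by (simp only:)
  qed
qed

lemma complete_op_commute:
  assumes "nc_linear T" "\<And>x f. x \<in> {1..m} \<Longrightarrow> T (hausdorff_deriv x f) = hausdorff_deriv x (T f)"
  shows "T (complete_op m i f) = complete_op m i (T f)"
  using assms(2)
  by (induction m i f rule: complete_op.induct)
    (simp_all add: module_hom.zero[OF assms(1)] module_hom.add[OF assms(1)])

lemma complete_op_expand:
  "complete_op (Suc m) i f = (\<Sum>j\<le>i. (hausdorff_deriv (Suc m) ^^ j) (complete_op m (i - j) f))"
proof (induction i)
  case (Suc i)
  have "complete_op (Suc m) (Suc i) f
      = complete_op m (Suc i) f + (\<Sum>j\<le>i. (hausdorff_deriv (Suc m) ^^ Suc j) (complete_op m (i - j) f))"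
    using Suc.IH by (simp add: module_hom.sum[OF nc_linear_hausdorff])
  also have "\<dots> = (\<Sum>j\<le>Suc i. (hausdorff_deriv (Suc m) ^^ j) (complete_op m (Suc i - j) f))"
    by (simp only: sum.atMost_Suc_shift funpow_0 diff_zero diff_Suc_Suc)
  finally show ?case .
qed simp

definition power_op :: "nat \<Rightarrow> nat \<Rightarrow> ncpoly \<Rightarrow> ncpoly"
  where "power_op m i f = (\<Sum>x\<in>{1..m}. (hausdorff_deriv x ^^ i) f)"

lemma nc_linear_power_op: "nc_linear (power_op m i)"
  unfolding power_op_def[abs_def] by (intro nc_linear_sum nc_linear_funpow nc_linear_hausdorff)

lemma power_op_Suc: "power_op (Suc m) i f = power_op m i f + (hausdorff_deriv (Suc m) ^^ i) f"
  by (simp add: power_op_def)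

lemma power_op_commute:
  assumes "nc_linear T" "\<And>x f. x \<in> {1..m} \<Longrightarrow> T (hausdorff_deriv x f) = hausdorff_deriv x (T f)"
  shows "T (power_op m i f) = power_op m i (T f)"
  unfolding power_op_def module_hom.sum[OF assms(1)]
  by (intro sum.cong refl funpow_commute_with[where T = T] assms(2))

lemma power_op_hausdorff: "power_op m i (hausdorff_deriv x f) = hausdorff_deriv x (power_op m i f)"
  by (rule power_op_commute[OF nc_linear_hausdorff hausdorff_commute, symmetric])

text \<open>The commuting derivatives behave like variables. The outer induction is on their number,
  the inner one on \<open>k\<close>, both driven by the recursion of
  \<open>complete_op\<close>.\<close>

lemma newton_identity:
  "nc_scale (of_nat k) (complete_op m k f) = (\<Sum>i=1..k. power_op m i (complete_op m (k - i) f))"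
proof (induction m arbitrary: k)
  case 0
  then show ?case by (cases k) (simp_all add: power_op_def)
next
  case (Suc m)
  note m_IH = this
  let ?D = "hausdorff_deriv (Suc m)"
  let ?h = "\<lambda>m k. complete_op m k f"
  show ?case
  proof (induction k)
    case (Suc k)
    have rec: "?h (Suc m) (Suc k - i) = ?h m (Suc k - i) + (if i \<le> k then ?D (?h (Suc m) (k - i)) else 0)"
      if "i \<le> Suc k" for i
      using that by (cases "i \<le> k") (simp_all add: Suc_diff_le not_le le_Suc_eq)
    have "(\<Sum>i=1..Suc k. power_op (Suc m) i (?h (Suc m) (Suc k - i)))
        = (\<Sum>i=1..Suc k. power_op (Suc m) i (?h m (Suc k - i)))
        + (\<Sum>i=1..Suc k. if i \<le> k then ?D (power_op (Suc m) i (?h (Suc m) (k - i))) else 0)"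
      unfolding sum.distrib[symmetric]
      by (intro sum.cong refl) (simp add: rec module_hom.add[OF nc_linear_power_op] power_op_hausdorff
          module_hom.zero[OF nc_linear_power_op])
    also have "(\<Sum>i=1..Suc k. if i \<le> k then ?D (power_op (Suc m) i (?h (Suc m) (k - i))) else 0)
        = ?D (\<Sum>i=1..k. power_op (Suc m) i (?h (Suc m) (k - i)))"
      by (simp add: module_hom.sum[OF nc_linear_hausdorff])
    also have "\<dots> = nc_scale (of_nat k) (?D (?h (Suc m) k))"
      by (simp only: Suc.IH[symmetric] module_hom.scale[OF nc_linear_hausdorff])
    also have "(\<Sum>i=1..Suc k. power_op (Suc m) i (?h m (Suc k - i)))
        = nc_scale (of_nat (Suc k)) (?h m (Suc k)) + (\<Sum>i=1..Suc k. (?D ^^ i) (?h m (Suc k - i)))"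
      by (simp only: power_op_Suc sum.distrib m_IH)
    \<comment> \<open>In \<open>complete_op_expand\<close> the term with exponent 0 is the
      polynomial in \<open>m\<close> variables, so the recursion identifies the other terms with its
      last summand.\<close>
    also have "(\<Sum>i=1..Suc k. (?D ^^ i) (?h m (Suc k - i))) = ?D (?h (Suc m) k)"
    proof -
      have "?h (Suc m) (Suc k) = ?h m (Suc k) + (\<Sum>i=1..Suc k. (?D ^^ i) (?h m (Suc k - i)))"
        unfolding complete_op_expand atMost_atLeast0 by (subst sum.atLeast_Suc_atMost) simp_all
      then show ?thesis by simp
    qed
    finally show ?case by (simp add: nc.scale_left_distrib nc.scale_right_distrib algebra_simps)
  qed simp
qed

section \<open>The trace on Hausdorff harmonics\<close>

text \<open>Dimension as the trace of the identity, so that one exact sequence lemma yields both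
  dimensions and traces.\<close>

abbreviation nc_dim :: "ncpoly set \<Rightarrow> rat"
  where "nc_dim V \<equiv> nc.trace_on V (\<lambda>f. f)"

lemma trace_on_zero: "nc_linear T \<Longrightarrow> nc.trace_on {0} T = 0"
  using nc.trace_on_frame[of "{0}" "{}" "\<lambda>_. 0" "\<lambda>_ _. 0" T] by (simp add: module_hom.zero)

lemma nc_dim_zero: "nc_dim {0} = 0"
  by (rule trace_on_zero[OF nc_linear_id])

lemma graded_exact:
  assumes V: "nc.subspace V" "V \<subseteq> NCPoly n"
    and T: "nc_linear T" "\<And>f. f \<in> V \<Longrightarrow> T f \<in> V" "\<And>f. f \<in> nc_homogeneous k \<Longrightarrow> T f \<in> nc_homogeneous k"
    and \<phi>: "nc_linear \<phi>" "\<And>f. \<phi> (T f) = T (\<phi> f)"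
  shows "nc.trace_on (V \<inter> nc_homogeneous k) T
    = nc.trace_on ({f \<in> V. \<phi> f = 0} \<inter> nc_homogeneous k) T + nc.trace_on (\<phi> ` (V \<inter> nc_homogeneous k)) T"
proof -
  have "{f \<in> V \<inter> nc_homogeneous k. \<phi> f = 0} = {f \<in> V. \<phi> f = 0} \<inter> nc_homogeneous k" by blast
  moreover have "nc.trace_on (V \<inter> nc_homogeneous k) T
      = nc.trace_on {f \<in> V \<inter> nc_homogeneous k. \<phi> f = 0} T + nc.trace_on (\<phi> ` (V \<inter> nc_homogeneous k)) T"
  proof (rule nc.trace_on_exact[OF _ _ _ T(1) \<phi>(1)])
    show "nc.subspace (V \<inter> nc_homogeneous k)"
      by (rule nc.subspace_inter[OF V(1) subspace_homogeneous])
    show "finite (word ` words n k)" by simp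
    show "V \<inter> nc_homogeneous k \<subseteq> nc.span (word ` words n k)"
      using NCPoly_homogeneous_span[of n k] V(2) by blast
  qed (use T \<phi> in auto)
  ultimately show ?thesis by simp
qed

lemma nc_dim_mono:
  assumes "nc.subspace U" "nc.subspace V" "U \<subseteq> V" "V \<subseteq> NCPoly n \<inter> nc_homogeneous k"
  shows "nc_dim U \<le> nc_dim V" "nc_dim U = nc_dim V \<Longrightarrow> U = V"
proof -
  have "V \<subseteq> nc.span (word ` words n k)" using assms(4) NCPoly_homogeneous_span by blast
  from nc.trace_on_id_mono[OF assms(1-3) _ this]
  obtain d where "nc_dim V = nc_dim U + of_nat d" "d = 0 \<longrightarrow> U = V" by auto
  then show "nc_dim U \<le> nc_dim V" "nc_dim U = nc_dim V \<Longrightarrow> U = V" by auto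
qed

section \<open>Dimension series and their coefficientwise comparison\<close>

definition dim_series :: "ncpoly set \<Rightarrow> rat fps"
  where "dim_series V = Abs_fps (\<lambda>k. nc_dim (V \<inter> nc_homogeneous k))"

definition fps_le :: "rat fps \<Rightarrow> rat fps \<Rightarrow> bool"
  where "fps_le f g \<longleftrightarrow> (\<forall>k. fps_nth f k \<le> fps_nth g k)"

lemma fps_le_refl: "fps_le f f"
  by (simp add: fps_le_def)

lemma fps_le_trans: "fps_le f g \<Longrightarrow> fps_le g h \<Longrightarrow> fps_le f h"
  unfolding fps_le_def by (meson order_trans)

lemma fps_le_mult: "fps_le 0 h \<Longrightarrow> fps_le f g \<Longrightarrow> fps_le (h * f) (h * g)"
  unfolding fps_le_def fps_mult_nth by (auto intro!: sum_mono mult_left_mono)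

lemma fps_le_mult_pos: "fps_le 0 f \<Longrightarrow> fps_le 0 g \<Longrightarrow> fps_le 0 (f * g)"
  using fps_le_mult[of f 0 g] by simp

lemma fps_le_prod_pos: "(\<And>x. x \<in> A \<Longrightarrow> fps_le 0 (f x)) \<Longrightarrow> fps_le 0 (prod f A)"
proof (induction A rule: infinite_finite_induct)
  case (insert x A)
  then show ?case by (simp add: fps_le_mult_pos)
qed (simp_all add: fps_le_def)

lemma fps_le_sum_pos: "(\<And>x. x \<in> A \<Longrightarrow> fps_le 0 (f x)) \<Longrightarrow> fps_le 0 (sum f A)"
  unfolding fps_le_def by (simp add: fps_sum_nth sum_nonneg)

lemma fps_le_0_X_power: "fps_le 0 (fps_X ^ j)"
  by (simp add: fps_le_def fps_X_power_nth)

definition geometric :: "nat \<Rightarrow> rat fps"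
  where "geometric r = (\<Sum>j<r. fps_X ^ j)"

lemma geometric_pos: "fps_le 0 (geometric r)"
  unfolding geometric_def by (intro fps_le_sum_pos fps_le_0_X_power)

lemma geometric_mult: "geometric r * (1 - fps_X) = 1 - fps_X ^ r"
  using one_diff_power_eq[of "fps_X :: rat fps" r] by (simp add: geometric_def mult.commute)

lemma geometric_mult_nth: "fps_nth (geometric r * f) k = (\<Sum>j<r. if j \<le> k then fps_nth f (k - j) else 0)"
  by (simp add: geometric_def sum_distrib_right fps_sum_nth fps_X_power_mult_nth not_le) (auto intro!: sum.cong)

text \<open>Each 1/(1 - q^i) is the indicator series of the multiples of \<open>i\<close>.
  Nonnegativity allows inequalities of series to be multiplied by this inverse.\<close>

lemma inverse_qpoch_pos: "fps_le 0 (inverse (qpoch n))"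
proof -
  have nonneg: "fps_le 0 (inverse (1 - fps_X ^ i))" if "i \<ge> 1" for i
  proof -
    let ?g = "Abs_fps (\<lambda>k. if i dvd k then 1 else 0) :: rat fps"
    have "(1 - fps_X ^ i) * ?g = 1"
    proof (rule fps_ext)
      fix k
      have "i dvd k - i \<longleftrightarrow> i dvd k" if "i \<le> k" using that by (simp add: dvd_minus_self)
      moreover have "i dvd k \<longleftrightarrow> k = 0" if "k < i" using that \<open>i \<ge> 1\<close> by (auto dest: dvd_imp_le)
      ultimately show "fps_nth ((1 - fps_X ^ i) * ?g) k = fps_nth 1 k"
        using that by (auto simp: left_diff_distrib fps_X_power_mult_nth not_less)
    qed
    then have "inverse (1 - fps_X ^ i) = ?g" by (metis fps_inverse_unique)
    then show ?thesis by (simp add: fps_le_def)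
  qed
  have "inverse (qpoch n) = (\<Prod>i=1..n. inverse (1 - fps_X ^ i))"
    unfolding qpoch_def by (induction n) (simp_all add: fps_inverse_mult)
  then show ?thesis by (auto intro!: fps_le_prod_pos nonneg)
qed

lemma qpoch_nth_0: "fps_nth (qpoch n) 0 = 1"
  by (induction n) (simp_all add: qpoch_def prod.nat_ivl_Suc')

lemma qpoch_inverse: "qpoch n * inverse (qpoch n) = 1"
  by (rule inverse_mult_cancel_fps) (simp add: qpoch_nth_0)

lemma qpoch_Suc: "qpoch (Suc n) = qpoch n * (1 - fps_X ^ Suc n)"
  by (simp add: qpoch_def prod.nat_ivl_Suc' mult.commute)

section \<open>Upper bound: joint kernels of complete symmetric operators\<close>

definition upper_kernel :: "nat \<Rightarrow> nat \<Rightarrow> ncpoly set"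
  where "upper_kernel n m = {f \<in> NCPoly n. \<forall>x\<in>{m<..n}. hausdorff_deriv x f = 0}"

lemma subspace_common_kernel:
  assumes "nc.subspace V" "\<And>x. x \<in> A \<Longrightarrow> nc_linear (T x)"
  shows "nc.subspace {f \<in> V. \<forall>x\<in>A. T x f = 0}"
  using assms(1) module_hom.add[OF assms(2)] module_hom.scale[OF assms(2)] module_hom.zero[OF assms(2)]
  by (simp add: nc.subspace_def)

lemma subspace_upper_kernel: "nc.subspace (upper_kernel n m)"
  unfolding upper_kernel_def by (intro subspace_common_kernel subspace_NCPoly nc_linear_hausdorff)

lemma upper_kernel_hausdorff: "f \<in> upper_kernel n m \<Longrightarrow> hausdorff_deriv x f \<in> upper_kernel n m"
  by (auto simp: upper_kernel_def hausdorff_NCPoly hausdorff_commute[of _ x] module_hom.zero[OF nc_linear_hausdorff])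

lemma upper_kernel_left_mult:
  "x \<in> {1..n} \<Longrightarrow> x \<le> m \<Longrightarrow> f \<in> upper_kernel n m \<Longrightarrow> left_mult x f \<in> upper_kernel n m"
  by (auto simp: upper_kernel_def left_mult_NCPoly hausdorff_left_mult module_hom.zero[OF nc_linear_left_mult])

text \<open>By \<open>hausdorff_surjective\<close> the derivative in the letter \<open>Suc m\<close>
  maps the larger kernel onto itself, one degree lower; the smaller kernel is what it
  annihilates.\<close>

lemma dim_series_upper_kernel_step:
  assumes "m < n"
  shows "dim_series (upper_kernel n m) = (1 - fps_X) * dim_series (upper_kernel n (Suc m))"
proof (rule fps_ext)
  fix k
  let ?V = "upper_kernel n (Suc m)" and ?D = "hausdorff_deriv (Suc m)"
  have ker: "{f \<in> ?V. ?D f = 0} = upper_kernel n m"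
  proof -
    have "{m<..n} = insert (Suc m) {Suc m<..n}" using assms by auto
    then show ?thesis by (auto simp: upper_kernel_def)
  qed
  have "nc_dim (?V \<inter> nc_homogeneous k)
      = nc_dim (upper_kernel n m \<inter> nc_homogeneous k) + nc_dim (?D ` (?V \<inter> nc_homogeneous k))"
    unfolding ker[symmetric]
    by (rule graded_exact[OF subspace_upper_kernel]) (auto simp: upper_kernel_def nc_linear_id nc_linear_hausdorff)
  moreover have "?D ` (?V \<inter> nc_homogeneous k) = (if k = 0 then {0} else ?V \<inter> nc_homogeneous (k - 1))"
  proof (cases k)
    case 0
    have "0 \<in> ?V \<inter> nc_homogeneous 0"
      by (rule nc.subspace_0[OF nc.subspace_inter[OF subspace_upper_kernel subspace_homogeneous]])
    then show ?thesis using 0 by (auto simp: hausdorff_homogeneous_0 image_iff)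
  next
    case (Suc j)
    have "?D f \<in> ?V \<inter> nc_homogeneous j" if "f \<in> ?V \<inter> nc_homogeneous k" for f
      using that upper_kernel_hausdorff hausdorff_homogeneous[of f k] Suc by simp
    moreover have "f \<in> ?D ` (?V \<inter> nc_homogeneous k)" if "f \<in> ?V \<inter> nc_homogeneous j" for f
      using hausdorff_surjective[OF subspace_upper_kernel upper_kernel_hausdorff upper_kernel_left_mult that, of "Suc m" 0]
        assms Suc by auto
    ultimately show ?thesis using Suc by auto
  qed
  ultimately show "fps_nth (dim_series (upper_kernel n m)) k
    = fps_nth ((1 - fps_X) * dim_series ?V) k"
    by (auto simp: dim_series_def left_diff_distrib nc_dim_zero)
qed

lemma dim_series_upper_kernel:
  "m \<le> n \<Longrightarrow> dim_series (upper_kernel n (n - m)) = (1 - fps_X) ^ m * dim_series (NCPoly n)"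
proof (induction m)
  case 0
  then show ?case by (simp add: upper_kernel_def)
next
  case (Suc m)
  then have "Suc (n - Suc m) = n - m" "n - Suc m < n" by simp_all
  then show ?case using dim_series_upper_kernel_step[of "n - Suc m" n] Suc by (simp add: mult.assoc)
qed

text \<open>Interpolates between \<open>m = 0\<close>, where all derivatives vanish, and
  \<open>m = n\<close>, where all complete symmetric operators of positive degree vanish. For i > n
  - m the polynomial \<open>h_i\<close> in \<open>m\<close> of \<open>n\<close> commuting variables
  lies in the ideal of symmetric polynomials without constant term.\<close>

definition complete_kernel :: "nat \<Rightarrow> nat \<Rightarrow> ncpoly set"
  where "complete_kernel n m = {f \<in> upper_kernel n m. \<forall>i\<in>{n - m<..}. complete_op m i f = 0}"

lemma subspace_complete_kernel: "nc.subspace (complete_kernel n m)"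
  unfolding complete_kernel_def by (intro subspace_common_kernel subspace_upper_kernel nc_linear_complete_op)

lemma complete_op_hausdorff: "complete_op m i (hausdorff_deriv x f) = hausdorff_deriv x (complete_op m i f)"
  by (rule complete_op_commute[OF nc_linear_hausdorff hausdorff_commute, symmetric])

lemma complete_op_funpow_hausdorff:
  "complete_op m i ((hausdorff_deriv x ^^ j) f) = (hausdorff_deriv x ^^ j) (complete_op m i f)"
  by (rule funpow_commute_with) (rule complete_op_hausdorff)

lemma complete_op_constant_part:
  "m < x \<Longrightarrow> complete_op m i (constant_part x K f) = constant_part x K (complete_op m i f)"
  by (rule complete_op_commute[OF nc_linear_constant_part, symmetric]) (auto intro: constant_part_hausdorff)

text \<open>\<open>h_i\<close> in \<open>m\<close> variables is \<open>h_i\<close> minus \<partial>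
  \<open>h_(i-1)\<close> in \<open>Suc m\<close> variables, and for i > n - m both indices exceed n
  - \<open>Suc m\<close>. Taking the constant part adds the equation for the letter
  \<open>Suc m\<close>.\<close>

lemma complete_kernel_step_map:
  assumes "m < n" and f: "f \<in> complete_kernel n (Suc m) \<inter> nc_homogeneous k"
  shows "constant_part (Suc m) k ((hausdorff_deriv (Suc m) ^^ j) f) \<in> complete_kernel n m"
proof -
  let ?D = "hausdorff_deriv (Suc m)"
  let ?g = "constant_part (Suc m) k ((?D ^^ j) f)"
  have f_in: "f \<in> NCPoly n" "\<And>x. x \<in> {Suc m<..n} \<Longrightarrow> hausdorff_deriv x f = 0"
    "\<And>i. n - Suc m < i \<Longrightarrow> complete_op (Suc m) i f = 0" "f \<in> nc_homogeneous k"
    using f by (auto simp: complete_kernel_def upper_kernel_def)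
  have "?g \<in> NCPoly n"
    using assms(1) f_in(1) by (intro constant_part_NCPoly funpow_hausdorff_NCPoly) auto
  moreover have "hausdorff_deriv x ?g = 0" if "x \<in> {m<..n}" for x
  proof (cases "x = Suc m")
    case True
    have "(?D ^^ Suc k) ((?D ^^ j) f) = (?D ^^ (Suc k + j)) f" by (simp only: funpow_add o_apply)
    also have "\<dots> = 0" by (rule funpow_hausdorff_eq_0[OF f_in(4)]) simp
    finally show ?thesis
      using True by (simp only: hausdorff_constant_part) (simp add: module_hom.zero[OF nc_linear_funpow[OF nc_linear_left_mult]] del: funpow.simps)
  next
    case False
    then have "hausdorff_deriv x ?g = constant_part (Suc m) k ((?D ^^ j) (hausdorff_deriv x f))"
      by (simp add: constant_part_hausdorff[symmetric] funpow_commute_with[where T = "hausdorff_deriv x"] hausdorff_commute)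
    then show ?thesis
      using f_in(2)[of x] that False
      by (simp add: module_hom.zero[OF nc_linear_constant_part] module_hom.zero[OF nc_linear_funpow[OF nc_linear_hausdorff]])
  qed
  moreover have "complete_op m i ?g = 0" if "n - m < i" for i
  proof -
    obtain i' where i': "i = Suc i'" using \<open>n - m < i\<close> by (cases i) auto
    have "complete_op m i f = complete_op (Suc m) i f - ?D (complete_op (Suc m) i' f)"
      by (simp add: i')
    also have "\<dots> = 0"
      using f_in(3)[of i] f_in(3)[of i'] that i' assms(1) by (simp add: module_hom.zero[OF nc_linear_hausdorff])
    finally show ?thesis
      by (simp add: complete_op_constant_part complete_op_funpow_hausdorff module_hom.zero[OF nc_linear_constant_part]
          module_hom.zero[OF nc_linear_funpow[OF nc_linear_hausdorff]])
  qed
  ultimately show ?thesis by (auto simp: complete_kernel_def upper_kernel_def)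
qed

text \<open>For \<open>j\<close> at least n - m the equation of degree \<open>j\<close> has leading
  term \<partial>^j and expresses this derivative through lower ones, so vanishing of the first n -
  m constant parts propagates to all.\<close>

lemma complete_kernel_determined:
  assumes "m < n" and f: "f \<in> complete_kernel n (Suc m) \<inter> nc_homogeneous k"
    and zero: "\<And>j. j < n - m \<Longrightarrow> constant_part (Suc m) k ((hausdorff_deriv (Suc m) ^^ j) f) = 0"
  shows "f = 0"
proof (rule constant_parts_zero)
  let ?D = "hausdorff_deriv (Suc m)"
  show "f \<in> nc_homogeneous k" using f by simp
  show "constant_part (Suc m) k ((?D ^^ j) f) = 0" for j
  proof (induction j rule: less_induct)
    case (less j)
    show ?case
    proof (cases "j < n - m")
      case False
      then have "complete_op (Suc m) j f = 0"
        using f assms(1) by (simp add: complete_kernel_def)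
      moreover have "complete_op (Suc m) j f = (\<Sum>i<j. (?D ^^ i) (complete_op m (j - i) f)) + (?D ^^ j) f"
        unfolding complete_op_expand lessThan_Suc_atMost[symmetric] by simp
      ultimately have "(?D ^^ j) f = - (\<Sum>i<j. (?D ^^ i) (complete_op m (j - i) f))"
        by (simp add: eq_neg_iff_add_eq_0 add.commute)
      then have "constant_part (Suc m) k ((?D ^^ j) f)
          = - (\<Sum>i<j. complete_op m (j - i) (constant_part (Suc m) k ((?D ^^ i) f)))"
        by (simp add: module_hom.neg[OF nc_linear_constant_part] module_hom.sum[OF nc_linear_constant_part]
            complete_op_constant_part complete_op_funpow_hausdorff)
      also have "\<dots> = 0"
        using less.IH by (simp add: module_hom.zero[OF nc_linear_complete_op])
      finally show ?thesis .
    qed (rule zero)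
  qed
qed simp

text \<open>The space is filtered by the vanishing of the first \<open>j\<close> constant parts;
  each of the n - m successive quotients embeds in \<open>complete_kernel n m\<close>, shifted by
  \<open>j\<close> degrees.\<close>

lemma dim_series_complete_kernel_step:
  assumes "m < n"
  shows "fps_le (dim_series (complete_kernel n (Suc m))) (geometric (n - m) * dim_series (complete_kernel n m))"
  unfolding fps_le_def
proof
  fix k
  let ?D = "hausdorff_deriv (Suc m)"
  let ?\<phi> = "\<lambda>j f. constant_part (Suc m) k ((?D ^^ j) f)"
  let ?V = "complete_kernel n (Suc m)"
  define U where "U j = {f \<in> ?V. \<forall>i\<in>{..<j}. ?\<phi> i f = 0}" for j
  have lin: "nc_linear (?\<phi> j)" for j
    by (rule nc_linear_comp[OF nc_linear_constant_part nc_linear_funpow[OF nc_linear_hausdorff]])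
  have U: "nc.subspace (U j)" for j
    unfolding U_def by (intro subspace_common_kernel subspace_complete_kernel lin)
  have UV: "U j \<subseteq> ?V" for j by (auto simp: U_def)
  have VF: "?V \<subseteq> NCPoly n" by (auto simp: complete_kernel_def upper_kernel_def)
  \<comment> \<open>Derivatives of order \<open>j > k\<close> vanish in degree \<open>k\<close>,
    hence the default 0.\<close>
  let ?b = "\<lambda>j. if j \<le> k then nc_dim (complete_kernel n m \<inter> nc_homogeneous (k - j)) else 0"
  have step: "nc_dim (U j \<inter> nc_homogeneous k) \<le> nc_dim (U (Suc j) \<inter> nc_homogeneous k) + ?b j" for j
  proof -
    have ker: "{f \<in> U j. ?\<phi> j f = 0} = U (Suc j)" by (auto simp: U_def less_Suc_eq)
    have "nc_dim (U j \<inter> nc_homogeneous k)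
      = nc_dim (U (Suc j) \<inter> nc_homogeneous k) + nc_dim (?\<phi> j ` (U j \<inter> nc_homogeneous k))"
      unfolding ker[symmetric] by (rule graded_exact[OF U]) (use UV VF lin nc_linear_id in auto)
    moreover have "nc_dim (?\<phi> j ` (U j \<inter> nc_homogeneous k)) \<le> ?b j"
    proof (cases "j \<le> k")
      case True
      have sub: "?\<phi> j ` (U j \<inter> nc_homogeneous k) \<subseteq> complete_kernel n m \<inter> nc_homogeneous (k - j)"
      proof
        fix g assume "g \<in> ?\<phi> j ` (U j \<inter> nc_homogeneous k)"
        then obtain f where f: "f \<in> ?V \<inter> nc_homogeneous k" "g = ?\<phi> j f" using UV by blast
        then show "g \<in> complete_kernel n m \<inter> nc_homogeneous (k - j)"
          using complete_kernel_step_map[OF assms f(1)] constant_part_homogeneous[OF funpow_hausdorff_homogeneous]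
          by simp
      qed
      have "nc.subspace (?\<phi> j ` (U j \<inter> nc_homogeneous k))"
        by (rule module_hom.subspace_image[OF lin nc.subspace_inter[OF U subspace_homogeneous]])
      moreover have "complete_kernel n m \<inter> nc_homogeneous (k - j) \<subseteq> NCPoly n \<inter> nc_homogeneous (k - j)"
        by (auto simp: complete_kernel_def upper_kernel_def)
      ultimately have "nc_dim (?\<phi> j ` (U j \<inter> nc_homogeneous k)) \<le> nc_dim (complete_kernel n m \<inter> nc_homogeneous (k - j))"
        by (rule nc_dim_mono(1)[OF _ nc.subspace_inter[OF subspace_complete_kernel subspace_homogeneous] sub])
      then show ?thesis using True by simp
    next
      case False
      have "?\<phi> j f = 0" if "f \<in> nc_homogeneous k" for f
        using funpow_hausdorff_eq_0[OF that, of j] False by (simp add: module_hom.zero[OF nc_linear_constant_part])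
      moreover have "0 \<in> U j \<inter> nc_homogeneous k"
        by (rule nc.subspace_0[OF nc.subspace_inter[OF U subspace_homogeneous]])
      ultimately have "?\<phi> j ` (U j \<inter> nc_homogeneous k) = {0}" by (auto simp: image_iff)
      then show ?thesis using False by (simp add: nc_dim_zero)
    qed
    ultimately show ?thesis by simp
  qed
  have chain: "nc_dim (U 0 \<inter> nc_homogeneous k) \<le> nc_dim (U r \<inter> nc_homogeneous k) + (\<Sum>j<r. ?b j)" for r
  proof (induction r)
    case (Suc r)
    then show ?case using step[of r] by simp
  qed simp
  have U0: "U 0 = ?V" by (simp add: U_def)
  have Ur: "U (n - m) \<inter> nc_homogeneous k = {0}"
  proof -
    have "0 \<in> U (n - m) \<inter> nc_homogeneous k"
      by (rule nc.subspace_0[OF nc.subspace_inter[OF U subspace_homogeneous]])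
    moreover have "f = 0" if "f \<in> U (n - m) \<inter> nc_homogeneous k" for f
      using complete_kernel_determined[OF assms, of f k] that by (simp add: U_def)
    ultimately show ?thesis by blast
  qed
  have "nc_dim (?V \<inter> nc_homogeneous k) \<le> (\<Sum>j<n - m. ?b j)"
    using chain[of "n - m"] unfolding U0 Ur nc_dim_zero add_0 .
  then show "fps_nth (dim_series ?V) k \<le> fps_nth (geometric (n - m) * dim_series (complete_kernel n m)) k"
    by (simp add: dim_series_def geometric_mult_nth cong: if_cong)
qed

text \<open>The step from m to m + 1 contributes (1 - q^(n-m))/(1 - q); the joint kernel of all
  derivatives supplies the power of 1 - q that clears the denominators.\<close>

lemma dim_series_complete_kernel_le: "fps_le (dim_series (complete_kernel n n)) (qpoch n * dim_series (NCPoly n))"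
proof -
  have "fps_le (dim_series (complete_kernel n m)) ((\<Prod>j<m. geometric (n - j)) * dim_series (complete_kernel n 0))"
    if "m \<le> n" for m
    using that
  proof (induction m)
    case (Suc m)
    have "fps_le (dim_series (complete_kernel n (Suc m))) (geometric (n - m) * dim_series (complete_kernel n m))"
      using Suc.prems by (intro dim_series_complete_kernel_step) simp
    moreover have "fps_le (geometric (n - m) * dim_series (complete_kernel n m))
        (geometric (n - m) * ((\<Prod>j<m. geometric (n - j)) * dim_series (complete_kernel n 0)))"
      using Suc by (intro fps_le_mult geometric_pos) simp
    ultimately show ?case by (auto intro: fps_le_trans simp: mult_ac)
  qed (simp add: fps_le_refl)
  from this[of n] have "fps_le (dim_series (complete_kernel n n)) ((\<Prod>j<n. geometric (n - j)) * dim_series (complete_kernel n 0))"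
    by simp
  also have "complete_kernel n 0 = upper_kernel n 0"
  proof -
    have "complete_op 0 i f = 0" if "n < i" for i f using that by (cases i) auto
    then show ?thesis by (auto simp: complete_kernel_def)
  qed
  also have "dim_series (upper_kernel n 0) = (1 - fps_X) ^ n * dim_series (NCPoly n)"
    using dim_series_upper_kernel[of n n] by simp
  also have "(\<Prod>j<n. geometric (n - j)) * ((1 - fps_X) ^ n * dim_series (NCPoly n))
      = (\<Prod>j<n. geometric (n - j) * (1 - fps_X)) * dim_series (NCPoly n)"
    by (simp add: prod.distrib mult.assoc)
  also have "(\<Prod>j<n. geometric (n - j) * (1 - fps_X)) = qpoch n"
    unfolding geometric_mult qpoch_def
    by (rule prod.reindex_bij_witness[of _ "\<lambda>i. n - i" "\<lambda>j. n - j"]) auto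
  finally show ?thesis .
qed

section \<open>Joint kernels of power sums\<close>

definition power_kernel :: "nat \<Rightarrow> nat \<Rightarrow> ncpoly set"
  where "power_kernel n i = {f \<in> NCPoly n. \<forall>j\<in>{1..i}. power_op n j f = 0}"

lemma subspace_power_kernel: "nc.subspace (power_kernel n i)"
  unfolding power_kernel_def by (intro subspace_common_kernel subspace_NCPoly nc_linear_power_op)

lemma power_op_NCPoly: "f \<in> NCPoly n \<Longrightarrow> power_op m i f \<in> NCPoly n"
  unfolding power_op_def by (intro nc.subspace_sum subspace_NCPoly funpow_hausdorff_NCPoly)

lemma power_op_homogeneous: "f \<in> nc_homogeneous k \<Longrightarrow> power_op m i f \<in> nc_homogeneous (k - i)"
  unfolding power_op_def by (intro nc.subspace_sum subspace_homogeneous funpow_hausdorff_homogeneous)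

lemma power_op_homogeneous_0: "f \<in> nc_homogeneous k \<Longrightarrow> k < i \<Longrightarrow> power_op m i f = 0"
  by (simp add: power_op_def funpow_hausdorff_eq_0)

lemma power_op_power_op: "power_op m i (power_op m j f) = power_op m j (power_op m i f)"
  by (rule power_op_commute[OF nc_linear_power_op power_op_hausdorff, symmetric])

lemma power_kernel_power_op: "f \<in> power_kernel n i \<Longrightarrow> power_op n j f \<in> power_kernel n i"
  by (simp add: power_kernel_def power_op_NCPoly power_op_power_op[of n _ j] module_hom.zero[OF nc_linear_power_op])

lemma power_kernel_Suc: "power_kernel n (Suc i) = {f \<in> power_kernel n i. power_op n (Suc i) f = 0}"
  by (auto simp: power_kernel_def atLeastAtMostSuc_conv)

lemma complete_op_power_op: "complete_op m i (power_op m' j f) = power_op m' j (complete_op m i f)"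
  by (rule complete_op_commute[OF nc_linear_power_op power_op_hausdorff, symmetric])

text \<open>Newton's identity settles \<open>i \<le> n\<close>. For larger \<open>i\<close> the
  number of variables has to vary: removing them one at a time reaches
  \<open>complete_op (n - d) i\<close> for \<open>d < i \<le> n\<close>, and adding them again,
  starting from none, raises \<open>i\<close> beyond \<open>n\<close>.\<close>

lemma power_kernel_complete_op:
  assumes f: "f \<in> power_kernel n n" and "i \<ge> 1"
  shows "complete_op n i f = 0"
proof -
  have base: "complete_op n i f = 0" if "1 \<le> i" "i \<le> n" for i
  proof -
    have "nc_scale (of_nat i) (complete_op n i f) = (\<Sum>j=1..i. complete_op n (i - j) (power_op n j f))"
      by (simp only: newton_identity complete_op_power_op)
    also have "\<dots> = 0"
      using f that by (intro sum.neutral) (simp add: power_kernel_def module_hom.zero[OF nc_linear_complete_op])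
    finally show ?thesis using that by simp
  qed
  have down: "complete_op (n - d) i f = 0" if "d < i" "i \<le> n" for d i
    using that
  proof (induction d arbitrary: i)
    case 0
    then show ?case using base by simp
  next
    case (Suc d)
    then obtain i' where i': "i = Suc i'" by (cases i) auto
    have "n - d = Suc (n - Suc d)" using Suc.prems by simp
    then have "complete_op (n - d) i f = complete_op (n - Suc d) i f + hausdorff_deriv (n - d) (complete_op (n - d) i' f)"
      by (simp add: i')
    then show ?case
      using Suc.IH[of i] Suc.IH[of i'] Suc.prems i' by (simp add: module_hom.zero[OF nc_linear_hausdorff])
  qed
  have up: "complete_op m i f = 0" if "m \<le> n" "n - m < i" for m i
    using that
  proof (induction m arbitrary: i)
    case 0
    then show ?case by (cases i) simp_all
  next
    case (Suc m)
    note m_IH = Suc.IH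
    from Suc.prems show ?case
    proof (induction i)
      case (Suc i)
      show ?case
      proof (cases "Suc i \<le> n")
        case True
        then show ?thesis using down[of "n - Suc m" "Suc i"] Suc.prems by simp
      next
        case False
        then have "complete_op (Suc m) i f = 0" if "i > n - Suc m"
          using Suc.IH Suc.prems that by simp
        moreover have "i > n - Suc m" using False Suc.prems by simp
        moreover have "complete_op m (Suc i) f = 0"
          using m_IH[of "Suc i"] False Suc.prems by simp
        ultimately show ?thesis by (simp add: module_hom.zero[OF nc_linear_hausdorff])
      qed
    qed simp
  qed
  show ?thesis using up[of n i] assms(2) by simp
qed

lemma power_kernel_subset: "power_kernel n n \<subseteq> complete_kernel n n"
  using power_kernel_complete_op by (auto simp: complete_kernel_def upper_kernel_def power_kernel_def)

text \<open>Newton's identity read backwards: the complete operator vanishes, the other terms vanish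
  by induction, and the power sum of degree \<open>k\<close> remains.\<close>

lemma power_kernel_all_power_ops:
  assumes "f \<in> power_kernel n n" "k \<ge> 1"
  shows "power_op n k f = 0"
  using assms(2)
proof (induction k rule: less_induct)
  case (less k)
  have "0 = (\<Sum>i=1..k. complete_op n (k - i) (power_op n i f))"
    using newton_identity[of k n f] power_kernel_complete_op[OF assms(1) less.prems]
    by (simp add: complete_op_power_op)
  also have "\<dots> = (\<Sum>i\<in>{k}. complete_op n (k - i) (power_op n i f))"
  proof (rule sum.mono_neutral_right)
    show "\<forall>i\<in>{1..k} - {k}. complete_op n (k - i) (power_op n i f) = 0"
      using less.IH by (auto simp: module_hom.zero[OF nc_linear_complete_op])
  qed (use less.prems in auto)
  finally show ?case by simp
qed

section \<open>Hausdorff harmonics as a joint kernel of power sums\<close>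

lemma foldr_hausdorff_mset:
  assumes "mset u = mset v"
  shows "foldr hausdorff_deriv u f = foldr hausdorff_deriv v f"
proof -
  have "fold hausdorff_deriv (rev u) = fold hausdorff_deriv (rev v)"
    by (rule fold_multiset_equiv) (auto simp: assms hausdorff_commute)
  then show ?thesis by (simp add: foldr_conv_fold)
qed

lemma foldr_hausdorff_commute:
  assumes "\<And>x f. T (hausdorff_deriv x f) = hausdorff_deriv x (T f)"
  shows "T (foldr hausdorff_deriv w f) = foldr hausdorff_deriv w (T f)"
  by (induction w) (simp_all add: assms)

text \<open>Up to a factor this is a monomial symmetric operator. A power sum times the
  symmetrisation of \<open>v\<close> gives 0; expanded, it contains the wanted term n -
  |\<open>set v\<close>| times, and terms with fewer distinct letters that vanish by
  induction.\<close>

lemma symmetrized_hausdorff_zero: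
  assumes f: "f \<in> power_kernel n n" and "w \<noteq> []" "set w \<subseteq> {1..n}"
  shows "symmetrized_op n hausdorff_deriv w f = 0"
  using assms(2,3)
proof (induction "card (set w)" arbitrary: w rule: less_induct)
  case less
  let ?G = "{\<sigma>. \<sigma> permutes {1..n}}"
  let ?S = "symmetrized_op n hausdorff_deriv"
  obtain i where i: "i \<in> set w" using less.prems(1) by (cases w) auto
  define a where "a = count (mset w) i"
  define v where "v = filter (\<lambda>x. x \<noteq> i) w"
  have a: "a \<ge> 1" using i by (simp add: a_def Suc_le_eq)
  have w: "mset w = mset (replicate a i @ v)"
    by (rule multiset_eqI) (auto simp: a_def v_def)
  have v: "set v = set w - {i}" "i \<notin> set v" by (auto simp: v_def)
  have S_cong: "?S u f = ?S u' f" if "mset u = mset u'" for u u'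
    unfolding symmetrized_op_def by (intro sum.cong refl foldr_hausdorff_mset) (simp add: that)
  \<comment> \<open>The \<open>a\<close> copies of \<open>i\<close> are replaced by copies of
    \<open>l\<close>; summing over \<open>l\<close> produces the power sum of degree
    \<open>a\<close>.\<close>
  define t where "t l = ?S (replicate a l @ v) f" for l
  have "(\<Sum>l\<in>{1..n}. t l) = (\<Sum>\<sigma>\<in>?G. \<Sum>l\<in>{1..n}. (hausdorff_deriv (\<sigma> l) ^^ a) (foldr hausdorff_deriv (map \<sigma> v) f))"
    unfolding t_def symmetrized_op_def by (subst sum.swap) (simp add: foldr_replicate)
  also have "\<dots> = (\<Sum>\<sigma>\<in>?G. power_op n a (foldr hausdorff_deriv (map \<sigma> v) f))"
  proof (intro sum.cong refl)
    fix \<sigma> assume "\<sigma> \<in> ?G"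
    then have "\<sigma> permutes {1..n}" by simp
    from sum.permute[OF this, of "\<lambda>x. (hausdorff_deriv x ^^ a) (foldr hausdorff_deriv (map \<sigma> v) f)"]
    show "(\<Sum>l\<in>{1..n}. (hausdorff_deriv (\<sigma> l) ^^ a) (foldr hausdorff_deriv (map \<sigma> v) f))
        = power_op n a (foldr hausdorff_deriv (map \<sigma> v) f)"
      by (simp add: power_op_def o_def)
  qed
  also have "\<dots> = 0"
  proof (intro sum.neutral ballI)
    fix \<sigma>
    have "power_op n a (foldr hausdorff_deriv (map \<sigma> v) f) = foldr hausdorff_deriv (map \<sigma> v) (power_op n a f)"
      by (rule foldr_hausdorff_commute) (rule power_op_hausdorff)
    also have "\<dots> = 0"
      using power_kernel_all_power_ops[OF f a] module_hom.zero[OF nc_linear_foldr[OF nc_linear_hausdorff]] by simp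
    finally show "power_op n a (foldr hausdorff_deriv (map \<sigma> v) f) = 0" .
  qed
  finally have sum_0: "(\<Sum>l\<in>{1..n}. t l) = 0" .
  \<comment> \<open>If \<open>l\<close> already occurs in \<open>v\<close>, the letter
    \<open>i\<close> is lost and one distinct letter fewer remains.\<close>
  have t_in: "t l = 0" if "l \<in> set v" for l
    unfolding t_def
  proof (rule less.hyps)
    have "set (replicate a l @ v) = set v" using \<open>l \<in> set v\<close> by auto
    then have "set (replicate a l @ v) = set w - {i}" by (simp only: v(1))
    then show "card (set (replicate a l @ v)) < card (set w)"
      using card_Diff1_less[OF _ i] by (simp only: List.finite_set)
    show "replicate a l @ v \<noteq> []" "set (replicate a l @ v) \<subseteq> {1..n}"
      using \<open>l \<in> set v\<close> v(1) less.prems(2) by auto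
  qed
  \<comment> \<open>The transposition of \<open>l\<close> and \<open>i\<close> fixes
    \<open>v\<close> and is absorbed by the sum over all permutations.\<close>
  have t_out: "t l = t i" if "l \<in> {1..n} - set v" for l
  proof -
    let ?s = "transpose l i"
    have s: "?s permutes {1..n}" using that i less.prems(2) by (intro permutes_swap_id) auto
    have "map ?s v = v" using that v by (intro map_idI) (auto simp: transpose_def)
    then have "map ?s (replicate a l @ v) = replicate a i @ v" by simp
    then have "t i = (\<Sum>\<sigma>\<in>?G. foldr hausdorff_deriv (map (\<sigma> \<circ> ?s) (replicate a l @ v)) f)"
      unfolding t_def symmetrized_op_def by (metis map_map)
    also have "\<dots> = t l"
      unfolding t_def symmetrized_op_def
      by (rule sum_permutations_compose_right[OF s, symmetric])
    finally show ?thesis ..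
  qed
  have vn: "set v \<subseteq> {1..n}" using v less.prems(2) by auto
  have "(\<Sum>l\<in>{1..n}. t l) = (\<Sum>l\<in>{1..n} - set v. t l) + (\<Sum>l\<in>set v. t l)"
    by (rule sum.subset_diff[OF vn]) simp
  also have "\<dots> = (\<Sum>l\<in>{1..n} - set v. t i)"
    using t_in t_out by simp
  also have "\<dots> = nc_scale (of_nat (card ({1..n} - set v))) (t i)"
    by (rule nc.sum_constant_scale)
  finally have "nc_scale (of_nat (card ({1..n} - set v))) (t i) = 0" using sum_0 by simp
  moreover have "card ({1..n} - set v) \<noteq> 0" using i v less.prems(2) by (auto simp: card_eq_0_iff)
  ultimately have "t i = 0" by simp
  then show ?case using S_cong[OF w] by (simp add: t_def)
qed

text \<open>The sums of the powers of the letters are symmetric, which gives one inclusion; the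
  other needs every symmetrised word to vanish on the joint kernel.\<close>

lemma MHar_eq_power_kernel: "MHar n = power_kernel n n"
proof
  show "power_kernel n n \<subseteq> MHar n"
    unfolding MHar_def NCSym0_annihilated_iff using symmetrized_hausdorff_zero
    by (auto simp: power_kernel_def)
  show "MHar n \<subseteq> power_kernel n n"
  proof
    fix f assume f: "f \<in> MHar n"
    have "power_op n j f = 0" if "j \<ge> 1" for j
    proof -
      let ?p = "\<Sum>x\<in>{1..n}. word (replicate j x)"
      have "?p \<in> NCPoly n"
        by (intro nc.subspace_sum subspace_NCPoly word_in_NCPoly) auto
      moreover have "permute_vars \<sigma> ?p = ?p" if "\<sigma> permutes {1..n}" for \<sigma>
      proof -
        have "permute_vars \<sigma> ?p = sum ((\<lambda>x. word (replicate j x)) \<circ> \<sigma>) {1..n}"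
          by (simp only: module_hom.sum[OF nc_linear_permute_vars] permute_vars_word map_replicate o_def)
        then show ?thesis by (simp only: sum.permute[OF that, symmetric])
      qed
      moreover have "Poly_Mapping.lookup ?p [] = 0"
        using that by (simp add: lookup_sum lookup_single)
      ultimately have "?p \<in> NCSym0 n" by (simp add: NCSym0_def NCSym_def)
      then have "poly_op hausdorff_deriv ?p f = 0" using f by (simp add: MHar_def)
      then show ?thesis
        by (simp add: poly_op_eq_lin_ext module_hom.sum[OF nc_linear_lin_ext] power_op_def foldr_replicate)
    qed
    then show "f \<in> power_kernel n n" using f by (simp add: power_kernel_def MHar_def)
  qed
qed

lemma power_op_permute_vars:
  assumes "\<sigma> permutes {1..n}"
  shows "power_op n i (permute_vars \<sigma> f) = permute_vars \<sigma> (power_op n i f)"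
proof -
  have pow: "permute_vars \<sigma> ((hausdorff_deriv x ^^ i) f) = (hausdorff_deriv (\<sigma> x) ^^ i) (permute_vars \<sigma> f)" for x
    by (induction i) (simp_all add: permute_vars_hausdorff[OF permutes_inj[OF assms]])
  show ?thesis
    unfolding power_op_def module_hom.sum[OF nc_linear_permute_vars] pow
    using sum.permute[OF assms, of "\<lambda>x. (hausdorff_deriv x ^^ i) (permute_vars \<sigma> f)"] by (simp add: o_def)
qed

section \<open>Surjectivity of the power sums and the resulting traces\<close>

text \<open>The codimension, in degree \<open>k\<close>, of the image of the next power sum inside
  the kernel of the previous ones; the source lies \<open>Suc i\<close> degrees higher.\<close>

definition image_defect :: "nat \<Rightarrow> nat \<Rightarrow> rat fps"
  where "image_defect n i = Abs_fps (\<lambda>k. nc_dim (power_kernel n i \<inter> nc_homogeneous k)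
    - nc_dim (power_op n (Suc i) ` (power_kernel n i \<inter> nc_homogeneous (k + Suc i))))"

lemma power_op_image_subset:
  "power_op n (Suc i) ` (power_kernel n i \<inter> nc_homogeneous (k + Suc i)) \<subseteq> power_kernel n i \<inter> nc_homogeneous k"
  using power_kernel_power_op power_op_homogeneous[where k = "k + Suc i" and i = "Suc i"] by fastforce

lemma subspace_power_op_image: "nc.subspace (power_op n (Suc i) ` (power_kernel n i \<inter> nc_homogeneous k))"
  by (rule module_hom.subspace_image[OF nc_linear_power_op nc.subspace_inter[OF subspace_power_kernel subspace_homogeneous]])

lemma power_kernel_NCPoly: "power_kernel n i \<subseteq> NCPoly n"
  by (auto simp: power_kernel_def)

lemma image_defect_pos: "fps_le 0 (image_defect n i)"
proof -
  have "power_kernel n i \<inter> nc_homogeneous k \<subseteq> NCPoly n \<inter> nc_homogeneous k" for k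
    using power_kernel_NCPoly by blast
  from nc_dim_mono(1)[OF subspace_power_op_image nc.subspace_inter[OF subspace_power_kernel subspace_homogeneous]
      power_op_image_subset this]
  show ?thesis by (simp add: fps_le_def image_defect_def)
qed

text \<open>\<open>T\<close> is abstract because the sequence is used twice: with the identity for
  dimensions and with \<open>permute_vars\<close> for traces.\<close>

lemma trace_power_kernel_Suc:
  assumes T: "nc_linear T" "\<And>f. f \<in> power_kernel n i \<Longrightarrow> T f \<in> power_kernel n i"
      "\<And>k f. f \<in> nc_homogeneous k \<Longrightarrow> T f \<in> nc_homogeneous k"
      "\<And>f. power_op n (Suc i) (T f) = T (power_op n (Suc i) f)"
  shows "nc.trace_on (power_kernel n i \<inter> nc_homogeneous k) T
    = nc.trace_on (power_kernel n (Suc i) \<inter> nc_homogeneous k) T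
      + (if k < Suc i then 0 else nc.trace_on (power_op n (Suc i) ` (power_kernel n i \<inter> nc_homogeneous k)) T)"
proof -
  have "nc.trace_on (power_kernel n i \<inter> nc_homogeneous k) T
    = nc.trace_on (power_kernel n (Suc i) \<inter> nc_homogeneous k) T
      + nc.trace_on (power_op n (Suc i) ` (power_kernel n i \<inter> nc_homogeneous k)) T"
    unfolding power_kernel_Suc
    by (rule graded_exact[OF subspace_power_kernel power_kernel_NCPoly T(1-3) nc_linear_power_op T(4)])
  moreover have "nc.trace_on (power_op n (Suc i) ` (power_kernel n i \<inter> nc_homogeneous k)) T = 0" if "k < Suc i"
  proof -
    have "0 \<in> power_kernel n i \<inter> nc_homogeneous k"
      by (rule nc.subspace_0[OF nc.subspace_inter[OF subspace_power_kernel subspace_homogeneous]])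
    then have "power_op n (Suc i) ` (power_kernel n i \<inter> nc_homogeneous k) = {0}"
      using power_op_homogeneous_0[OF _ that] by (auto simp: image_iff)
    then show ?thesis by (simp add: trace_on_zero[OF T(1)])
  qed
  ultimately show ?thesis by auto
qed

lemma dim_series_power_kernel_Suc:
  "dim_series (power_kernel n (Suc i))
    = (1 - fps_X ^ Suc i) * dim_series (power_kernel n i) + fps_X ^ Suc i * image_defect n i"
proof (rule fps_ext)
  fix k
  show "fps_nth (dim_series (power_kernel n (Suc i))) k
    = fps_nth ((1 - fps_X ^ Suc i) * dim_series (power_kernel n i) + fps_X ^ Suc i * image_defect n i) k"
    using trace_power_kernel_Suc[of "\<lambda>f. f" n i k, OF nc_linear_id]
    by (simp add: left_diff_distrib fps_X_power_mult_nth dim_series_def image_defect_def del: power_Suc)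
qed

text \<open>After division of the \<open>i\<close>-th dimension series by \<open>qpoch i\<close>,
  each step adds a nonnegative series \<open>e i\<close>. The bound through
  \<open>complete_kernel\<close> leaves no room for a positive total, so each \<open>e i\<close> is
  zero.\<close>

lemma image_defect_zero:
  assumes "i < n"
  shows "image_defect n i = 0"
proof -
  define F where "F = dim_series (NCPoly n)"
  define e where "e i = fps_X ^ Suc i * (inverse (qpoch (Suc i)) * image_defect n i)" for i
  have e_pos: "fps_le 0 (e i)" for i
    unfolding e_def by (intro fps_le_mult_pos fps_le_0_X_power inverse_qpoch_pos image_defect_pos)
  have sum: "inverse (qpoch m) * dim_series (power_kernel n m) = F + (\<Sum>i<m. e i)" for m
  proof (induction m)
    case 0
    then show ?case by (simp add: qpoch_def power_kernel_def F_def)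
  next
    case (Suc m)
    have "inverse (qpoch (Suc m)) * (1 - fps_X ^ Suc m) = inverse (qpoch m)"
    proof -
      have "(1 - fps_X ^ Suc m) * inverse (1 - fps_X ^ Suc m) = (1 :: rat fps)"
        by (rule inverse_mult_cancel_fps) simp
      moreover have "fps_nth (1 - fps_X ^ Suc m :: rat fps) 0 \<noteq> 0" by simp
      ultimately show ?thesis
        by (simp only: qpoch_Suc fps_inverse_mult mult.assoc mult.commute[of "inverse (1 - fps_X ^ Suc m)"] mult_1_right)
    qed
    then have "inverse (qpoch (Suc m)) * dim_series (power_kernel n (Suc m))
        = inverse (qpoch m) * dim_series (power_kernel n m) + e m"
    proof -
      assume q: "inverse (qpoch (Suc m)) * (1 - fps_X ^ Suc m) = inverse (qpoch m)"
      have "a * (b * c + d * x) = (a * b) * c + d * (a * x)" for a b c d x :: "rat fps"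
        by (simp add: algebra_simps)
      then show ?thesis unfolding dim_series_power_kernel_Suc e_def by (simp only: q)
    qed
    then show ?case using Suc by simp
  qed
  have "fps_le (dim_series (power_kernel n n)) (dim_series (complete_kernel n n))"
    unfolding fps_le_def dim_series_def fps_nth_Abs_fps
  proof
    fix k
    show "nc_dim (power_kernel n n \<inter> nc_homogeneous k) \<le> nc_dim (complete_kernel n n \<inter> nc_homogeneous k)"
    proof (rule nc_dim_mono(1)[OF nc.subspace_inter[OF subspace_power_kernel subspace_homogeneous]
        nc.subspace_inter[OF subspace_complete_kernel subspace_homogeneous]])
      show "power_kernel n n \<inter> nc_homogeneous k \<subseteq> complete_kernel n n \<inter> nc_homogeneous k"
        using power_kernel_subset[of n] by blast
      show "complete_kernel n n \<inter> nc_homogeneous k \<subseteq> NCPoly n \<inter> nc_homogeneous k"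
        by (auto simp: complete_kernel_def upper_kernel_def)
    qed
  qed
  then have "fps_le (dim_series (power_kernel n n)) (qpoch n * F)"
    unfolding F_def by (rule fps_le_trans[OF _ dim_series_complete_kernel_le])
  \<comment> \<open>Multiplication by the inverse of \<open>qpoch n\<close> preserves the bound
    because its coefficients are nonnegative.\<close>
  from fps_le_mult[OF inverse_qpoch_pos[of n] this] have "fps_le (F + (\<Sum>i<n. e i)) F"
    by (simp only: sum mult.assoc[symmetric] mult.commute[of "inverse (qpoch n)" "qpoch n"] qpoch_inverse mult_1_left)
  then have le: "(\<Sum>i<n. fps_nth (e i) k) \<le> 0" for k
    by (simp add: fps_le_def fps_sum_nth)
  have nonneg: "0 \<le> fps_nth (e j) k" for j k
    using e_pos by (simp add: fps_le_def)
  have "fps_nth (e i) k = 0" for k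
  proof -
    have "(\<Sum>i<n. fps_nth (e i) k) = 0"
      using le[of k] sum_nonneg[of "{..<n}" "\<lambda>i. fps_nth (e i) k"] nonneg by simp
    then show ?thesis
      using sum_nonneg_eq_0_iff[of "{..<n}" "\<lambda>i. fps_nth (e i) k"] nonneg assms by simp
  qed
  then have "e i = 0" by (simp add: fps_eq_iff)
  moreover have "inverse (qpoch (Suc i)) \<noteq> 0" by (simp add: qpoch_nth_0)
  ultimately show ?thesis by (simp add: e_def)
qed

lemma power_op_surjective:
  assumes "i < n"
  shows "power_op n (Suc i) ` (power_kernel n i \<inter> nc_homogeneous (k + Suc i)) = power_kernel n i \<inter> nc_homogeneous k"
proof (rule nc_dim_mono(2)[OF subspace_power_op_image nc.subspace_inter[OF subspace_power_kernel subspace_homogeneous] power_op_image_subset])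
  show "power_kernel n i \<inter> nc_homogeneous k \<subseteq> NCPoly n \<inter> nc_homogeneous k"
    using power_kernel_NCPoly by blast
  show "nc_dim (power_op n (Suc i) ` (power_kernel n i \<inter> nc_homogeneous (k + Suc i))) = nc_dim (power_kernel n i \<inter> nc_homogeneous k)"
    using image_defect_zero[OF assms] by (simp add: image_defect_def fps_eq_iff)
qed

text \<open>Surjectivity, though proved by counting dimensions, identifies the image with a
  \<sigma>-stable kernel, so the step to \<open>Suc i\<close> multiplies the traces by 1 -
  q^(i+1).\<close>

lemma trace_MHar:
  assumes s: "\<sigma> permutes {1..n}"
  shows "nc.trace_on (MHar n \<inter> nc_homogeneous k) (permute_vars \<sigma>)
    = fps_nth (qpoch n * inverse (1 - of_nat (num_fix {1..n} \<sigma>) * fps_X)) k"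
proof -
  define T where "T i = Abs_fps (\<lambda>k. nc.trace_on (power_kernel n i \<inter> nc_homogeneous k) (permute_vars \<sigma>))" for i
  have stable: "permute_vars \<sigma> f \<in> power_kernel n i" if "f \<in> power_kernel n i" for f i
    using that by (simp add: power_kernel_def power_op_permute_vars[OF s] permute_vars_NCPoly[OF s]
        module_hom.zero[OF nc_linear_permute_vars])
  have step: "T i = qpoch i * T 0" if "i \<le> n" for i
    using that
  proof (induction i)
    case (Suc i)
    have "T (Suc i) = (1 - fps_X ^ Suc i) * T i"
    proof (rule fps_ext)
      fix k
      have "power_op n (Suc i) ` (power_kernel n i \<inter> nc_homogeneous k) = power_kernel n i \<inter> nc_homogeneous (k - Suc i)"
        if "\<not> k < Suc i"
        using power_op_surjective[of i n "k - Suc i"] Suc.prems that by simp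
      then show "fps_nth (T (Suc i)) k = fps_nth ((1 - fps_X ^ Suc i) * T i) k"
        using trace_power_kernel_Suc[OF nc_linear_permute_vars[of \<sigma>] stable permute_vars_homogeneous power_op_permute_vars[OF s], of i k]
        by (auto simp: left_diff_distrib fps_X_power_mult_nth T_def simp del: power_Suc)
    qed
    then show ?case using Suc by (simp add: qpoch_Suc mult_ac del: power_Suc)
  qed (simp add: qpoch_def)
  have "T n = qpoch n * T 0" by (rule step) simp
  moreover have "T 0 = inverse (1 - of_nat (num_fix {1..n} \<sigma>) * fps_X)"
    by (rule fps_ext) (simp add: T_def power_kernel_def trace_NCPoly[OF s, unfolded One_nat_def] inverse_one_minus_nth)
  ultimately have "fps_nth (T n) k = fps_nth (qpoch n * inverse (1 - of_nat (num_fix {1..n} \<sigma>) * fps_X)) k"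
    by (simp only:)
  then show ?thesis
    unfolding MHar_eq_power_kernel by (simp add: T_def)
qed

theorem theorem2p2:
  fixes n :: nat
  assumes "n \<ge> 1"
  shows "nc_graded_Frob n (MHar n) =
      mp_const (qpoch n) *
      (\<Sum>d=0..n. mp_const (fps_X ^ d / qbrace d) * (complete_h (n - d) * complete_h 1 ^ d))
    \<and> nc_graded_Frob n (NCHar n) =
      mp_const (inverse (\<Sum>d=0..n. fps_X ^ d / qbrace d)) *
      (\<Sum>d=0..n. mp_const (fps_X ^ d / qbrace d) * (complete_h (n - d) * complete_h 1 ^ d))"
proof
  show "nc_graded_Frob n (MHar n) =
      mp_const (qpoch n) *
      (\<Sum>d=0..n. mp_const (fps_X ^ d / qbrace d) * (complete_h (n - d) * complete_h 1 ^ d))"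
    by (rule nc_graded_Frob_eq[OF trace_MHar])
  show "nc_graded_Frob n (NCHar n) =
      mp_const (inverse (\<Sum>d=0..n. fps_X ^ d / qbrace d)) *
      (\<Sum>d=0..n. mp_const (fps_X ^ d / qbrace d) * (complete_h (n - d) * complete_h 1 ^ d))"
    by (rule nc_graded_Frob_eq[OF trace_NCHar])
qed

end
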